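(* The set $$\{\mathrm{sys}(S)\mid S \text{ is a closed semi-arithmetic Riemann surface}\}$$ is dense in the positive real numbers.
   Context: $\mathbb{H}$ is the upper half-plane with the hyperbolic metric. A closed Riemann surface of genus $g\ge 2$ is $S=\Gamma\backslash\mathbb{H}$ for a Fuchsian group (discrete subgroup) $\Gamma<\mathrm{PSL}(2,\mathbb{R})$, and carries the induced hyperbolic metric; $\mathrm{sys}(S)$ (the systole) is the minimal length of a closed geodesic of $S$. All surfaces considered have genus at least $2$, and the genus is allowed to vary. Semi-arithmetic: for $\gamma\in\mathrm{PSL}(2,\mathbb{R})$, $\mathrm{Tr}\,\gamma$ is the absolute value of the trace of a lift of $\gamma$ to $\mathrm{SL}(2,\mathbb{R})$. For a Fuchsian group $\Gamma$, $\Gamma^{(2)}$ is the subgroup generated by $\{\gamma^2\mid\gamma\in\Gamma\}$, and $k\Gamma=\mathbb{Q}(\mathrm{Tr}\,\gamma\mid\gamma\in\Gamma^{(2)})$ is the invariant trace field. A cofinite Fuchsian group $\Gamma$ is semi-arithmetic if $k\Gamma$ is a totally real number field and $\mathrm{Tr}\,\gamma$ lies in the ring of integers of $k\Gamma$ for all $\gamma\in\Gamma^{(2)}$. A Riemann surface $S=\Gamma\backslash\mathbb{H}$ is semi-arithmetic if $\Gamma$ is. *)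

theory Defs
  imports
    "HOL-Analysis.Analysis"
    "HOL-Algebra.Coset"
    "HOL-Algebra.Group_Action"
    "HOL-Algebra.Generated_Groups"
    "HOL-Algebra.Generated_Fields"
    "HOL-Algebra.Embedded_Algebras"
    "HOL-Algebra.Algebraic_Closure_Type"
begin

section \<open>The group PSL(2,R)\<close>

definition SL2R :: "(real^2^2) monoid" where
  "SL2R = \<lparr>carrier = {A. det A = 1}, mult = (**), one = mat 1\<rparr>"

definition SL2R_center :: "(real^2^2) set" where
  "SL2R_center = {mat 1, - mat 1}"

text \<open>Elements of PSL(2,R) are the cosets \<open>{A, -A}\<close>.\<close>

definition PSL2R :: "(real^2^2) set monoid" where
  "PSL2R = SL2R Mod SL2R_center"

text \<open>The quotient topology, where SL(2,R) is topologised as a subset of the space of matrices.\<close>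

definition PSL2R_topology :: "(real^2^2) set topology" where
  "PSL2R_topology = topology (\<lambda>U. U \<subseteq> carrier PSL2R \<and> openin (top_of_set (carrier SL2R)) (\<Union>U))"

definition psl_lift :: "(real^2^2) set \<Rightarrow> real^2^2" where
  "psl_lift \<gamma> = (SOME A. A \<in> \<gamma>)"

text \<open>Neither the absolute value of the trace nor the Moebius action depends on the lift; see
  \<open>psl_trace_coset\<close> and \<open>psl_act_coset\<close> below.\<close>

definition psl_trace :: "(real^2^2) set \<Rightarrow> real" where
  "psl_trace \<gamma> = \<bar>trace (psl_lift \<gamma>)\<bar>"

definition moebius :: "real^2^2 \<Rightarrow> complex \<Rightarrow> complex" where
  "moebius A z = (of_real (A$1$1) * z + of_real (A$1$2)) / (of_real (A$2$1) * z + of_real (A$2$2))"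

definition psl_act :: "(real^2^2) set \<Rightarrow> complex \<Rightarrow> complex" where
  "psl_act \<gamma> = moebius (psl_lift \<gamma>)"

section \<open>The hyperbolic plane and its quotients\<close>

definition upper_half_plane :: "complex set" where
  "upper_half_plane = {z. Im z > 0}"

definition hyp_dist :: "complex \<Rightarrow> complex \<Rightarrow> real" where
  "hyp_dist z w = arcosh (1 + (cmod (z - w))\<^sup>2 / (2 * Im z * Im w))"

definition fuchsian :: "(real^2^2) set set \<Rightarrow> bool" where
  "fuchsian \<Gamma> \<longleftrightarrow> subgroup \<Gamma> PSL2R \<and> subtopology PSL2R_topology \<Gamma> = discrete_topology \<Gamma>"

text \<open>The points of the quotient of the upper half-plane by \<open>\<Gamma>\<close> are the orbits of \<open>\<Gamma>\<close>.\<close>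

definition quotient_surface :: "(real^2^2) set set \<Rightarrow> complex set set" where
  "quotient_surface \<Gamma> = orbits (PSL2R\<lparr>carrier := \<Gamma>\<rparr>) upper_half_plane psl_act"

text \<open>The distance function of the induced hyperbolic metric. It is a metric when
  \<open>\<Gamma>\<close> is Fuchsian.\<close>

definition quotient_dist :: "(real^2^2) set set \<Rightarrow> complex set \<Rightarrow> complex set \<Rightarrow> real" where
  "quotient_dist \<Gamma> p q =
     (if p \<in> quotient_surface \<Gamma> \<and> q \<in> quotient_surface \<Gamma>
      then Inf {hyp_dist z w | z w. z \<in> p \<and> w \<in> q} else 0)"

text \<open>The quotient is a closed hyperbolic surface if \<open>\<Gamma>\<close> is Fuchsian, acts freely
  (so that the quotient map is a covering and the hyperbolic metric descends without cone points)
  and has compact quotient. The genus is then automatically at least 2, by Gauss--Bonnet.\<close>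

definition closed_surface_group :: "(real^2^2) set set \<Rightarrow> bool" where
  "closed_surface_group \<Gamma> \<longleftrightarrow>
     fuchsian \<Gamma> \<and>
     (\<forall>\<gamma>\<in>\<Gamma>. \<forall>z\<in>upper_half_plane. psl_act \<gamma> z = z \<longrightarrow> \<gamma> = \<one>\<^bsub>PSL2R\<^esub>) \<and>
     compact_space (Metric_space.mtopology (quotient_surface \<Gamma>) (quotient_dist \<Gamma>))"

text \<open>Finite hyperbolic area of the quotient, computed on a Borel set that meets every orbit
  exactly once.\<close>

definition cofinite_fuchsian :: "(real^2^2) set set \<Rightarrow> bool" where
  "cofinite_fuchsian \<Gamma> \<longleftrightarrow>
     fuchsian \<Gamma> \<and>
     (\<exists>F \<in> sets borel. F \<subseteq> upper_half_plane \<and> (\<forall>p\<in>quotient_surface \<Gamma>. \<exists>!z. z \<in> F \<inter> p) \<and>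
        (\<integral>\<^sup>+ z\<in>F. ennreal (1 / (Im z)\<^sup>2) \<partial>lborel) < \<infinity>)"

section \<open>Closed geodesics and the systole of a metric space\<close>

text \<open>Unit-speed geodesics, as locally distance-preserving maps on the line.\<close>

definition geodesic_line :: "'a set \<Rightarrow> ('a \<Rightarrow> 'a \<Rightarrow> real) \<Rightarrow> (real \<Rightarrow> 'a) \<Rightarrow> bool" where
  "geodesic_line M d c \<longleftrightarrow>
     range c \<subseteq> M \<and>
     (\<forall>t. \<exists>\<epsilon>>0. \<forall>r\<in>{t-\<epsilon><..<t+\<epsilon>}. \<forall>s\<in>{t-\<epsilon><..<t+\<epsilon>}. d (c r) (c s) = \<bar>r - s\<bar>)"

definition closed_geodesic_lengths :: "'a set \<Rightarrow> ('a \<Rightarrow> 'a \<Rightarrow> real) \<Rightarrow> real set" where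
  "closed_geodesic_lengths M d =
     {l. l > 0 \<and> (\<exists>c. geodesic_line M d c \<and> (\<forall>t. c (t + l) = c t))}"

text \<open>The minimum exists for every closed hyperbolic surface.\<close>

definition systole :: "'a set \<Rightarrow> ('a \<Rightarrow> 'a \<Rightarrow> real) \<Rightarrow> real" where
  "systole M d = (LEAST l. l \<in> closed_geodesic_lengths M d)"

section \<open>Semi-arithmetic Fuchsian groups\<close>

definition square_subgroup :: "(real^2^2) set set \<Rightarrow> (real^2^2) set set" where
  "square_subgroup \<Gamma> = generate PSL2R {\<gamma> \<otimes>\<^bsub>PSL2R\<^esub> \<gamma> | \<gamma>. \<gamma> \<in> \<Gamma>}"

abbreviation real_ring :: "real ring" where
  "real_ring \<equiv> ring_of_type_algebra"

abbreviation complex_ring :: "complex ring" where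
  "complex_ring \<equiv> ring_of_type_algebra"

definition invariant_trace_field :: "(real^2^2) set set \<Rightarrow> real set" where
  "invariant_trace_field \<Gamma> = generate_field real_ring (psl_trace ` square_subgroup \<Gamma>)"

definition totally_real_number_field :: "real set \<Rightarrow> bool" where
  "totally_real_number_field K \<longleftrightarrow>
     subfield K real_ring \<and> ring.finite_dimension real_ring \<rat> K \<and>
     (\<forall>\<sigma> \<in> ring_hom (real_ring\<lparr>carrier := K\<rparr>) complex_ring. \<sigma> ` K \<subseteq> \<real>)"

definition ring_of_integers :: "real set \<Rightarrow> real set" where
  "ring_of_integers K = {x \<in> K. algebraic_int x}"

definition semi_arithmetic :: "(real^2^2) set set \<Rightarrow> bool" where
  "semi_arithmetic \<Gamma> \<longleftrightarrow>
     cofinite_fuchsian \<Gamma> \<and>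
     totally_real_number_field (invariant_trace_field \<Gamma>) \<and>
     (\<forall>\<gamma>\<in>square_subgroup \<Gamma>. psl_trace \<gamma> \<in> ring_of_integers (invariant_trace_field \<Gamma>))"

section \<open>Well-definedness\<close>

lemma group_SL2R: "group SL2R"
proof (rule groupI)
  fix A assume "A \<in> carrier SL2R"
  hence A: "det A = 1" by (simp add: SL2R_def)
  then obtain B where B: "A ** B = mat 1" "B ** A = mat 1"
    using invertible_det_nz[of A] unfolding invertible_def by auto
  have "det (B ** A) = 1" by (simp add: B)
  hence "det B = 1" using A by (simp add: det_mul)
  with B show "\<exists>B\<in>carrier SL2R. B \<otimes>\<^bsub>SL2R\<^esub> A = \<one>\<^bsub>SL2R\<^esub>" by (auto simp: SL2R_def)
qed (auto simp: SL2R_def det_mul matrix_mul_assoc)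

lemma mult_minus_one: "(- mat 1) ** (A::real^2^2) = - A" "A ** (- mat 1) = - A"
  by (simp_all add: vec_eq_iff matrix_matrix_mult_def mat_def sum_2 forall_2)

lemma subgroup_center: "subgroup SL2R_center SL2R"
proof -
  have d: "det (- mat 1 :: real^2^2) = 1" by (simp add: det_2 mat_def)
  show ?thesis
  proof (rule group.subgroupI[OF group_SL2R])
    fix A assume "A \<in> SL2R_center"
    then have "A \<in> carrier SL2R" "A \<otimes>\<^bsub>SL2R\<^esub> A = \<one>\<^bsub>SL2R\<^esub>"
      using d by (auto simp: SL2R_def SL2R_center_def mult_minus_one)
    then have "inv\<^bsub>SL2R\<^esub> A = A"
      by (metis group.inv_equality[OF group_SL2R])
    with \<open>A \<in> SL2R_center\<close> show "inv\<^bsub>SL2R\<^esub> A \<in> SL2R_center" by simp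
  qed (use d in \<open>auto simp: SL2R_def SL2R_center_def mult_minus_one\<close>)
qed

lemma normal_center: "SL2R_center \<lhd> SL2R"
  by (rule group.normalI[OF group_SL2R subgroup_center])
     (auto simp: SL2R_center_def r_coset_def l_coset_def SL2R_def mult_minus_one)

lemma group_PSL2R: "group PSL2R"
  unfolding PSL2R_def by (rule normal.factorgroup_is_group[OF normal_center])

lemma carrier_PSL2R: "carrier PSL2R = {{A, - A} | A. det A = 1}"
  by (auto simp: PSL2R_def FactGroup_def RCOSETS_def r_coset_def SL2R_center_def SL2R_def
      mult_minus_one)

lemma psl_trace_coset: "psl_trace {A, - A} = \<bar>trace A\<bar>"
proof -
  have "psl_lift {A, - A} \<in> {A, - A}" unfolding psl_lift_def by (rule someI[of _ A]) simp
  then show ?thesis by (auto simp: psl_trace_def trace_def sum_2)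
qed

lemma psl_act_coset: "psl_act {A, - A} = moebius A"
proof -
  have "moebius (- A) z = moebius A z" for z
    using minus_divide_divide[of "of_real (A$1$1) * z + of_real (A$1$2)"
        "of_real (A$2$1) * z + of_real (A$2$2)"]
    by (simp add: moebius_def)
  moreover have "psl_lift {A, - A} \<in> {A, - A}"
    unfolding psl_lift_def by (rule someI[of _ A]) simp
  ultimately show ?thesis by (auto simp: psl_act_def)
qed

lemma openin_PSL2R_topology:
  "openin PSL2R_topology U \<longleftrightarrow>
     U \<subseteq> carrier PSL2R \<and> openin (top_of_set (carrier SL2R)) (\<Union>U)"
proof -
  have Int: "\<Union>(S \<inter> T) = \<Union>S \<inter> \<Union>T" if "S \<subseteq> carrier PSL2R" "T \<subseteq> carrier PSL2R" for S T
  proof -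
    have "P = Q" if "P \<in> carrier PSL2R" "Q \<in> carrier PSL2R" "A \<in> P" "A \<in> Q" for P Q A
      using that by (auto simp: carrier_PSL2R)
    with that show ?thesis by blast
  qed
  have "istopology (\<lambda>U. U \<subseteq> carrier PSL2R \<and> openin (top_of_set (carrier SL2R)) (\<Union>U))"
    unfolding istopology_def
  proof (intro conjI allI impI)
    fix \<K> assume K: "\<forall>U\<in>\<K>. U \<subseteq> carrier PSL2R \<and> openin (top_of_set (carrier SL2R)) (\<Union>U)"
    show "\<Union>\<K> \<subseteq> carrier PSL2R" using K by blast
    have "\<Union>(\<Union>\<K>) = \<Union>((\<lambda>U. \<Union>U) ` \<K>)" by blast
    then show "openin (top_of_set (carrier SL2R)) (\<Union>(\<Union>\<K>))"
      using K by (metis (no_types, lifting) imageE openin_Union)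
  qed (auto simp: Int)
  then show ?thesis by (simp add: PSL2R_topology_def topology_inverse')
qed

end

theory Submission
  imports "Jordan_Normal_Form.Char_Poly" Defs
begin

text \<open>For \<open>u \<in> (0, 1]\<close> consider the reflection group of the right-angled hexagon with alternating side lengths
  \<open>arcosh (1 + u)\<close> and \<open>arcosh (1 + 1 / u)\<close>. All these groups are the same Coxeter group, so the congruence subgroup of
  level \<open>m\<close> of its integral reflection representation at \<open>u = 1\<close> gives a family of closed surfaces depending continuously
  on \<open>u\<close>. Given \<open>L > 0\<close>, a large \<open>m\<close> makes the systole at \<open>u = 1\<close> larger than \<open>L\<close>, whereas for \<open>u \<rightarrow> 0\<close> a power of the
  product of two reflections becomes a closed geodesic shorter than \<open>L\<close>; near a fixed \<open>u\<close> only finitely many words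
  compete for the systole, which is therefore continuous in \<open>u\<close> and takes the value \<open>L\<close>.
  All traces lie in \<open>\<int>[u, 1 / u]\<close>. When \<open>u = 2 cos (2\<pi>j / n)\<close> with \<open>n\<close> odd, \<open>u\<close> is a unit and this ring consists of totally
  real algebraic integers, so the surface is semi-arithmetic; such \<open>u\<close> are dense.

  The systole of a closed surface is \<open>2 arcosh (t / 2)\<close> for the least trace \<open>t\<close>: a local geodesic with period \<open>l\<close>
  lifts to a sequence of equally spaced points on one line, which an element of the group translates by \<open>l\<close>.\<close>

text \<open>The trigonometry of a right-angled hexagon with alternating side lengths a and b is the
  single relation (cosh a - 1) (cosh b - 1) = 1, which is why u and 1 / u appear together. The Gram
  entry of opposite sides is a square root, and only its square 2 (1 + u) (1 + 1 / u) + 1 lies in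
  the ring generated by u and 1 / u. Hence the groups consist of words with evenly many letters of
  each of the two types of sides: the root then disappears from the traces. The same parity gives
  freeness, because a reduced word that fixes a point of the hexagon has at most one letter of each
  type. At u = 1 the root is 3, so the Gram matrix is integral. All estimates rest on one fact that
  is uniform in u: for u at most 1, each letter of a reduced word raises the cosh of the
  displacement of the centre by at least 2/3. Integrality and total reality come from the same
  matrix: multiplication by a cyclotomic number is a symmetric circulant matrix, and every conjugate
  of the number is a root of its characteristic polynomial.\<close>

no_notation fps_nth (infixl "$" 75)
no_notation Matrix.vec_index (infixl "$" 100)

section \<open>Real 2 by 2 matrices\<close>

definition mat2 :: "real \<Rightarrow> real \<Rightarrow> real \<Rightarrow> real \<Rightarrow> real^2^2" where
  "mat2 a b c d = vector [vector [a, b], vector [c, d]]"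

lemma mat2_nth [simp]:
  "mat2 a b c d $ 1 $ 1 = a" "mat2 a b c d $ 1 $ 2 = b"
  "mat2 a b c d $ 2 $ 1 = c" "mat2 a b c d $ 2 $ 2 = d"
  by (simp_all add: mat2_def)

lemma mat2_eta: "A = mat2 (A$1$1) (A$1$2) (A$2$1) (A$2$2)"
  by (simp add: vec_eq_iff forall_2)

lemma mat2_cases: obtains a b c d where "A = mat2 a b c d"
  using mat2_eta by blast

lemma mat2_eq_iff [simp]:
  "mat2 a b c d = mat2 a' b' c' d' \<longleftrightarrow> a = a' \<and> b = b' \<and> c = c' \<and> d = d'"
  by (auto simp: vec_eq_iff forall_2)

lemma mat2_mult [simp]:
  "mat2 a b c d ** mat2 a' b' c' d' =
     mat2 (a * a' + b * c') (a * b' + b * d') (c * a' + d * c') (c * b' + d * d')"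
  by (simp add: vec_eq_iff forall_2 matrix_matrix_mult_def sum_2)

lemma mat2_one: "mat 1 = mat2 1 0 0 1"
  by (simp add: vec_eq_iff forall_2 mat_def)

lemma mat2_linear [simp]:
  "- mat2 a b c d = mat2 (-a) (-b) (-c) (-d)"
  "mat2 a b c d + mat2 a' b' c' d' = mat2 (a + a') (b + b') (c + c') (d + d')"
  "mat2 a b c d - mat2 a' b' c' d' = mat2 (a - a') (b - b') (c - c') (d - d')"
  "s *\<^sub>R mat2 a b c d = mat2 (s * a) (s * b) (s * c) (s * d)"
  by (simp_all add: vec_eq_iff forall_2)

lemma mat2_trace [simp]: "trace (mat2 a b c d) = a + d"
  by (simp add: trace_def sum_2)

lemma mat2_det [simp]: "det (mat2 a b c d) = a * d - b * c"
  by (simp add: det_2)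

text \<open>The adjugate is the inverse times the determinant. For determinant -1 this sign is what
  keeps \<open>A ** hmat z ** adj2 A\<close> on the sheet of the hyperboloid that contains
  \<open>hmat z\<close>.\<close>

definition adj2 :: "real^2^2 \<Rightarrow> real^2^2" where
  "adj2 A = mat2 (A$2$2) (- A$1$2) (- A$2$1) (A$1$1)"

lemma adj2_mat2 [simp]: "adj2 (mat2 a b c d) = mat2 d (-b) (-c) a"
  by (simp add: adj2_def)

lemma adj2_mult: "adj2 (A ** B) = adj2 B ** adj2 A"
  by (cases A rule: mat2_cases, cases B rule: mat2_cases) simp

lemma adj2_minus: "adj2 (- A) = - adj2 A"
  by (cases A rule: mat2_cases) simp

lemma adj2_cancel: "A ** adj2 A = det A *\<^sub>R mat 1" "adj2 A ** A = det A *\<^sub>R mat 1"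
  for A :: "real^2^2"
  by (cases A rule: mat2_cases, simp add: mat2_one algebra_simps)+

lemma matrix_scaleR_right: "A ** (s *\<^sub>R B) = s *\<^sub>R (A ** B)"
  and matrix_scaleR_left: "(s *\<^sub>R A) ** B = s *\<^sub>R (A ** B)" for A B :: "real^2^2"
  by (cases A rule: mat2_cases, cases B rule: mat2_cases, simp add: algebra_simps)+

lemma matrix_minus_left: "(- A) ** B = - (A ** B)"
  and matrix_minus_right: "A ** (- B) = - (A ** B)" for A B :: "real^2^2"
  by (cases A rule: mat2_cases, cases B rule: mat2_cases, simp add: algebra_simps)+

lemma trace_cyclic: "trace (A ** B) = trace (B ** A)" for A B :: "real^2^2"
  by (cases A rule: mat2_cases, cases B rule: mat2_cases) (simp add: algebra_simps)

lemma trace_scaleR: "trace (s *\<^sub>R A :: real^2^2) = s * trace A"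
  by (cases A rule: mat2_cases) (simp add: algebra_simps)

lemma trace_minus: "trace (- A :: real^2^2) = - trace A"
  by (cases A rule: mat2_cases) simp

lemma trace_plus: "trace (A + B :: real^2^2) = trace A + trace B"
  by (cases A rule: mat2_cases, cases B rule: mat2_cases) simp

lemma trace_square: "trace (A ** A) = (trace A)\<^sup>2 - 2 * det (A :: real^2^2)"
  by (cases A rule: mat2_cases) (simp add: algebra_simps power2_eq_square)

section \<open>The hyperbolic plane\<close>

abbreviation "HH \<equiv> upper_half_plane"

lemma HH_iff: "z \<in> HH \<longleftrightarrow> Im z > 0"
  by (simp add: upper_half_plane_def)

text \<open>The half-turn about \<open>z\<close>. It identifies the plane with one sheet of the
  hyperboloid \<open>det X = 1\<close> in the space of traceless matrices.\<close>

definition hmat :: "complex \<Rightarrow> real^2^2" where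
  "hmat z = mat2 (Re z / Im z) (- (cmod z)\<^sup>2 / Im z) (1 / Im z) (- Re z / Im z)"

lemma cmod_sq: "(cmod z)\<^sup>2 = (Re z)\<^sup>2 + (Im z)\<^sup>2"
  by (rule cmod_power2)

lemma hmat_square: "z \<in> HH \<Longrightarrow> hmat z ** hmat z = - mat 1"
  by (simp add: hmat_def mat2_one HH_iff cmod_sq) (simp add: field_simps power2_eq_square)

lemma trace_hmat [simp]: "trace (hmat z) = 0"
  by (simp add: hmat_def)

lemma det_hmat: "z \<in> HH \<Longrightarrow> det (hmat z) = 1"
  by (simp add: hmat_def HH_iff cmod_sq) (simp add: field_simps power2_eq_square)

lemma hmat_inj: "z \<in> HH \<Longrightarrow> w \<in> HH \<Longrightarrow> hmat z = hmat w \<Longrightarrow> z = w"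
  by (auto simp: hmat_def HH_iff complex_eq_iff)

text \<open>Every point of the sheet \<open>r > 0\<close> is a half-turn about a point of the plane.
  This produces the centre of the hexagon from a linear combination of normals.\<close>

lemma hmat_of_traceless:
  assumes "- p\<^sup>2 - q * r = 1" "r > 0"
  shows "Complex (p / r) (1 / r) \<in> HH" "hmat (Complex (p / r) (1 / r)) = mat2 p q r (-p)"
proof -
  have "(cmod (Complex (p / r) (1 / r)))\<^sup>2 = (p\<^sup>2 + 1) / r\<^sup>2"
    by (simp add: cmod_sq power_divide add_divide_distrib)
  also have "p\<^sup>2 + 1 = - q * r" using assms by simp
  finally show "hmat (Complex (p / r) (1 / r)) = mat2 p q r (-p)"
    using assms(2) by (simp add: hmat_def power2_eq_square)
qed (use assms in \<open>simp add: HH_iff\<close>)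

text \<open>Minus the Minkowski form on traceless matrices, hence the cosh of the distance. It is
  bilinear in the two half-turns, so most estimates are made here and carried over to
  \<open>hyp_dist\<close> at the end.\<close>

definition cdist :: "complex \<Rightarrow> complex \<Rightarrow> real" where
  "cdist z w = - trace (hmat z ** hmat w) / 2"

lemma cdist_eq:
  assumes "z \<in> HH" "w \<in> HH"
  shows "cdist z w = 1 + (cmod (z - w))\<^sup>2 / (2 * Im z * Im w)"
  using assms
  by (simp add: cdist_def hmat_def HH_iff cmod_sq) (simp add: field_simps power2_eq_square)

lemma cdist_ge_1: "z \<in> HH \<Longrightarrow> w \<in> HH \<Longrightarrow> cdist z w \<ge> 1"
  by (simp add: cdist_eq HH_iff)

lemma cosh_hyp_dist: "z \<in> HH \<Longrightarrow> w \<in> HH \<Longrightarrow> cosh (hyp_dist z w) = cdist z w"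
  using cdist_ge_1[of z w] by (simp add: hyp_dist_def cdist_eq)

lemma hyp_dist_eq: "z \<in> HH \<Longrightarrow> w \<in> HH \<Longrightarrow> hyp_dist z w = arcosh (cdist z w)"
  by (simp add: hyp_dist_def cdist_eq)

lemma hyp_dist_nonneg: "z \<in> HH \<Longrightarrow> w \<in> HH \<Longrightarrow> hyp_dist z w \<ge> 0"
  using cdist_ge_1[of z w] by (simp add: hyp_dist_eq)

lemma hyp_dist_commute: "hyp_dist z w = hyp_dist w z"
  by (simp add: hyp_dist_def norm_minus_commute mult.commute mult.left_commute)

lemma hyp_dist_eq_0: "z \<in> HH \<Longrightarrow> w \<in> HH \<Longrightarrow> hyp_dist z w = 0 \<longleftrightarrow> z = w"
proof -
  assume H: "z \<in> HH" "w \<in> HH"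
  have "hyp_dist z w = 0 \<longleftrightarrow> cosh (hyp_dist z w) = cosh 0"
    using cosh_real_nonneg_less_iff[of 0 "hyp_dist z w"] hyp_dist_nonneg[OF H] by force
  also have "\<dots> \<longleftrightarrow> z = w"
    using H by (auto simp: cosh_hyp_dist cdist_eq HH_iff)
  finally show ?thesis .
qed

lemma hyp_dist_self [simp]: "hyp_dist z z = 0"
  by (simp add: hyp_dist_def)

text \<open>The difference of the two sides is the Gram determinant of three vectors for a form of
  signature (1, 2), hence a positive multiple of the square of the determinant \<open>D\<close> of
  their coordinates.\<close>

lemma cdist_gram:
  assumes "x \<in> HH" "y \<in> HH" "z \<in> HH"
  shows "(cdist x y)\<^sup>2 + (cdist y z)\<^sup>2 + (cdist x z)\<^sup>2 \<le> 1 + 2 * cdist x y * cdist y z * cdist x z"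
proof -
  define g where "g = (\<lambda>u v :: real \<times> real \<times> real. case (u, v) of ((a, b, c), (a', b', c')) \<Rightarrow>
      (b * c' + c * b') / 2 - a * a')"
  define h where "h = (\<lambda>z. (Re z / Im z, (cmod z)\<^sup>2 / Im z, 1 / Im z))"
  have cd: "cdist u v = g (h u) (h v)" for u v
    by (simp add: cdist_def hmat_def g_def h_def field_simps)
  have one: "g (h u) (h u) = 1" if "u \<in> HH" for u
    using that by (simp flip: cd add: cdist_eq HH_iff)
  obtain a1 b1 c1 a2 b2 c2 a3 b3 c3 where e: "h x = (a1, b1, c1)" "h y = (a2, b2, c2)" "h z = (a3, b3, c3)"
    by (metis prod_cases3)
  have o: "b1 * c1 - a1 * a1 = 1" "b2 * c2 - a2 * a2 = 1" "b3 * c3 - a3 * a3 = 1"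
    using one[OF assms(1)] one[OF assms(2)] one[OF assms(3)] by (simp_all add: e g_def algebra_simps)
  define D where "D = a1 * (b2 * c3 - b3 * c2) - b1 * (a2 * c3 - a3 * c2) + c1 * (a2 * b3 - a3 * b2)"
  define P12 P13 P23 where "P12 = b1*c2 + c1*b2 - 2*a1*a2" "P13 = b1*c3 + c1*b3 - 2*a1*a3"
    "P23 = b2*c3 + c2*b3 - 2*a2*a3"
  have c: "cdist x y = P12 / 2" "cdist x z = P13 / 2" "cdist y z = P23 / 2"
    by (simp_all add: cd e g_def P12_P13_P23_def field_simps)
  have "4 * (b1*c1 - a1*a1) * (b2*c2 - a2*a2) * (b3*c3 - a3*a3) + P12 * P23 * P13
      - (b3*c3 - a3*a3) * P12\<^sup>2 - (b1*c1 - a1*a1) * P23\<^sup>2 - (b2*c2 - a2*a2) * P13\<^sup>2 = D\<^sup>2"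
    unfolding D_def P12_P13_P23_def by (simp add: algebra_simps power2_eq_square)
  then have "4 + P12 * P23 * P13 - P12\<^sup>2 - P23\<^sup>2 - P13\<^sup>2 \<ge> 0"
    using o by simp
  then show ?thesis unfolding c by (simp add: field_simps)
qed

lemma hyp_dist_triangle:
  assumes "x \<in> HH" "y \<in> HH" "z \<in> HH"
  shows "hyp_dist x z \<le> hyp_dist x y + hyp_dist y z"
proof -
  let ?a = "hyp_dist x y" and ?b = "hyp_dist y z" and ?c = "hyp_dist x z"
  have n: "?a \<ge> 0" "?b \<ge> 0" "?c \<ge> 0" using assms by (auto intro: hyp_dist_nonneg)
  have g: "(cosh ?a)\<^sup>2 + (cosh ?b)\<^sup>2 + (cosh ?c)\<^sup>2 \<le> 1 + 2 * cosh ?a * cosh ?b * cosh ?c"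
    using cdist_gram[OF assms] assms by (simp add: cosh_hyp_dist)
  \<comment> \<open>Completing the square in \<open>cosh ?c\<close> brings the Gram inequality into
    this form, whose extreme case is the addition theorem.\<close>
  have "(cosh ?c - cosh ?a * cosh ?b)\<^sup>2 \<le> (sinh ?a * sinh ?b)\<^sup>2"
    using g by (simp add: power_mult_distrib sinh_square_eq) (simp add: algebra_simps power2_eq_square)
  moreover have "sinh ?a * sinh ?b \<ge> 0" using n by simp
  ultimately have "cosh ?c - cosh ?a * cosh ?b \<le> sinh ?a * sinh ?b"
    by (meson abs_le_square_iff abs_of_nonneg abs_le_D1 power2_le_imp_le)
  then have "cosh ?c \<le> cosh (?a + ?b)" by (simp add: cosh_add)
  then show ?thesis using n by (simp add: cosh_real_nonneg_le_iff)
qed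

lemma continuous_on_hyp_dist:
  assumes "continuous_on S f" "continuous_on S g" "f ` S \<subseteq> HH" "g ` S \<subseteq> HH"
  shows "continuous_on S (\<lambda>x. hyp_dist (f x) (g x))"
proof -
  have *: "continuous_on S (\<lambda>x. 1 + (cmod (f x - g x))\<^sup>2 / (2 * Im (f x) * Im (g x)))"
    using assms by (intro continuous_intros) (auto simp: HH_iff image_subset_iff)
  have **: "(\<lambda>x. 1 + (cmod (f x - g x))\<^sup>2 / (2 * Im (f x) * Im (g x))) ` S \<subseteq> {1..}"
    using assms(3,4) by (auto simp: HH_iff image_subset_iff less_imp_le)
  show ?thesis
    unfolding hyp_dist_def by (rule continuous_on_compose2[OF continuous_on_arcosh[OF order.refl] * **])
qed

lemma open_HH: "open HH"
  unfolding upper_half_plane_def by (simp add: open_Collect_less continuous_intros)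

lemma open_hyp_ball:
  assumes "x \<in> HH" shows "open {z \<in> HH. hyp_dist x z < r}"
proof -
  have "open ((\<lambda>z. hyp_dist x z) -` {..<r} \<inter> HH)"
    using assms continuous_open_preimage[OF _ open_HH open_lessThan[of r], of "hyp_dist x"]
    by (simp add: Int_commute continuous_on_hyp_dist image_subset_iff)
  also have "(\<lambda>z. hyp_dist x z) -` {..<r} \<inter> HH = {z \<in> HH. hyp_dist x z < r}" by auto
  finally show ?thesis .
qed

text \<open>The bounds on the imaginary part express that \<open>\<bar>ln (Im z / Im w)\<bar>\<close> is at most the distance.\<close>

lemma hyp_cball_bounds:
  assumes "x \<in> HH" "z \<in> HH" "hyp_dist x z \<le> r"
  shows "Im z \<ge> Im x / (2 * cosh r)" "Im z \<le> Im x * (2 * cosh r)"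
    "cmod (x - z) \<le> 2 * cosh r * Im x"
proof -
  define C where "C = cosh r"
  have r: "r \<ge> 0" using assms hyp_dist_nonneg[of x z] by linarith
  have C: "C \<ge> 1" unfolding C_def by (rule cosh_real_ge_1)
  have "cdist x z \<le> C" unfolding C_def using assms r
    by (simp add: cosh_hyp_dist[symmetric] cosh_real_nonneg_le_iff hyp_dist_nonneg)
  then have 1: "(cmod (x - z))\<^sup>2 \<le> (C - 1) * (2 * Im x * Im z)"
    using assms by (simp add: cdist_eq HH_iff field_simps)
  have "(Im x - Im z)\<^sup>2 \<le> (cmod (x - z))\<^sup>2" by (simp add: cmod_sq)
  with 1 have 2: "(Im x)\<^sup>2 + (Im z)\<^sup>2 \<le> 2 * C * Im x * Im z"
    by (simp add: algebra_simps power2_eq_square)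
  have p: "Im x > 0" "Im z > 0" using assms by (auto simp: HH_iff)
  have "Im x * Im x \<le> (2 * C * Im z) * Im x" "Im z * Im z \<le> (2 * C * Im x) * Im z"
    using 2 zero_le_square[of "Im z"] zero_le_square[of "Im x"]
    unfolding power2_eq_square by (simp_all only: mult_ac)
  then have 3: "Im x \<le> 2 * C * Im z" "Im z \<le> 2 * C * Im x" using p by simp_all
  then show "Im z \<ge> Im x / (2 * cosh r)" "Im z \<le> Im x * (2 * cosh r)"
    using C by (simp_all add: C_def[symmetric] field_simps)
  have "(cmod (x - z))\<^sup>2 \<le> (C * 2 * Im x) * Im z"
    using 1 mult_pos_pos[OF p] by (simp add: algebra_simps)
  also have "\<dots> \<le> (C * 2 * Im x) * (2 * C * Im x)"
    using 3 p C by (intro mult_left_mono) auto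
  finally have "(cmod (x - z))\<^sup>2 \<le> (2 * C * Im x)\<^sup>2" by (simp add: power2_eq_square algebra_simps)
  then show "cmod (x - z) \<le> 2 * cosh r * Im x"
    using p C unfolding C_def[symmetric] by (simp add: power2_le_iff_abs_le)
qed

text \<open>A hyperbolic ball stays away from the real axis, so it is a closed part of a Euclidean
  compact set \<open>K\<close> inside \<open>HH\<close>.\<close>

lemma compact_hyp_cball:
  assumes "x \<in> HH" shows "compact {z \<in> HH. hyp_dist x z \<le> r}"
proof -
  define K where "K = {z. Im z \<ge> Im x / (2 * cosh r)} \<inter> cball x (2 * cosh r * Im x)"
  have "compact K" unfolding K_def
    by (intro closed_Int_compact closed_halfspace_Im_ge compact_cball)
  have KH: "K \<subseteq> HH"
  proof -
    have "Im x / (2 * cosh r) > 0" using assms by (simp add: HH_iff)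
    then show ?thesis unfolding K_def HH_iff subset_iff by auto
  qed
  have eq: "{z \<in> HH. hyp_dist x z \<le> r} = {z \<in> K. hyp_dist x z \<le> r}"
    using KH hyp_cball_bounds[OF assms] by (auto simp: K_def dist_norm)
  have "closed (K \<inter> (\<lambda>z. hyp_dist x z) -` {..r})"
    using KH assms \<open>compact K\<close>
    by (intro continuous_closed_preimage continuous_on_hyp_dist continuous_intros)
       (auto simp: compact_imp_closed)
  then have "compact (K \<inter> (K \<inter> (\<lambda>z. hyp_dist x z) -` {..r}))"
    by (intro compact_Int_closed \<open>compact K\<close>)
  also have "K \<inter> (K \<inter> (\<lambda>z. hyp_dist x z) -` {..r}) = {z \<in> K. hyp_dist x z \<le> r}" by auto
  finally show ?thesis by (simp add: eq)
qed

section \<open>Isometries\<close>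

text \<open>Matrices of determinant \<open>-1\<close> act by orientation-reversing isometries.\<close>

definition gact :: "real^2^2 \<Rightarrow> complex \<Rightarrow> complex" where
  "gact A z = moebius A (if det A > 0 then z else cnj z)"

lemma gact_det_1: "det A = 1 \<Longrightarrow> gact A = moebius A"
  by (simp add: gact_def fun_eq_iff)

lemma hmat_gact:
  assumes "det A = 1 \<or> det A = -1" "z \<in> HH"
  shows "gact A z \<in> HH" "hmat (gact A z) = A ** hmat z ** adj2 A"
proof -
  obtain a b c d where A: "A = mat2 a b c d" by (rule mat2_cases)
  define s where "s = det A"
  have s: "s = 1 \<or> s = -1" "a * d - b * c = s" using assms by (auto simp: s_def A)
  define x y where "x = Re z" "y = Im z"
  have y: "y > 0" using assms by (simp add: x_y_def HH_iff)
  \<comment> \<open>With the sign \<open>s\<close> in the imaginary part, \<open>z'\<close> is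
    \<open>z\<close> or its conjugate, and both determinants are treated by one calculation.\<close>
  define z' where "z' = Complex x (s * y)"
  have z': "gact A z = (of_real a * z' + of_real b) / (of_real c * z' + of_real d)"
  proof -
    have "z' = (if det A > 0 then z else cnj z)"
      using assms(1) by (auto simp: s_def z'_def x_y_def complex_eq_iff)
    then show ?thesis by (simp add: gact_def moebius_def A)
  qed
  have ss: "s * s = 1" using s by auto
  define N where "N = (c * x + d)\<^sup>2 + (c * y)\<^sup>2"
  have "c \<noteq> 0 \<or> d \<noteq> 0" using s by auto
  then have N: "N > 0"
    unfolding N_def using y by (cases "c = 0") (auto intro: add_nonneg_pos)
  have N': "(c * x + d)\<^sup>2 + (c * (s * y))\<^sup>2 = N"
    using ss by (simp add: N_def power_mult_distrib) (metis power2_eq_square mult_1)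
  have i: "Im (gact A z) = y / N"
  proof -
    have "Im (gact A z) = ((a * (s * y)) * (c * x + d) - (a * x + b) * (c * (s * y))) / N"
      unfolding z' by (simp add: Im_divide z'_def N')
    also have "(a * (s * y)) * (c * x + d) - (a * x + b) * (c * (s * y)) = s * (a * d - b * c) * y"
      by (simp add: algebra_simps)
    finally show ?thesis by (simp add: s(2) ss)
  qed
  have r: "Re (gact A z) = ((a * x + b) * (c * x + d) + a * c * y\<^sup>2) / N"
  proof -
    have "Re (gact A z) = ((a * x + b) * (c * x + d) + (a * (s * y)) * (c * (s * y))) / N"
      unfolding z' by (simp add: Re_divide z'_def N')
    also have "(a * (s * y)) * (c * (s * y)) = a * c * y\<^sup>2"
      using ss by (metis (no_types, opaque_lifting) mult.assoc mult.commute mult.left_neutral power2_eq_square)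
    finally show ?thesis .
  qed
  have m: "(cmod (gact A z))\<^sup>2 = ((a * x + b)\<^sup>2 + (a * y)\<^sup>2) / N"
  proof -
    have "(a * (s * y))\<^sup>2 = (a * y)\<^sup>2"
      using ss by (simp add: power_mult_distrib) (metis power2_eq_square mult_1)
    then show ?thesis
      unfolding z' norm_divide power_divide cmod_sq by (simp add: z'_def N')
  qed
  show "gact A z \<in> HH" using i y N by (simp add: HH_iff)
  define v where "v = x * x + y * y"
  have q: "Re (gact A z) / Im (gact A z) = (a * c * v + (a * d + b * c) * x + b * d) / y"
    "(cmod (gact A z))\<^sup>2 / Im (gact A z) = (a * a * v + 2 * a * b * x + b * b) / y"
    "1 / Im (gact A z) = (c * c * v + 2 * c * d * x + d * d) / y"
    using y less_imp_neq[OF N] unfolding i r m by (simp_all add: v_def) (simp_all add: N_def algebra_simps power2_eq_square)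
  have "(cmod z)\<^sup>2 = v" using cmod_sq[of z] by (simp add: v_def x_y_def power2_eq_square)
  then have hz: "hmat z = mat2 (x / y) (- v / y) (1 / y) (- x / y)"
    by (simp add: hmat_def x_y_def)
  have hg: "hmat (gact A z) = mat2 (Re (gact A z) / Im (gact A z)) (- ((cmod (gact A z))\<^sup>2 / Im (gact A z)))
      (1 / Im (gact A z)) (- (Re (gact A z) / Im (gact A z)))"
    by (simp add: hmat_def)
  show "hmat (gact A z) = A ** hmat z ** adj2 A"
    using y unfolding hg q hz unfolding A by (simp add: field_simps)
qed

text \<open>\<open>hmat\<close> is injective and turns the action into multiplication on both sides,
  so fractions need not be composed.\<close>

lemma gact_mult:
  assumes "det A = 1 \<or> det A = -1" "det B = 1 \<or> det B = -1" "z \<in> HH"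
  shows "gact (A ** B) z = gact A (gact B z)"
proof (rule hmat_inj)
  have d: "det (A ** B) = 1 \<or> det (A ** B) = -1" using assms by (auto simp: det_mul)
  show "gact (A ** B) z \<in> HH" "gact A (gact B z) \<in> HH"
    using assms d by (auto intro!: hmat_gact(1))
  show "hmat (gact (A ** B) z) = hmat (gact A (gact B z))"
    using assms d hmat_gact(1)[of B z] by (simp add: hmat_gact(2) adj2_mult matrix_mul_assoc)
qed

lemma gact_minus:
  assumes "det A = 1 \<or> det A = -1" "z \<in> HH"
  shows "gact (- A) z = gact A z"
proof (rule hmat_inj)
  have d: "det (- A) = det A" by (cases A rule: mat2_cases) simp
  show "gact (- A) z \<in> HH" "gact A z \<in> HH" using assms d by (auto intro!: hmat_gact(1))
  show "hmat (gact (- A) z) = hmat (gact A z)"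
    using assms d by (simp add: hmat_gact(2) adj2_minus matrix_minus_left matrix_minus_right)
qed

lemma gact_one: "z \<in> HH \<Longrightarrow> gact (mat 1) z = z"
  by (simp add: gact_def moebius_def mat2_one)

lemma cdist_gact:
  assumes "det A = 1 \<or> det A = -1" "z \<in> HH" "w \<in> HH"
  shows "cdist (gact A z) (gact A w) = cdist z w"
proof -
  have "(A ** hmat z ** adj2 A) ** (A ** hmat w ** adj2 A) = A ** hmat z ** (adj2 A ** A) ** (hmat w ** adj2 A)"
    by (simp add: matrix_mul_assoc)
  also have "\<dots> = det A *\<^sub>R (A ** (hmat z ** hmat w) ** adj2 A)"
    by (simp add: adj2_cancel matrix_scaleR_right matrix_scaleR_left matrix_mul_assoc)
  finally have "trace ((A ** hmat z ** adj2 A) ** (A ** hmat w ** adj2 A))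
      = det A * trace (adj2 A ** (A ** (hmat z ** hmat w)))"
    by (metis trace_scaleR trace_cyclic)
  also have "\<dots> = det A * (det A * trace (hmat z ** hmat w))"
    by (simp add: matrix_mul_assoc adj2_cancel matrix_scaleR_left trace_scaleR)
  also have "\<dots> = trace (hmat z ** hmat w)" using assms(1) by auto
  finally show ?thesis unfolding cdist_def using assms by (simp add: hmat_gact)
qed

lemma hyp_dist_gact:
  assumes "det A = 1 \<or> det A = -1" "z \<in> HH" "w \<in> HH"
  shows "hyp_dist (gact A z) (gact A w) = hyp_dist z w"
  using assms by (simp add: hyp_dist_eq hmat_gact cdist_gact)

section \<open>The action of PSL(2,R)\<close>

lemma mult_PSL2R:
  assumes "det A = 1" "det B = 1"
  shows "{A, - A} \<otimes>\<^bsub>PSL2R\<^esub> {B, - B} = {A ** B, - (A ** B)}"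
  using assms
  by (auto simp: PSL2R_def FactGroup_def set_mult_def SL2R_def matrix_minus_left matrix_minus_right)

lemma one_PSL2R: "\<one>\<^bsub>PSL2R\<^esub> = {mat 1, - mat 1}"
  by (simp add: PSL2R_def FactGroup_def SL2R_center_def)

lemma PSL2R_cases:
  assumes "\<gamma> \<in> carrier PSL2R"
  obtains A where "det A = 1" "\<gamma> = {A, - A}" "psl_act \<gamma> = gact A" "psl_trace \<gamma> = \<bar>trace A\<bar>"
  using assms by (auto simp: carrier_PSL2R psl_act_coset psl_trace_coset gact_det_1)

lemma psl_act_HH [simp]: "\<gamma> \<in> carrier PSL2R \<Longrightarrow> z \<in> HH \<Longrightarrow> psl_act \<gamma> z \<in> HH"
  by (elim PSL2R_cases) (simp add: hmat_gact)

lemma psl_act_mult: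
  assumes "\<gamma> \<in> carrier PSL2R" "\<eta> \<in> carrier PSL2R" "z \<in> HH"
  shows "psl_act (\<gamma> \<otimes>\<^bsub>PSL2R\<^esub> \<eta>) z = psl_act \<gamma> (psl_act \<eta> z)"
proof -
  obtain A where A: "det A = 1" "\<gamma> = {A, - A}" "psl_act \<gamma> = gact A" using assms(1) by (rule PSL2R_cases)
  obtain B where B: "det B = 1" "\<eta> = {B, - B}" "psl_act \<eta> = gact B" using assms(2) by (rule PSL2R_cases)
  have "psl_act (\<gamma> \<otimes>\<^bsub>PSL2R\<^esub> \<eta>) = gact (A ** B)"
    using A(1) B(1) by (simp add: A(2) B(2) mult_PSL2R psl_act_coset gact_det_1 det_mul)
  then show ?thesis using A B assms(3) by (simp add: gact_mult)
qed

lemma psl_act_one [simp]: "z \<in> HH \<Longrightarrow> psl_act \<one>\<^bsub>PSL2R\<^esub> z = z"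
  by (simp add: one_PSL2R psl_act_coset gact_one flip: gact_det_1)

lemma hyp_dist_psl_act [simp]:
  assumes "\<gamma> \<in> carrier PSL2R" "z \<in> HH" "w \<in> HH"
  shows "hyp_dist (psl_act \<gamma> z) (psl_act \<gamma> w) = hyp_dist z w"
  using assms by (elim PSL2R_cases) (simp add: hyp_dist_gact)

lemma continuous_on_psl_act: "\<gamma> \<in> carrier PSL2R \<Longrightarrow> continuous_on HH (psl_act \<gamma>)"
proof (elim PSL2R_cases)
  fix A assume A: "det A = 1" "psl_act \<gamma> = gact A"
  obtain a b c d where m: "A = mat2 a b c d" by (rule mat2_cases)
  have "of_real c * z + of_real d \<noteq> 0" if "z \<in> HH" for z
    using that A(1) by (auto simp: m HH_iff complex_eq_iff)
  then show "continuous_on HH (psl_act \<gamma>)"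
    unfolding A(2) gact_det_1[OF A(1)] moebius_def by (intro continuous_intros) (simp add: m)
qed

section \<open>Displacement and axes\<close>

text \<open>With \<open>z = Complex x y\<close> the numerator is the squared modulus of
  \<open>c * z\<^sup>2 + (d - a) * z - b\<close>, whose zeros are the fixed points.\<close>

lemma cdist_displacement:
  assumes "a * d - b * c = 1" "y > 0"
  shows "cdist (Complex x y) (gact (mat2 a b c d) (Complex x y)) =
    1 + ((c * (x\<^sup>2 - y\<^sup>2) + (d - a) * x - b)\<^sup>2 + ((2 * c * x + d - a) * y)\<^sup>2) / (2 * y\<^sup>2)"
proof -
  define v where "v = x\<^sup>2 + y\<^sup>2"
  have h: "hmat (Complex x y) = mat2 (x / y) (- v / y) (1 / y) (- x / y)"
    by (simp add: hmat_def cmod_sq v_def)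
  have "cdist (Complex x y) (gact (mat2 a b c d) (Complex x y)) =
      - trace (hmat (Complex x y) ** (mat2 a b c d ** hmat (Complex x y) ** adj2 (mat2 a b c d))) / 2"
    using assms by (simp add: cdist_def hmat_gact HH_iff)
  also have "\<dots> = (v * (c * c * v + 2 * c * d * x + d * d) + (a * a * v + 2 * a * b * x + b * b)
      - 2 * x * (a * c * v + (a * d + b * c) * x + b * d)) / (2 * y\<^sup>2)"
    using assms(2) unfolding h by (simp add: field_simps power2_eq_square)
  also have "v * (c * c * v + 2 * c * d * x + d * d) + (a * a * v + 2 * a * b * x + b * b)
      - 2 * x * (a * c * v + (a * d + b * c) * x + b * d) =
      2 * y\<^sup>2 * (a * d - b * c) +
      (c * (x\<^sup>2 - y\<^sup>2) + (d - a) * x - b)\<^sup>2 + ((2 * c * x + d - a) * y)\<^sup>2"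
    unfolding v_def by (simp add: algebra_simps power2_eq_square)
  finally show ?thesis using assms by (simp add: add_divide_distrib)
qed

text \<open>Elliptic elements fix a point, and parabolic ones move points near their fixed point at
  the boundary by arbitrarily little. Against a positive injectivity radius this excludes
  both.\<close>

lemma small_displacement:
  assumes "det A = 1" "\<bar>trace A\<bar> \<le> 2" "e > 0"
  shows "\<exists>z\<in>HH. cdist z (gact A z) < 1 + e"
proof -
  obtain a b c d where A: "A = mat2 a b c d" by (rule mat2_cases)
  have det: "a * d - b * c = 1" and tr: "\<bar>a + d\<bar> \<le> 2" using assms by (auto simp: A)
  have tr2: "(a + d)\<^sup>2 \<le> 4" using abs_le_square_iff[of "a + d" 2] tr by simp
  show ?thesis
  proof (cases "c = 0")
    case True
    then have "a * d = 1" using det by simp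
    then have "(a - d)\<^sup>2 = (a + d)\<^sup>2 - 4" by (simp add: power2_eq_square algebra_simps)
    then have "a = d" using tr2 zero_le_power2[of "a - d"] by (metis diff_le_0_iff_le eq_iff_diff_eq_0 order_antisym power2_eq_iff zero_power2 power_eq_0_iff)
    \<comment> \<open>Here \<open>A\<close> translates horizontally by \<open>b\<close> up to sign,
      so the displacement is small high up; the summand 1 keeps \<open>y\<close> positive when
      \<open>b = 0\<close>.\<close>
    define y where "y = sqrt ((b\<^sup>2 + 1) / e)"
    have y: "y > 0" "y\<^sup>2 = (b\<^sup>2 + 1) / e" using assms by (auto simp: y_def add_nonneg_pos)
    have "cdist (Complex 0 y) (gact A (Complex 0 y)) = 1 + b\<^sup>2 / (2 * y\<^sup>2)"
      unfolding A using det y True \<open>a = d\<close> by (subst cdist_displacement) auto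
    also have "\<dots> < 1 + e"
    proof -
      have "b\<^sup>2 < 2 * (b\<^sup>2 + 1)" using zero_le_power2[of b] by (simp add: algebra_simps add_pos_nonneg)
      moreover have "2 * y\<^sup>2 * e = 2 * (b\<^sup>2 + 1)" using y assms by simp
      ultimately have "b\<^sup>2 < e * (2 * y\<^sup>2)" by (simp add: mult_ac)
      then show ?thesis using y(1) by (simp add: divide_less_eq)
    qed
    finally show ?thesis using y by (intro bexI[of _ "Complex 0 y"]) (auto simp: HH_iff)
  next
    case False
    \<comment> \<open>\<open>x\<close> is the real part of the fixed points and \<open>- s\<close>
      is the discriminant of their quadratic equation.\<close>
    define x s where "x = (a - d) / (2 * c)" "s = 4 - (a + d)\<^sup>2"
    have s: "s \<ge> 0" using tr2 by (simp add: x_s_def)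
    have *: "cdist (Complex x y) (gact A (Complex x y)) = 1 + (c * y\<^sup>2 - s / (4 * c))\<^sup>2 / (2 * y\<^sup>2)" if "y > 0" for y
    proof -
      have 1: "2 * c * x + d - a = 0" using False by (simp add: x_s_def)
      have "4 * c * (c * x\<^sup>2 + (d - a) * x - b) = (2 * c * x + d - a)\<^sup>2 - (a + d)\<^sup>2 + 4 * (a * d - b * c)"
        by Groebner_Basis.algebra
      then have "4 * c * (c * x\<^sup>2 + (d - a) * x - b) = s" unfolding 1 det by (simp add: x_s_def(2))
      then have "c * x\<^sup>2 + (d - a) * x - b = s / (4 * c)" using False by (simp add: field_simps)
      then have 2: "c * (x\<^sup>2 - y\<^sup>2) + (d - a) * x - b = - (c * y\<^sup>2 - s / (4 * c))"
        by (simp add: algebra_simps)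
      show ?thesis unfolding A cdist_displacement[OF det that] 1 2 power2_minus by simp
    qed
    show ?thesis
    proof (cases "s = 0")
      case True
      \<comment> \<open>Parabolic case: at height \<open>y\<close> above the boundary fixed point
        \<open>x\<close> the value is exactly \<open>1 + e / 2\<close>.\<close>
      define y where "y = sqrt e / \<bar>c\<bar>"
      have y: "y > 0" "c\<^sup>2 * y\<^sup>2 = e" using assms False by (auto simp: y_def power_divide)
      have "(c * y\<^sup>2)\<^sup>2 / (2 * y\<^sup>2) = e / 2"
        using y by (simp add: power2_eq_square[of "c * y\<^sup>2"]) (simp add: power2_eq_square)
      then have "cdist (Complex x y) (gact A (Complex x y)) < 1 + e"
        using *[OF y(1)] True assms by simp
      then show ?thesis using y by (intro bexI[of _ "Complex x y"]) (auto simp: HH_iff)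
    next
      case False': False
      \<comment> \<open>Elliptic case: this is the height of the fixed point itself.\<close>
      define y where "y = sqrt s / (2 * \<bar>c\<bar>)"
      have y: "y > 0" "y\<^sup>2 = s / (4 * c\<^sup>2)" using s False False' by (auto simp: y_def power_divide power_mult_distrib)
      then have "c * y\<^sup>2 - s / (4 * c) = 0" using False by (simp add: power2_eq_square)
      then have "cdist (Complex x y) (gact A (Complex x y)) < 1 + e"
        using *[OF y(1)] assms by simp
      then show ?thesis using y by (intro bexI[of _ "Complex x y"]) (auto simp: HH_iff)
    qed
  qed
qed

text \<open>The columns of \<open>P\<close> are eigenvectors, one of them rescaled to make the
  determinant 1. If \<open>c = 0\<close> the eigenvalues stand on the diagonal in one of two orders,
  and each order has its own \<open>P\<close>.\<close>

lemma diagonalization: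
  assumes "det A = 1" "trace A = lam + mu" "lam * mu = 1" "lam \<noteq> mu"
  shows "\<exists>P. det P = 1 \<and> A ** P = P ** mat2 lam 0 0 mu"
proof -
  obtain a b c d where A: "A = mat2 a b c d" by (rule mat2_cases)
  have e: "a * d - b * c = 1" "a + d = lam + mu" using assms by (auto simp: A)
  have d: "d = lam + mu - a" using e by simp
  have bc: "b * c = a * d - 1" using e by simp
  show ?thesis
  proof (cases "c = 0")
    case c: False
    define k where "k = c * (lam - mu)"
    have k: "k \<noteq> 0" using c assms by (simp add: k_def)
    have "det (mat2 ((lam - d) / k) (mu - d) (c / k) c) = c * (lam - mu) / k"
      using k by (simp add: field_simps)
    then have "det (mat2 ((lam - d) / k) (mu - d) (c / k) c) = 1" using k by (simp add: k_def)
    moreover have "A ** mat2 ((lam - d) / k) (mu - d) (c / k) c =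
        mat2 ((lam - d) / k) (mu - d) (c / k) c ** mat2 lam 0 0 mu"
    proof -
      have "a * (lam - d) + b * c = (lam - d) * lam" "a * (mu - d) + b * c = (mu - d) * mu"
        using e assms(3) unfolding bc d by Groebner_Basis.algebra+
      moreover have "c * (lam - d) + d * c = c * lam" "c * (mu - d) + d * c = c * mu" by Groebner_Basis.algebra+
      ultimately show ?thesis using k unfolding A by (simp add: field_simps)
    qed
    ultimately show ?thesis by blast
  next
    case c: True
    then have ad: "a * d = 1" using e by simp
    have "(a - lam) * (a - mu) = 0" using ad assms(3) unfolding d by Groebner_Basis.algebra
    then have "a = lam \<and> d = mu \<or> a = mu \<and> d = lam" unfolding d by auto
    then show ?thesis
    proof (elim disjE conjE)
      assume [simp]: "a = lam" "d = mu"
      have "det (mat2 1 (b / (mu - lam)) 0 1) = 1" by simp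
      moreover have "A ** mat2 1 (b / (mu - lam)) 0 1 = mat2 1 (b / (mu - lam)) 0 1 ** mat2 lam 0 0 mu"
        using assms(4) unfolding A c by (simp add: field_simps)
      ultimately show ?thesis by blast
    next
      assume [simp]: "a = mu" "d = lam"
      have "det (mat2 (b / (lam - mu)) (-1) 1 0) = 1" by simp
      moreover have "A ** mat2 (b / (lam - mu)) (-1) 1 0 = mat2 (b / (lam - mu)) (-1) 1 0 ** mat2 lam 0 0 mu"
        using assms(4) unfolding A c by (simp add: field_simps)
      ultimately show ?thesis by blast
    qed
  qed
qed

text \<open>Up to sign \<open>A\<close> is conjugate to a diagonal matrix that multiplies by
  \<open>exp l\<close>, and this translates the unit-speed geodesic \<open>Complex 0 (exp s)\<close>
  by \<open>l\<close>. The conjugating matrix carries that geodesic to \<open>g\<close>.\<close>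

lemma hyperbolic_axis:
  assumes "det A = 1" "\<bar>trace A\<bar> = 2 * cosh (l / 2)" "l > 0"
  shows "\<exists>g. range g \<subseteq> HH \<and> (\<forall>r s. hyp_dist (g r) (g s) = \<bar>r - s\<bar>) \<and> (\<forall>s. gact A (g s) = g (s + l))"
proof -
  define lam where "lam = exp (l / 2)"
  have lam: "lam > 0" "lam * lam = exp l" by (simp_all add: lam_def flip: exp_add)
  have lam1: "lam \<noteq> 1 / lam"
  proof
    assume "lam = 1 / lam"
    then have "lam * lam = 1" using lam(1) by (metis less_irrefl nonzero_eq_divide_eq)
    then show False using lam(2) assms(3) by simp
  qed
  have tr: "2 * cosh (l / 2) = lam + 1 / lam"
    by (simp add: cosh_def lam_def exp_minus inverse_eq_divide)
  define B where "B = (if trace A \<ge> 0 then A else - A)"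
  have dB: "det B = 1" using assms(1) unfolding B_def by (cases A rule: mat2_cases) auto
  have tB: "trace B = lam + 1 / lam" using assms(2) tr by (simp add: B_def trace_minus abs_if split: if_splits)
  have AB: "gact A z = gact B z" if "z \<in> HH" for z
    using that assms(1) by (auto simp: B_def gact_minus)
  obtain P where P: "det P = 1" "B ** P = P ** mat2 lam 0 0 (1 / lam)"
    using diagonalization[OF dB tB _ lam1] lam(1) by auto
  define e where "e = (\<lambda>s::real. Complex 0 (exp s))"
  have e: "e s \<in> HH" for s by (simp add: e_def HH_iff)
  have de: "hyp_dist (e r) (e s) = \<bar>r - s\<bar>" for r s
  proof -
    have "cdist (e r) (e s) = 1 + (exp r - exp s)\<^sup>2 / (2 * exp r * exp s)"
      using e by (subst cdist_eq) (simp_all add: e_def cmod_sq)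
    also have "\<dots> = (exp r / exp s + exp s / exp r) / 2"
    proof -
      have "1 + (a - b)\<^sup>2 / (2 * a * b) = (a / b + b / a) / 2" if "a > 0" "b > 0" for a b :: real
      proof -
        have "1 + (a - b)\<^sup>2 / (2 * a * b) = (2 * a * b + (a - b)\<^sup>2) / (2 * a * b)"
          using that by (simp add: add_divide_distrib)
        also have "2 * a * b + (a - b)\<^sup>2 = a * a + b * b" by (simp add: power2_eq_square algebra_simps)
        finally show ?thesis using that by (simp add: add_divide_distrib)
      qed
      from this[of "exp r" "exp s"] show ?thesis by simp
    qed
    also have "\<dots> = cosh (r - s)" by (simp add: cosh_def exp_diff)
    also have "\<dots> = cosh \<bar>r - s\<bar>" by simp
    finally show ?thesis unfolding hyp_dist_eq[OF e e] by (metis abs_ge_zero arcosh_cosh_real)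
  qed
  have De: "gact (mat2 lam 0 0 (1 / lam)) (e s) = e (s + l)" for s
  proof -
    have "gact (mat2 lam 0 0 (1 / lam)) (e s) = of_real lam * e s / of_real (1 / lam)"
      using lam by (simp add: gact_def moebius_def)
    also have "\<dots> = of_real (lam * lam) * e s" using lam(1) by simp
    also have "\<dots> = e (s + l)" unfolding lam(2) by (simp add: e_def exp_add complex_eq_iff)
    finally show ?thesis .
  qed
  define g where "g = (\<lambda>s. gact P (e s))"
  have "range g \<subseteq> HH" using P e by (auto simp: g_def hmat_gact)
  moreover have "hyp_dist (g r) (g s) = \<bar>r - s\<bar>" for r s
    using P e by (simp add: g_def hyp_dist_gact de)
  moreover have "gact A (g s) = g (s + l)" for s
  proof -
    have "gact A (g s) = gact B (gact P (e s))" using P e by (simp add: g_def AB hmat_gact)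
    also have "\<dots> = gact (P ** mat2 lam 0 0 (1 / lam)) (e s)" using dB P e by (simp flip: P(2) add: gact_mult)
    also have "\<dots> = gact P (gact (mat2 lam 0 0 (1 / lam)) (e s))"
      using P e lam by (subst gact_mult) auto
    finally show ?thesis by (simp add: De g_def)
  qed
  ultimately show ?thesis by blast
qed

text \<open>A broken geodesic with equality in consecutive triangle inequalities lies on one geodesic,
  because a lightlike vector orthogonal to a timelike one vanishes.\<close>

lemma hmat_collinear:
  assumes "x \<in> HH" "y \<in> HH" "w \<in> HH"
    and "cdist x y = c" "cdist y w = c" "cdist x w = 2 * c\<^sup>2 - 1"
  shows "hmat x + hmat w = (2 * c) *\<^sub>R hmat y"
proof -
  obtain y1 y2 y3 where Y: "hmat y = mat2 y1 y2 y3 (- y1)" by (simp add: hmat_def)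
  obtain x1 x2 x3 where X: "hmat x = mat2 x1 x2 x3 (- x1)" by (simp add: hmat_def)
  obtain w1 w2 w3 where W: "hmat w = mat2 w1 w2 w3 (- w1)" by (simp add: hmat_def)
  have n: "x1 * x1 + x2 * x3 = -1" "y1 * y1 + y2 * y3 = -1" "w1 * w1 + w2 * w3 = -1"
    using det_hmat[OF assms(1)] det_hmat[OF assms(2)] det_hmat[OF assms(3)]
    by (simp_all add: X Y W)
  have cc: "2 * x1 * y1 + x2 * y3 + x3 * y2 = - 2 * c" "2 * y1 * w1 + y2 * w3 + y3 * w2 = - 2 * c"
    "2 * x1 * w1 + x2 * w3 + x3 * w2 = 2 - 4 * c\<^sup>2"
    using assms(4-6) unfolding cdist_def X Y W by (simp_all add: field_simps)
  define p q r where "p = x1 + w1 - 2 * c * y1" "q = x2 + w2 - 2 * c * y2" "r = x3 + w3 - 2 * c * y3"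
  have 1: "p * p + q * r = 0" unfolding p_q_r_def using n cc by Groebner_Basis.algebra
  have 2: "2 * p * y1 + q * y3 + r * y2 = 0" unfolding p_q_r_def using n cc by Groebner_Basis.algebra
  have "(q * y3 - r * y2)\<^sup>2 + 4 * p\<^sup>2 = 0" using 1 2 n(2) by Groebner_Basis.algebra
  then have p: "p = 0" and qr: "q * y3 = r * y2"
    by (simp_all add: sum_power2_eq_zero_iff add_nonneg_eq_0_iff)
  have "q * y3 = 0" "r * y2 = 0" using 2 p qr by auto
  moreover have "y2 * y3 = - 1 - y1\<^sup>2" using n(2) by (simp add: power2_eq_square)
  then have "y2 * y3 < 0" using zero_le_power2[of y1] by linarith
  then have "y2 \<noteq> 0" "y3 \<noteq> 0" by auto
  ultimately have "q = 0" "r = 0" by auto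
  with p show ?thesis by (simp add: X Y W p_q_r_def)
qed

text \<open>The half-turns \<open>X\<^sub>k\<close> about equally spaced points of a geodesic satisfy \<open>X\<^sub>k = T\<^sup>k X\<^sub>0\<close> with the
  translation \<open>T = - X\<^sub>1 X\<^sub>0\<close>. An isometry taking \<open>X\<^sub>0, X\<^sub>1\<close> to \<open>X\<^sub>n, X\<^sub>n\<^sub>+\<^sub>1\<close> commutes with \<open>T\<close>, whence \<open>A\<^sup>2 X\<^sub>0 = X\<^sub>n\<close>.\<close>

lemma trace_of_translation:
  fixes z :: "nat \<Rightarrow> complex"
  assumes z: "\<And>k. z k \<in> HH" and h: "h > 0"
    and d1: "\<And>k. hyp_dist (z k) (z (Suc k)) = h"
    and d2: "\<And>k. hyp_dist (z k) (z (Suc (Suc k))) = 2 * h"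
    and A: "det A = 1" "gact A (z 0) = z n" "gact A (z 1) = z (Suc n)"
  shows "(trace A)\<^sup>2 = (2 * cosh (real n * h / 2))\<^sup>2"
proof -
  define c where "c = cosh h"
  define Ht where "Ht = (\<lambda>k. hmat (z k))"
  have c1: "c > 1" unfolding c_def using h cosh_real_strict_mono[of 0 h] by simp
  have rec: "Ht (Suc (Suc k)) = (2 * c) *\<^sub>R Ht (Suc k) - Ht k" for k
  proof -
    have "Ht k + Ht (Suc (Suc k)) = (2 * c) *\<^sub>R Ht (Suc k)"
      unfolding Ht_def c_def using z d1 d2
      by (intro hmat_collinear) (auto simp: cosh_hyp_dist[symmetric] cosh_double_cosh)
    then show ?thesis by (simp add: algebra_simps)
  qed
  have sq: "Ht k ** Ht k = - mat 1" for k unfolding Ht_def using z by (rule hmat_square)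
  define T where "T = - (Ht 1 ** Ht 0)"
  have trT: "trace T = 2 * c"
    using d1[of 0] cosh_hyp_dist[OF z z, of 0 1]
    by (simp add: T_def trace_minus c_def cdist_def Ht_def trace_cyclic)
  have detT: "det T = 1"
  proof -
    have "det (- B) = det B" for B :: "real^2^2" by (cases B rule: mat2_cases) simp
    then show ?thesis using z det_hmat by (simp add: T_def det_mul Ht_def)
  qed
  have TX: "Ht (Suc k) = T ** Ht k" for k
  proof (induction k)
    case 0
    show ?case by (simp add: T_def matrix_minus_left matrix_mul_assoc[symmetric] sq matrix_minus_right)
  next
    case (Suc k)
    \<comment> \<open>Cayley-Hamilton: multiplication by \<open>T\<close> obeys the same three-term
      recurrence as the sequence \<open>Ht\<close>.\<close>
    have CH: "T ** T = (2 * c) *\<^sub>R T - mat 1"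
    proof -
      obtain a b c' d where T': "T = mat2 a b c' d" by (rule mat2_cases)
      have "a * d - b * c' = 1" "a + d = 2 * c" using trT detT by (simp_all add: T')
      then show ?thesis unfolding T' mat2_one by (simp, intro conjI) Groebner_Basis.algebra+
    qed
    have "Ht (Suc (Suc k)) = (2 * c) *\<^sub>R (T ** Ht k) - Ht k" by (simp add: rec Suc)
    also have "\<dots> = ((2 * c) *\<^sub>R T - mat 1) ** Ht k"
      by (cases T rule: mat2_cases, cases "Ht k" rule: mat2_cases) (simp add: mat2_one algebra_simps)
    also have "\<dots> = T ** Ht (Suc k)" by (simp add: CH[symmetric] Suc matrix_mul_assoc)
    finally show ?case .
  qed
  have f: "- trace (Ht k ** Ht 0) / 2 = cosh (real k * h)" for k
  proof (induction k rule: induct_nat_012)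
    case 0 show ?case by (simp add: sq trace_minus mat2_one)
  next
    case 1 then show ?case
      using d1[of 0] cosh_hyp_dist[OF z z, of 0 1] by (simp add: cdist_def Ht_def trace_cyclic)
  next
    case (ge2 k)
    have "trace (Ht (Suc (Suc k)) ** Ht 0) = 2 * c * trace (Ht (Suc k) ** Ht 0) - trace (Ht k ** Ht 0)"
      unfolding rec by (cases "Ht k" rule: mat2_cases, cases "Ht (Suc k)" rule: mat2_cases, cases "Ht 0" rule: mat2_cases)
        (simp add: algebra_simps)
    moreover have "trace (Ht k ** Ht 0) = - 2 * cosh (real k * h)"
      "trace (Ht (Suc k) ** Ht 0) = - 2 * cosh (real (Suc k) * h)" using ge2 by linarith+
    ultimately have "- trace (Ht (Suc (Suc k)) ** Ht 0) / 2 = 2 * c * cosh (real (Suc k) * h) - cosh (real k * h)"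
      by simp
    also have "\<dots> = cosh (real (Suc (Suc k)) * h)"
      using cosh_add[of "real (Suc k) * h" h] cosh_diff[of "real (Suc k) * h" h]
      by (simp add: c_def algebra_simps)
    finally show ?case .
  qed
  have AX: "A ** Ht 0 = Ht n ** A" "A ** Ht 1 = Ht (Suc n) ** A"
  proof -
    have "Ht n = A ** Ht 0 ** adj2 A" "Ht (Suc n) = A ** Ht 1 ** adj2 A"
      using hmat_gact(2)[OF disjI1[OF A(1)] z, of 0] hmat_gact(2)[OF disjI1[OF A(1)] z, of 1] A
      by (simp_all add: Ht_def)
    then show "A ** Ht 0 = Ht n ** A" "A ** Ht 1 = Ht (Suc n) ** A"
      using A(1) by (simp_all add: matrix_mul_assoc[symmetric] adj2_cancel)
  qed
  have comm: "A ** T = T ** A"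
  proof -
    have "A ** (Ht 1 ** Ht 0) = Ht (Suc n) ** (A ** Ht 0)"
      unfolding matrix_mul_assoc AX(2) ..
    also have "\<dots> = T ** (Ht n ** Ht n) ** A" unfolding AX(1) TX matrix_mul_assoc ..
    also have "\<dots> = - (T ** A)" by (simp add: sq matrix_minus_left matrix_minus_right)
    finally show ?thesis unfolding T_def by (simp add: matrix_minus_left matrix_minus_right)
  qed
  have trTX: "trace (T ** Ht 0) = 0" by (metis TX Ht_def trace_hmat)
  \<comment> \<open>Since \<open>A\<close> commutes with \<open>T\<close>, which is not scalar, the
    traceless part of \<open>A\<close> is a multiple of that of \<open>T\<close>. So orthogonality
    to \<open>Ht 0\<close> passes from \<open>T\<close> to \<open>A\<close>.\<close>
  have trAX: "trace (A ** Ht 0) = 0"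
  proof -
    obtain a b c' d where A': "A = mat2 a b c' d" by (rule mat2_cases)
    obtain p q r s where T': "T = mat2 p q r s" by (rule mat2_cases)
    obtain x1 x2 x3 where X0: "Ht 0 = mat2 x1 x2 x3 (- x1)" by (simp add: Ht_def hmat_def)
    have e: "b * r = q * c'" "(a - d) * q = (p - s) * b" "(a - d) * r = (p - s) * c'"
    proof -
      have "mat2 a b c' d ** mat2 p q r s = mat2 p q r s ** mat2 a b c' d" using comm A' T' by simp
      then have "a * p + b * r = p * a + q * c'" "a * q + b * s = p * b + q * d"
        "c' * p + d * r = r * a + s * c'" unfolding mat2_mult mat2_eq_iff by blast+
      then show "b * r = q * c'" "(a - d) * q = (p - s) * b" "(a - d) * r = (p - s) * c'"
        by Groebner_Basis.algebra+
    qed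
    have t: "(p - s) * x1 + q * x3 + r * x2 = 0" using trTX by (simp add: T' X0 algebra_simps)
    let ?W = "(a - d) * x1 + b * x3 + c' * x2"
    have "(p - s) * ?W = 0" "q * ?W = 0" "r * ?W = 0" using e t by Groebner_Basis.algebra+
    moreover have "p - s \<noteq> 0 \<or> q \<noteq> 0 \<or> r \<noteq> 0"
    proof (rule ccontr)
      assume "\<not> ?thesis"
      then have "p * p = 1" "2 * p = 2 * c" using detT trT by (auto simp: T')
      then show False using c1 by (metis less_1_mult less_irrefl mult_cancel_left zero_neq_numeral)
    qed
    ultimately have "?W = 0" by auto
    then show ?thesis by (simp add: A' X0 algebra_simps)
  qed
  \<comment> \<open>\<open>A ** Ht 0\<close> is traceless, so its adjugate is its negative; the same
    holds for \<open>Ht 0\<close>, and the two signs cancel.\<close>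
  have AXA: "A ** Ht 0 = Ht 0 ** adj2 A"
  proof -
    obtain a b c' d where A': "A = mat2 a b c' d" by (rule mat2_cases)
    obtain x1 x2 x3 where X0: "Ht 0 = mat2 x1 x2 x3 (- x1)" by (simp add: Ht_def hmat_def)
    have "a * x1 + b * x3 + (c' * x2 - d * x1) = 0" using trAX by (simp add: A' X0)
    then show ?thesis unfolding A' X0 adj2_mat2 mat2_mult mat2_eq_iff
      by (simp add: algebra_simps)
  qed
  have "Ht n = A ** Ht 0 ** adj2 A"
    using hmat_gact(2)[OF disjI1[OF A(1)] z, of 0] A by (simp add: Ht_def)
  then have "Ht n = A ** (A ** Ht 0)" by (metis AXA matrix_mul_assoc)
  then have "Ht n ** Ht 0 = - (A ** A)"
    by (simp add: matrix_mul_assoc[symmetric] sq matrix_minus_right)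
  then have "trace (A ** A) = 2 * cosh (real n * h)" using f[of n] by (simp add: trace_minus)
  then have "(trace A)\<^sup>2 = 2 * cosh (real n * h) + 2" using A(1) by (simp add: trace_square)
  also have "\<dots> = (2 * cosh (real n * h / 2))\<^sup>2"
    using cosh_double_cosh[of "real n * h / 2"] by (simp add: power_mult_distrib)
  finally show ?thesis .
qed

lemma arcosh_mono_real: "1 \<le> x \<Longrightarrow> x \<le> y \<Longrightarrow> arcosh x \<le> arcosh (y::real)"
  by (cases "x = y") (auto intro: less_imp_le)

section \<open>Free, properly discontinuous and cocompact groups\<close>

text \<open>Properness at a single point and a bound on orbits are what estimates of word lengths
  provide. The topological and measure-theoretic requirements on the group are derived from
  them.\<close>

locale surface_group =
  fixes \<Gamma> :: "(real^2^2) set set" and base :: complex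
  assumes subgroup: "subgroup \<Gamma> PSL2R"
    and base: "base \<in> HH"
    and free: "\<And>\<gamma> z. \<gamma> \<in> \<Gamma> \<Longrightarrow> z \<in> HH \<Longrightarrow> psl_act \<gamma> z = z \<Longrightarrow> \<gamma> = \<one>\<^bsub>PSL2R\<^esub>"
    and proper_base: "\<And>r. finite {\<gamma> \<in> \<Gamma>. hyp_dist base (psl_act \<gamma> base) \<le> r}"
    and cocompact: "\<exists>R. \<forall>z\<in>HH. \<exists>\<gamma>\<in>\<Gamma>. hyp_dist base (psl_act \<gamma> z) \<le> R"
begin

sublocale P: group PSL2R by (rule group_PSL2R)

lemma in_carrier [simp]: "\<gamma> \<in> \<Gamma> \<Longrightarrow> \<gamma> \<in> carrier PSL2R"
  using subgroup subgroup.subset by blast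

lemma one_in [simp]: "\<one>\<^bsub>PSL2R\<^esub> \<in> \<Gamma>"
  and mult_in [simp]: "\<gamma> \<in> \<Gamma> \<Longrightarrow> \<eta> \<in> \<Gamma> \<Longrightarrow> \<gamma> \<otimes>\<^bsub>PSL2R\<^esub> \<eta> \<in> \<Gamma>"
  and inv_in [simp]: "\<gamma> \<in> \<Gamma> \<Longrightarrow> inv\<^bsub>PSL2R\<^esub> \<gamma> \<in> \<Gamma>"
  by (simp_all add: subgroup.one_closed[OF subgroup] subgroup.m_closed[OF subgroup]
      subgroup.m_inv_closed[OF subgroup])

lemma act_inv [simp]:
  assumes "\<gamma> \<in> \<Gamma>" "z \<in> HH"
  shows "psl_act (inv\<^bsub>PSL2R\<^esub> \<gamma>) (psl_act \<gamma> z) = z" "psl_act \<gamma> (psl_act (inv\<^bsub>PSL2R\<^esub> \<gamma>) z) = z"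
  using assms psl_act_mult[of "inv\<^bsub>PSL2R\<^esub> \<gamma>" \<gamma> z] psl_act_mult[of \<gamma> "inv\<^bsub>PSL2R\<^esub> \<gamma>" z]
  by simp_all

lemma hyp_dist_act_left:
  assumes "\<gamma> \<in> \<Gamma>" "z \<in> HH" "w \<in> HH"
  shows "hyp_dist (psl_act \<gamma> z) w = hyp_dist z (psl_act (inv\<^bsub>PSL2R\<^esub> \<gamma>) w)"
  using assms hyp_dist_psl_act[of \<gamma> z "psl_act (inv\<^bsub>PSL2R\<^esub> \<gamma>) w"] by simp

lemma proper:
  assumes "z \<in> HH" "w \<in> HH" shows "finite {\<gamma> \<in> \<Gamma>. hyp_dist z (psl_act \<gamma> w) \<le> r}"
proof (rule finite_subset[OF _ proper_base])
  show "{\<gamma> \<in> \<Gamma>. hyp_dist z (psl_act \<gamma> w) \<le> r} \<subseteq>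
     {\<gamma> \<in> \<Gamma>. hyp_dist base (psl_act \<gamma> base) \<le> hyp_dist base z + r + hyp_dist w base}"
  proof safe
    fix \<gamma> assume g: "\<gamma> \<in> \<Gamma>" "hyp_dist z (psl_act \<gamma> w) \<le> r"
    have "hyp_dist base (psl_act \<gamma> base) \<le> hyp_dist base z + hyp_dist z (psl_act \<gamma> base)"
      using g assms base by (intro hyp_dist_triangle) auto
    also have "hyp_dist z (psl_act \<gamma> base) \<le> hyp_dist z (psl_act \<gamma> w) + hyp_dist (psl_act \<gamma> w) (psl_act \<gamma> base)"
      using g assms base by (intro hyp_dist_triangle) auto
    also have "hyp_dist (psl_act \<gamma> w) (psl_act \<gamma> base) = hyp_dist w base" using g assms base by simp
    finally show "hyp_dist base (psl_act \<gamma> base) \<le> hyp_dist base z + r + hyp_dist w base" using g by simp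
  qed
qed

section \<open>The orbit space as a metric space\<close>

definition orb :: "complex \<Rightarrow> complex set" where "orb z = {psl_act \<gamma> z |\<gamma>. \<gamma> \<in> \<Gamma>}"

lemma surface_eq: "quotient_surface \<Gamma> = orb ` HH"
  by (auto simp: quotient_surface_def orbits_def orbit_def orb_def)

lemma orb_self [simp]: "z \<in> HH \<Longrightarrow> z \<in> orb z"
  unfolding orb_def by (rule CollectI, rule exI[of _ "\<one>\<^bsub>PSL2R\<^esub>"]) simp

lemma orb_act [simp]:
  assumes "\<gamma> \<in> \<Gamma>" "z \<in> HH" shows "orb (psl_act \<gamma> z) = orb z"
proof
  show "orb (psl_act \<gamma> z) \<subseteq> orb z"
  proof
    fix w assume "w \<in> orb (psl_act \<gamma> z)"
    then obtain \<eta> where e: "\<eta> \<in> \<Gamma>" "w = psl_act \<eta> (psl_act \<gamma> z)" by (auto simp: orb_def)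
    then have "w = psl_act (\<eta> \<otimes>\<^bsub>PSL2R\<^esub> \<gamma>) z" using assms by (simp add: psl_act_mult)
    then show "w \<in> orb z" unfolding orb_def using e(1) assms(1) mult_in by blast
  qed
  show "orb z \<subseteq> orb (psl_act \<gamma> z)"
  proof
    fix w assume "w \<in> orb z"
    then obtain \<eta> where e: "\<eta> \<in> \<Gamma>" "w = psl_act \<eta> z" by (auto simp: orb_def)
    then have "w = psl_act (\<eta> \<otimes>\<^bsub>PSL2R\<^esub> inv\<^bsub>PSL2R\<^esub> \<gamma>) (psl_act \<gamma> z)"
      using assms by (simp add: psl_act_mult)
    then show "w \<in> orb (psl_act \<gamma> z)"
      unfolding orb_def using e(1) assms(1) mult_in inv_in by blast
  qed
qed

lemma orb_HH: "z \<in> HH \<Longrightarrow> w \<in> orb z \<Longrightarrow> w \<in> HH"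
  by (auto simp: orb_def)

lemma orb_eq:
  assumes "z \<in> HH" "w \<in> orb z" shows "orb w = orb z"
proof -
  obtain \<gamma> where "\<gamma> \<in> \<Gamma>" "w = psl_act \<gamma> z" using assms(2) by (auto simp: orb_def)
  then show ?thesis using assms(1) by simp
qed

abbreviation "qd \<equiv> quotient_dist \<Gamma>"

text \<open>By properness only finitely many translates of \<open>w\<close> compete, so the infimum
  is a minimum. Distances in the quotient can therefore be lifted, which gives the triangle
  inequality and separates orbits.\<close>

lemma qd_attained:
  assumes "z \<in> HH" "w \<in> HH"
  shows "\<exists>\<gamma>\<in>\<Gamma>. qd (orb z) (orb w) = hyp_dist z (psl_act \<gamma> w) \<and>
    (\<forall>\<eta>\<in>\<Gamma>. qd (orb z) (orb w) \<le> hyp_dist z (psl_act \<eta> w))"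
proof -
  define f where "f = (\<lambda>\<gamma>. hyp_dist z (psl_act \<gamma> w))"
  define F where "F = {\<gamma> \<in> \<Gamma>. f \<gamma> \<le> hyp_dist z w}"
  have F: "finite F" unfolding F_def f_def using assms by (rule proper)
  have "\<one>\<^bsub>PSL2R\<^esub> \<in> F" using assms by (simp add: F_def f_def)
  then have "Min (f ` F) \<in> f ` F" using F by (intro Min_in) auto
  then obtain \<gamma> where g: "\<gamma> \<in> F" "f \<gamma> = Min (f ` F)" by auto
  have min: "f \<gamma> \<le> f \<eta>" if "\<eta> \<in> \<Gamma>" for \<eta>
  proof (cases "\<eta> \<in> F")
    case True then show ?thesis using g F by simp
  next
    case False then show ?thesis using g that by (auto simp: F_def)
  qed
  have "{hyp_dist z' w' | z' w'. z' \<in> orb z \<and> w' \<in> orb w} = f ` \<Gamma>"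
  proof safe
    fix z' w' assume "z' \<in> orb z" "w' \<in> orb w"
    then obtain \<eta> \<theta> where e: "\<eta> \<in> \<Gamma>" "\<theta> \<in> \<Gamma>" "z' = psl_act \<eta> z" "w' = psl_act \<theta> w"
      by (auto simp: orb_def)
    then have "hyp_dist z' w' = f (inv\<^bsub>PSL2R\<^esub> \<eta> \<otimes>\<^bsub>PSL2R\<^esub> \<theta>)"
      using assms by (simp add: f_def hyp_dist_act_left psl_act_mult)
    then show "hyp_dist z' w' \<in> f ` \<Gamma>" using e by auto
  next
    fix \<eta> assume "\<eta> \<in> \<Gamma>"
    then have "psl_act \<eta> w \<in> orb w" by (auto simp: orb_def)
    then show "\<exists>z' w'. f \<eta> = hyp_dist z' w' \<and> z' \<in> orb z \<and> w' \<in> orb w"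
      unfolding f_def using orb_self[OF assms(1)] by blast
  qed
  moreover have "Inf (f ` \<Gamma>) = f \<gamma>"
    using g(1) min by (intro cInf_eq_minimum) (auto simp: F_def simp del: image_eqI intro!: imageI)
  ultimately have "qd (orb z) (orb w) = f \<gamma>"
    using assms by (simp add: quotient_dist_def surface_eq)
  then show ?thesis using g(1) min unfolding F_def f_def by auto
qed

lemma qd_le:
  assumes "z \<in> HH" "w \<in> HH" shows "qd (orb z) (orb w) \<le> hyp_dist z w"
proof -
  have "qd (orb z) (orb w) \<le> hyp_dist z (psl_act \<one>\<^bsub>PSL2R\<^esub> w)"
    using qd_attained[OF assms] one_in by blast
  then show ?thesis using assms by simp
qed

lemma qd_lift:
  assumes "z \<in> HH" "w \<in> HH"
  obtains w' where "w' \<in> HH" "orb w' = orb w" "hyp_dist z w' = qd (orb z) (orb w)"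
proof -
  obtain \<gamma> where "\<gamma> \<in> \<Gamma>" "qd (orb z) (orb w) = hyp_dist z (psl_act \<gamma> w)"
    using qd_attained[OF assms] by blast
  then show ?thesis using that[of "psl_act \<gamma> w"] assms by simp
qed

lemma qd_nonneg:
  assumes "z \<in> HH" "w \<in> HH" shows "qd (orb z) (orb w) \<ge> 0"
proof -
  obtain w' where "w' \<in> HH" "hyp_dist z w' = qd (orb z) (orb w)" using qd_lift[OF assms] by blast
  then show ?thesis using hyp_dist_nonneg[OF assms(1)] by metis
qed

lemma qd_commute: "qd p q = qd q p"
proof -
  have "{hyp_dist z w |z w. z \<in> p \<and> w \<in> q} = {hyp_dist z w |z w. z \<in> q \<and> w \<in> p}"
    by (rule Collect_cong) (metis hyp_dist_commute)
  then show ?thesis by (simp add: quotient_dist_def)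
qed

lemma Metric_space: "Metric_space (quotient_surface \<Gamma>) qd"
proof
  show "0 \<le> qd p q" for p q
  proof (cases "p \<in> quotient_surface \<Gamma> \<and> q \<in> quotient_surface \<Gamma>")
    case True
    then obtain z w where "z \<in> HH" "w \<in> HH" "p = orb z" "q = orb w" by (auto simp: surface_eq)
    then show ?thesis using qd_nonneg by blast
  qed (auto simp: quotient_dist_def)
  show "qd p q = qd q p" for p q by (rule qd_commute)
  show "qd p q = 0 \<longleftrightarrow> p = q" if pq: "p \<in> quotient_surface \<Gamma>" "q \<in> quotient_surface \<Gamma>" for p q
  proof -
    obtain z w where zw: "z \<in> HH" "w \<in> HH" "p = orb z" "q = orb w"
      using pq unfolding surface_eq by blast
    obtain w' where w': "w' \<in> HH" "orb w' = orb w" "hyp_dist z w' = qd (orb z) (orb w)"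
      using qd_lift[OF zw(1,2)] by blast
    have "qd p q = 0 \<Longrightarrow> p = q" using zw w' hyp_dist_eq_0[of z w'] by auto
    moreover have "qd p p \<le> 0" using qd_le[of z z] zw by simp
    moreover have "qd p p \<ge> 0" using qd_nonneg zw by blast
    ultimately show ?thesis by auto
  qed
  show "qd p r \<le> qd p q + qd q r"
    if pqr: "p \<in> quotient_surface \<Gamma>" "q \<in> quotient_surface \<Gamma>" "r \<in> quotient_surface \<Gamma>" for p q r
  proof -
    obtain x y z where xyz: "x \<in> HH" "y \<in> HH" "z \<in> HH" "p = orb x" "q = orb y" "r = orb z"
      using pqr by (auto simp: surface_eq)
    obtain y' where y': "y' \<in> HH" "orb y' = orb y" "hyp_dist x y' = qd (orb x) (orb y)"
      using qd_lift[OF xyz(1,2)] by blast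
    obtain z' where z': "z' \<in> HH" "orb z' = orb z" "hyp_dist y' z' = qd (orb y') (orb z)"
      using qd_lift[OF y'(1) xyz(3)] by blast
    have "qd p r \<le> hyp_dist x z'" using qd_le[of x z'] xyz z' by simp
    also have "\<dots> \<le> hyp_dist x y' + hyp_dist y' z'" using xyz y' z' by (intro hyp_dist_triangle)
    finally show ?thesis using xyz y' z' by simp
  qed
qed

interpretation Q: Metric_space "quotient_surface \<Gamma>" qd by (rule Metric_space)

text \<open>A closed ball about \<open>base\<close> meets every orbit, so the quotient is a
  continuous image of a compact set.\<close>

lemma compact_quotient: "compact_space Q.mtopology"
proof -
  obtain R where R: "\<forall>z\<in>HH. \<exists>\<gamma>\<in>\<Gamma>. hyp_dist base (psl_act \<gamma> z) \<le> R" using cocompact by blast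
  define K where "K = {z \<in> HH. hyp_dist base z \<le> R}"
  have K: "compact K" "K \<subseteq> HH" using compact_hyp_cball[OF base] by (auto simp: K_def)
  have surj: "orb ` K = quotient_surface \<Gamma>"
  proof -
    have "orb z \<in> orb ` K" if z: "z \<in> HH" for z
    proof -
      obtain \<gamma> where g: "\<gamma> \<in> \<Gamma>" "hyp_dist base (psl_act \<gamma> z) \<le> R" using R z by auto
      then have "psl_act \<gamma> z \<in> K" using z by (simp add: K_def)
      moreover have "orb z = orb (psl_act \<gamma> z)" using g z by simp
      ultimately show ?thesis by blast
    qed
    then show ?thesis using K by (auto simp: surface_eq)
  qed
  have "continuous_map (top_of_set K) Q.mtopology orb"
    unfolding Q.continuous_map_to_metric
  proof (intro ballI allI impI)
    fix z and e :: real assume z: "z \<in> topspace (top_of_set K)" and e: "e > 0"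
    then have zH: "z \<in> HH" using K by auto
    define U where "U = K \<inter> {w \<in> HH. hyp_dist z w < e}"
    have "openin (top_of_set K) U" unfolding U_def using open_hyp_ball[OF zH] by (simp add: openin_open_Int)
    moreover have "z \<in> U" using z e zH by (auto simp: U_def)
    moreover have "orb w \<in> Q.mball (orb z) e" if "w \<in> U" for w
    proof -
      have w: "w \<in> HH" "hyp_dist z w < e" using that by (auto simp: U_def)
      have "orb z \<in> quotient_surface \<Gamma>" "orb w \<in> quotient_surface \<Gamma>"
        using zH w by (auto simp: surface_eq)
      then show ?thesis using qd_le[OF zH w(1)] w(2) by (simp add: Q.in_mball)
    qed
    ultimately show "\<exists>U. openin (top_of_set K) U \<and> z \<in> U \<and> (\<forall>y\<in>U. orb y \<in> Q.mball (orb z) e)" by blast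
  qed
  then have "compactin Q.mtopology (orb ` K)"
    using K(1) by (intro image_compactin[of "top_of_set K"]) (auto simp: compactin_subtopology compactin_euclidean_iff)
  then show ?thesis by (simp add: surj compact_space_def)
qed

text \<open>The squared Euclidean norm \<open>f B\<close> of a matrix is twice the cosh of the
  distance by which it moves \<open>\<i>\<close>. By properness a Euclidean ball contains finitely
  many matrices of the group, so every union of cosets from \<open>\<Gamma>\<close> is
  closed.\<close>

lemma discrete: "subtopology PSL2R_topology \<Gamma> = discrete_topology \<Gamma>"
proof -
  have i: "\<i> \<in> HH" by (simp add: HH_iff)
  have cl: "closed (\<Union>V)" if V: "V \<subseteq> \<Gamma>" for V
    unfolding closed_limpt
  proof (intro allI impI, rule ccontr)
    fix A assume lim: "A islimpt (\<Union>V)"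
    have inf: "infinite (\<Union>V \<inter> ball A 1)" using lim by (simp add: islimpt_eq_infinite_ball)
    define f where "f = (\<lambda>B::real^2^2. (B$1$1)\<^sup>2 + (B$1$2)\<^sup>2 + (B$2$1)\<^sup>2 + (B$2$2)\<^sup>2)"
    have "bounded (f ` cball A 1)"
      unfolding f_def by (intro compact_imp_bounded compact_continuous_image continuous_intros compact_cball)
    then obtain C where C': "\<forall>y\<in>f ` cball A 1. norm y \<le> C" unfolding bounded_iff by blast
    have C: "f B \<le> C" if "B \<in> ball A 1" for B
    proof -
      have "f B \<in> f ` cball A 1" using that ball_subset_cball by blast
      then have "\<bar>f B\<bar> \<le> C" using C' by (metis real_norm_def)
      then show ?thesis by simp
    qed
    define F where "F = {\<gamma> \<in> \<Gamma>. hyp_dist \<i> (psl_act \<gamma> \<i>) \<le> arcosh (max 1 (C / 2))}"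
    have F: "finite F" unfolding F_def using i by (intro proper)
    have "\<Union>V \<inter> ball A 1 \<subseteq> \<Union>F"
    proof
      fix B assume B: "B \<in> \<Union>V \<inter> ball A 1"
      then obtain \<gamma> where g: "\<gamma> \<in> V" "B \<in> \<gamma>" by blast
      then have gG: "\<gamma> \<in> \<Gamma>" using V by blast
      then obtain B' where B': "det B' = 1" "\<gamma> = {B', - B'}" "psl_act \<gamma> = gact B'"
        by (meson PSL2R_cases in_carrier)
      obtain a b c d where m: "B' = mat2 a b c d" by (rule mat2_cases)
      have fB: "f B = f B'" using g B' by (auto simp: f_def)
      have cd: "cdist \<i> (gact B' \<i>) = f B' / 2"
        using B'(1) i by (simp add: cdist_def hmat_gact) (simp add: m hmat_def f_def power2_eq_square field_simps)
      have gi: "gact B' \<i> \<in> HH" using B'(1) i by (simp add: hmat_gact)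
      have "hyp_dist \<i> (psl_act \<gamma> \<i>) = arcosh (f B' / 2)"
        unfolding B'(3) hyp_dist_eq[OF i gi] cd ..
      moreover have "f B' / 2 \<ge> 1" using cdist_ge_1[OF i gi] unfolding cd .
      moreover have "f B' \<le> C" using C[of B] B fB by simp
      ultimately have "hyp_dist \<i> (psl_act \<gamma> \<i>) \<le> arcosh (max 1 (C / 2))"
        by (metis arcosh_mono_real divide_right_mono le_max_iff_disj zero_le_numeral)
      then show "B \<in> \<Union>F" using g gG by (auto simp: F_def)
    qed
    moreover have "finite (\<Union>F)"
    proof (rule finite_Union[OF F])
      fix \<gamma> assume "\<gamma> \<in> F"
      then have "\<gamma> \<in> carrier PSL2R" by (simp add: F_def)
      then show "finite \<gamma>" by (auto simp: carrier_PSL2R)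
    qed
    ultimately show False using inf finite_subset by blast
  qed
  have sub: "\<Gamma> \<subseteq> carrier PSL2R" by (auto)
  have disj: "\<gamma> = \<eta>" if "\<gamma> \<in> carrier PSL2R" "\<eta> \<in> carrier PSL2R" "A \<in> \<gamma>" "A \<in> \<eta>" for \<gamma> \<eta> A
    using that by (auto simp: carrier_PSL2R)
  have op: "openin PSL2R_topology (carrier PSL2R - V)" if V: "V \<subseteq> \<Gamma>" for V
  proof -
    have "\<Union>(carrier PSL2R - V) = carrier SL2R \<inter> - \<Union>V"
    proof safe
      fix A \<gamma> assume "\<gamma> \<in> carrier PSL2R" "A \<in> \<gamma>"
      moreover have "det (- B) = det B" for B :: "real^2^2" by (cases B rule: mat2_cases) simp
      ultimately show "A \<in> carrier SL2R" by (auto simp: carrier_PSL2R SL2R_def)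
    next
      fix A \<gamma> \<eta> assume *: "\<gamma> \<in> carrier PSL2R" "A \<in> \<gamma>" "\<gamma> \<notin> V" "\<eta> \<in> V" "A \<in> \<eta>"
      then have "\<eta> \<in> carrier PSL2R" using V by auto
      then have "\<gamma> = \<eta>" using * by (intro disj[of \<gamma> \<eta> A])
      then show False using * by simp
    next
      fix A assume "A \<in> carrier SL2R" "A \<notin> \<Union>V"
      then show "A \<in> \<Union>(carrier PSL2R - V)" by (auto simp: carrier_PSL2R SL2R_def intro!: exI[of _ "{A, -A}"])
    qed
    then show ?thesis using cl[OF V]
      by (simp add: openin_PSL2R_topology openin_open_Int open_Compl)
  qed
  have top: "topspace PSL2R_topology = carrier PSL2R"
  proof
    show "topspace PSL2R_topology \<subseteq> carrier PSL2R"
      using openin_PSL2R_topology[THEN iffD1, OF openin_topspace] by blast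
    show "carrier PSL2R \<subseteq> topspace PSL2R_topology" using openin_subset[OF op[of "{}"]] by simp
  qed
  show ?thesis
  proof (rule sym, subst discrete_topology_unique_alt, intro conjI ballI)
    show "topspace (subtopology PSL2R_topology \<Gamma>) \<subseteq> \<Gamma>" by simp
    fix \<gamma> assume "\<gamma> \<in> \<Gamma>"
    then have "{\<gamma>} = (carrier PSL2R - (\<Gamma> - {\<gamma>})) \<inter> \<Gamma>" using sub by auto
    then show "openin (subtopology PSL2R_topology \<Gamma>) {\<gamma>}"
      using op[of "\<Gamma> - {\<gamma>}"] by (metis Diff_subset openin_subtopology)
  qed
qed

lemma fuchsian: "fuchsian \<Gamma>"
  by (simp add: fuchsian_def subgroup discrete)

lemma closed_surface_group: "closed_surface_group \<Gamma>"
  using free compact_quotient by (auto simp: closed_surface_group_def fuchsian)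

text \<open>On the compact set \<open>K\<close> only finitely many elements move some point by at
  most 1, and each of these has a positive minimal displacement there. Conjugation brings an
  arbitrary point into \<open>K\<close>.\<close>

lemma injectivity_radius:
  "\<exists>\<rho>>0. \<forall>\<gamma>\<in>\<Gamma>. \<forall>z\<in>HH. \<gamma> \<noteq> \<one>\<^bsub>PSL2R\<^esub> \<longrightarrow> \<rho> \<le> hyp_dist z (psl_act \<gamma> z)"
proof -
  obtain R where R: "\<forall>z\<in>HH. \<exists>\<gamma>\<in>\<Gamma>. hyp_dist base (psl_act \<gamma> z) \<le> R" using cocompact by blast
  define K where "K = {z \<in> HH. hyp_dist base z \<le> R}"
  have K: "compact K" "K \<subseteq> HH" using compact_hyp_cball[OF base] by (auto simp: K_def)
  have Kne: "K \<noteq> {}" using R base unfolding K_def by (metis (mono_tags, lifting) empty_iff in_carrier mem_Collect_eq psl_act_HH)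
  define F where "F = {\<gamma> \<in> \<Gamma>. \<gamma> \<noteq> \<one>\<^bsub>PSL2R\<^esub> \<and> (\<exists>z\<in>K. hyp_dist z (psl_act \<gamma> z) \<le> 1)}"
  have "F \<subseteq> {\<gamma> \<in> \<Gamma>. hyp_dist base (psl_act \<gamma> base) \<le> R + 1 + R}"
  proof
    fix \<gamma> assume "\<gamma> \<in> F"
    then obtain z where g: "\<gamma> \<in> \<Gamma>" "z \<in> K" "hyp_dist z (psl_act \<gamma> z) \<le> 1" by (auto simp: F_def)
    have z: "z \<in> HH" "hyp_dist base z \<le> R" using g by (auto simp: K_def)
    have "hyp_dist base (psl_act \<gamma> base) \<le> hyp_dist base z + hyp_dist z (psl_act \<gamma> base)"
      using g z base by (intro hyp_dist_triangle) auto
    also have "hyp_dist z (psl_act \<gamma> base) \<le> hyp_dist z (psl_act \<gamma> z) + hyp_dist (psl_act \<gamma> z) (psl_act \<gamma> base)"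
      using g z base by (intro hyp_dist_triangle) auto
    also have "hyp_dist (psl_act \<gamma> z) (psl_act \<gamma> base) = hyp_dist base z"
      using g z base by (simp add: hyp_dist_commute)
    finally show "\<gamma> \<in> {\<gamma> \<in> \<Gamma>. hyp_dist base (psl_act \<gamma> base) \<le> R + 1 + R}" using g z by simp
  qed
  then have F: "finite F" using proper_base finite_subset by blast
  have "\<exists>e>0. \<forall>z\<in>K. e \<le> hyp_dist z (psl_act \<gamma> z)" if g: "\<gamma> \<in> F" for \<gamma>
  proof -
    have gG: "\<gamma> \<in> \<Gamma>" "\<gamma> \<noteq> \<one>\<^bsub>PSL2R\<^esub>" using g by (auto simp: F_def)
    have "continuous_on K (\<lambda>z. hyp_dist z (psl_act \<gamma> z))"
      using K gG continuous_on_subset[OF continuous_on_psl_act K(2)]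
      by (intro continuous_on_hyp_dist) auto
    then obtain x where x: "x \<in> K" "\<And>z. z \<in> K \<Longrightarrow> hyp_dist x (psl_act \<gamma> x) \<le> hyp_dist z (psl_act \<gamma> z)"
      using continuous_attains_inf[OF K(1) Kne] by metis
    have "hyp_dist x (psl_act \<gamma> x) \<noteq> 0" "hyp_dist x (psl_act \<gamma> x) \<ge> 0"
      using x(1) K gG free[of \<gamma> x] hyp_dist_eq_0[of x "psl_act \<gamma> x"] hyp_dist_nonneg[of x "psl_act \<gamma> x"]
      by (auto simp: subset_iff)
    then show ?thesis using x by (intro exI[of _ "hyp_dist x (psl_act \<gamma> x)"]) auto
  qed
  then obtain e where e: "\<And>\<gamma>. \<gamma> \<in> F \<Longrightarrow> e \<gamma> > 0" "\<And>\<gamma> z. \<gamma> \<in> F \<Longrightarrow> z \<in> K \<Longrightarrow> e \<gamma> \<le> hyp_dist z (psl_act \<gamma> z)"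
    by metis
  define \<rho> where "\<rho> = Min (insert 1 (e ` F))"
  have pos: "\<rho> > 0" unfolding \<rho>_def using F e(1) by (subst Min_gr_iff) auto
  have K': "\<rho> \<le> hyp_dist z (psl_act \<gamma> z)" if "\<gamma> \<in> \<Gamma>" "\<gamma> \<noteq> \<one>\<^bsub>PSL2R\<^esub>" "z \<in> K" for \<gamma> z
  proof (cases "\<gamma> \<in> F")
    case True
    then have "\<rho> \<le> e \<gamma>" unfolding \<rho>_def using F by (intro Min_le) auto
    then show ?thesis using e(2)[OF True that(3)] by simp
  next
    case False
    then have "hyp_dist z (psl_act \<gamma> z) > 1" using that by (force simp: F_def)
    moreover have "\<rho> \<le> 1" unfolding \<rho>_def using F by (intro Min_le) auto
    ultimately show ?thesis by simp
  qed
  have "\<rho> \<le> hyp_dist z (psl_act \<gamma> z)" if g: "\<gamma> \<in> \<Gamma>" "\<gamma> \<noteq> \<one>\<^bsub>PSL2R\<^esub>" and z: "z \<in> HH" for \<gamma> z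
  proof -
    obtain \<eta> where h: "\<eta> \<in> \<Gamma>" "hyp_dist base (psl_act \<eta> z) \<le> R" using R z by auto
    define \<gamma>' where "\<gamma>' = \<eta> \<otimes>\<^bsub>PSL2R\<^esub> (\<gamma> \<otimes>\<^bsub>PSL2R\<^esub> inv\<^bsub>PSL2R\<^esub> \<eta>)"
    have a: "psl_act \<gamma>' (psl_act \<eta> z) = psl_act \<eta> (psl_act \<gamma> z)"
      using g h z by (simp add: \<gamma>'_def psl_act_mult)
    have "\<gamma>' \<noteq> \<one>\<^bsub>PSL2R\<^esub>"
    proof
      assume "\<gamma>' = \<one>\<^bsub>PSL2R\<^esub>"
      then have "hyp_dist (psl_act \<eta> (psl_act \<gamma> z)) (psl_act \<eta> z) = 0" using a h z by simp
      then have "hyp_dist (psl_act \<gamma> z) z = 0" using g h z by simp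
      then show False using free[of \<gamma> z] g z hyp_dist_eq_0[of "psl_act \<gamma> z" z] by auto
    qed
    then have "\<rho> \<le> hyp_dist (psl_act \<eta> z) (psl_act \<gamma>' (psl_act \<eta> z))"
      using g h z by (intro K') (auto simp: \<gamma>'_def K_def)
    then show ?thesis using g h z by (simp add: a)
  qed
  then show ?thesis using pos by blast
qed

text \<open>A Borel fundamental set is chosen greedily. Finitely many balls of radius
  \<open>\<rho> / 2\<close> cover \<open>K\<close>, and each contains at most one point of an orbit.
  From the ball with index \<open>i\<close> the orbits that meet an earlier ball,
  \<open>sat i\<close>, are removed. The result lies in a hyperbolic ball, where the area density is
  bounded.\<close>

lemma cofinite: "cofinite_fuchsian \<Gamma>"
proof -
  obtain \<rho> where \<rho>: "\<rho> > 0"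
    "\<And>\<gamma> z. \<gamma> \<in> \<Gamma> \<Longrightarrow> \<gamma> \<noteq> \<one>\<^bsub>PSL2R\<^esub> \<Longrightarrow> z \<in> HH \<Longrightarrow> \<rho> \<le> hyp_dist z (psl_act \<gamma> z)"
    using injectivity_radius by blast
  obtain R where R: "\<forall>z\<in>HH. \<exists>\<gamma>\<in>\<Gamma>. hyp_dist base (psl_act \<gamma> z) \<le> R" using cocompact by blast
  define K where "K = {z \<in> HH. hyp_dist base z \<le> R}"
  have K: "compact K" "K \<subseteq> HH" using compact_hyp_cball[OF base] by (auto simp: K_def)
  define B where "B = (\<lambda>x. {z \<in> HH. hyp_dist x z < \<rho> / 2})"
  have oB: "open (B x)" if "x \<in> HH" for x unfolding B_def using that by (rule open_hyp_ball)
  have "K \<subseteq> (\<Union>x\<in>K. B x)" using K \<rho>(1) by (auto simp: B_def)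
  then obtain Cs where Cs: "Cs \<subseteq> K" "finite Cs" "K \<subseteq> (\<Union>x\<in>Cs. B x)"
    using compactE_image[OF K(1), of K B] oB K(2) by (metis subsetD)
  obtain xs where xs: "set xs = Cs" using Cs(2) finite_list by blast
  have xsH: "xs ! i \<in> HH" if "i < length xs" for i
    using that xs Cs K by (metis nth_mem subsetD)
  define sat where "sat = (\<lambda>i. \<Union>j<i. \<Union>\<gamma>\<in>\<Gamma>. B (psl_act \<gamma> (xs ! j)))"
  define F where "F = (\<Union>i<length xs. B (xs ! i) - sat i)"
  have sat: "w \<in> sat i" if w: "j < i" "j < length xs" "w \<in> HH" "z \<in> orb w" "z \<in> B (xs ! j)" for i j w z
  proof -
    obtain \<gamma> where g: "\<gamma> \<in> \<Gamma>" "z = psl_act \<gamma> w" using w by (auto simp: orb_def)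
    have "hyp_dist (psl_act (inv\<^bsub>PSL2R\<^esub> \<gamma>) (xs ! j)) w < \<rho> / 2"
      using w g xsH[of j] by (simp add: B_def hyp_dist_act_left)
    then have "w \<in> B (psl_act (inv\<^bsub>PSL2R\<^esub> \<gamma>) (xs ! j))" using w by (simp add: B_def)
    then show ?thesis unfolding sat_def using w(1) g inv_in by blast
  qed
  have satD: "\<exists>j z. j < i \<and> z \<in> orb w \<and> z \<in> B (xs ! j)" if sw: "w \<in> sat i" and i: "i \<le> length xs" for i w
  proof -
    obtain j \<gamma> where j: "j < i" "\<gamma> \<in> \<Gamma>" "w \<in> B (psl_act \<gamma> (xs ! j))" using sw by (auto simp: sat_def)
    then have w: "w \<in> HH" by (simp add: B_def)
    have x: "xs ! j \<in> HH" using j i xsH by simp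
    have "hyp_dist (psl_act \<gamma> (xs ! j)) w < \<rho> / 2" using j by (simp add: B_def)
    then have "psl_act (inv\<^bsub>PSL2R\<^esub> \<gamma>) w \<in> B (xs ! j)"
      using j w x by (simp add: B_def hyp_dist_act_left)
    moreover have "psl_act (inv\<^bsub>PSL2R\<^esub> \<gamma>) w \<in> orb w" using j by (auto simp: orb_def)
    ultimately show ?thesis using j by blast
  qed
  have FH: "F \<subseteq> HH" by (auto simp: F_def B_def)
  have borel: "F \<in> sets borel"
  proof -
    have "open (sat i)" if "i \<le> length xs" for i
      unfolding sat_def using that xsH by (intro open_UN ballI oB psl_act_HH in_carrier) auto
    then show ?thesis unfolding F_def using oB xsH
      by (intro sets.finite_UN sets.Diff borel_open) auto
  qed
  have uniq: "\<exists>!z. z \<in> F \<inter> p" if p: "p \<in> quotient_surface \<Gamma>" for p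
  proof -
    obtain z0 where z0: "z0 \<in> HH" "p = orb z0" using p by (auto simp: surface_eq)
    obtain \<gamma> where g: "\<gamma> \<in> \<Gamma>" "hyp_dist base (psl_act \<gamma> z0) \<le> R" using R z0 by auto
    define z where "z = psl_act \<gamma> z0"
    have z: "z \<in> K" "z \<in> p" using g z0 by (auto simp: z_def K_def orb_def)
    have pH: "p \<subseteq> HH" "\<And>w. w \<in> p \<Longrightarrow> orb w = p"
      using z0(2) orb_HH[OF z0(1)] orb_eq[OF z0(1)] by blast+
    obtain i0 where "i0 < length xs" "z \<in> B (xs ! i0)"
      using Cs(3) z xs by (metis UN_E in_set_conv_nth subsetD)
    then have ex: "\<exists>i. i < length xs \<and> (\<exists>z\<in>p. z \<in> B (xs ! i))" using z by blast
    define i where "i = (LEAST i. i < length xs \<and> (\<exists>z\<in>p. z \<in> B (xs ! i)))"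
    have i: "i < length xs" "\<exists>z\<in>p. z \<in> B (xs ! i)" using LeastI_ex[OF ex] by (auto simp: i_def)
    have imin: "i \<le> j" if "j < length xs" "w \<in> p" "w \<in> B (xs ! j)" for j w
      unfolding i_def using that by (intro Least_le) auto
    from i obtain y where y: "y \<in> p" "y \<in> B (xs ! i)" by blast
    have "y \<notin> sat i"
    proof
      assume "y \<in> sat i"
      then obtain j z' where "j < i" "z' \<in> orb y" "z' \<in> B (xs ! j)" using satD[of y i] i by auto
      then show False using imin[of j z'] pH y i by auto
    qed
    then have yF: "y \<in> F \<inter> p" using y i by (auto simp: F_def)
    have "w = y" if w: "w \<in> F \<inter> p" for w
    proof -
      obtain k where k: "k < length xs" "w \<in> B (xs ! k)" "w \<notin> sat k" using w by (auto simp: F_def)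
      have wp: "w \<in> p" "w \<in> HH" using w pH by auto
      have "i \<le> k" using imin k wp by blast
      moreover have "\<not> i < k" using sat[of i k w y] k i y wp pH by auto
      ultimately have "w \<in> B (xs ! i)" using k by simp
      then have "hyp_dist (xs ! i) w < \<rho> / 2" "hyp_dist (xs ! i) y < \<rho> / 2" using y by (auto simp: B_def)
      moreover have "hyp_dist y w \<le> hyp_dist y (xs ! i) + hyp_dist (xs ! i) w"
        using y pH wp xsH[OF i(1)] by (intro hyp_dist_triangle) auto
      ultimately have d: "hyp_dist y w < \<rho>" by (simp add: hyp_dist_commute[of y])
      have "w \<in> orb y" using pH y wp by simp
      then obtain \<eta> where e: "\<eta> \<in> \<Gamma>" "w = psl_act \<eta> y" by (auto simp: orb_def)
      have "\<eta> = \<one>\<^bsub>PSL2R\<^esub>" using \<rho>(2)[of \<eta> y] e d y pH by force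
      then show ?thesis using e y pH by auto
    qed
    then show ?thesis using yF by blast
  qed
  define K' where "K' = {z \<in> HH. hyp_dist base z \<le> R + \<rho>}"
  have FK: "F \<subseteq> K'"
  proof
    fix w assume "w \<in> F"
    then obtain i where i: "i < length xs" "w \<in> B (xs ! i)" by (auto simp: F_def)
    have "xs ! i \<in> K" using i xs Cs by (metis nth_mem subsetD)
    then have "hyp_dist base (xs ! i) \<le> R" by (simp add: K_def)
    moreover have "hyp_dist (xs ! i) w < \<rho> / 2" "w \<in> HH" using i by (auto simp: B_def)
    moreover have "hyp_dist base w \<le> hyp_dist base (xs ! i) + hyp_dist (xs ! i) w"
      using i base xsH calculation by (intro hyp_dist_triangle) auto
    ultimately show "w \<in> K'" using \<rho>(1) by (simp add: K'_def)
  qed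
  define m where "m = Im base / (2 * cosh (R + \<rho>))"
  have m: "m > 0" using base by (simp add: m_def HH_iff)
  have "(\<integral>\<^sup>+ z\<in>F. ennreal (1 / (Im z)\<^sup>2) \<partial>lborel) \<le> (\<integral>\<^sup>+ z. ennreal (1 / m\<^sup>2) * indicator K' z \<partial>lborel)"
  proof (intro nn_integral_mono)
    fix z
    show "ennreal (1 / (Im z)\<^sup>2) * indicator F z \<le> ennreal (1 / m\<^sup>2) * indicator K' z"
    proof (cases "z \<in> F")
      case True
      then have "z \<in> K'" using FK by blast
      then have "m \<le> Im z" unfolding m_def using base hyp_cball_bounds(1) by (simp add: K'_def)
      then have "1 / (Im z)\<^sup>2 \<le> 1 / m\<^sup>2" using m by (intro divide_left_mono power_mono) auto
      then show ?thesis using True \<open>z \<in> K'\<close> by (simp add: ennreal_leI)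
    qed simp
  qed
  also have "\<dots> = ennreal (1 / m\<^sup>2) * emeasure lborel K'"
    using compact_hyp_cball[OF base, of "R + \<rho>"] by (intro nn_integral_cmult_indicator) (simp add: K'_def borel_compact)
  also have "\<dots> < \<infinity>"
    using emeasure_compact_finite[OF compact_hyp_cball[OF base, of "R + \<rho>"]]
    by (simp add: K'_def ennreal_mult_less_top)
  finally have "(\<integral>\<^sup>+ z\<in>F. ennreal (1 / (Im z)\<^sup>2) \<partial>lborel) < \<infinity>" .
  then show ?thesis unfolding cofinite_fuchsian_def using fuchsian borel FH uniq
    by (intro conjI bexI[of _ F] ballI)
qed

section \<open>Closed geodesics and the systole\<close>

text \<open>A smaller trace would allow displacements below the injectivity radius.\<close>

lemma trace_gt_2:
  assumes "\<gamma> \<in> \<Gamma>" "\<gamma> \<noteq> \<one>\<^bsub>PSL2R\<^esub>" shows "psl_trace \<gamma> > 2"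
proof (rule ccontr)
  assume "\<not> psl_trace \<gamma> > 2"
  moreover obtain A where A: "det A = 1" "psl_act \<gamma> = gact A" "psl_trace \<gamma> = \<bar>trace A\<bar>"
    using assms(1) by (meson PSL2R_cases in_carrier)
  ultimately have tr: "\<bar>trace A\<bar> \<le> 2" by simp
  obtain \<rho> where \<rho>: "\<rho> > 0"
    "\<And>\<gamma> z. \<gamma> \<in> \<Gamma> \<Longrightarrow> \<gamma> \<noteq> \<one>\<^bsub>PSL2R\<^esub> \<Longrightarrow> z \<in> HH \<Longrightarrow> \<rho> \<le> hyp_dist z (psl_act \<gamma> z)"
    using injectivity_radius by blast
  have "cosh \<rho> - 1 > 0" using \<rho>(1) cosh_real_strict_mono[of 0 \<rho>] by simp
  then obtain z where z: "z \<in> HH" "cdist z (gact A z) < 1 + (cosh \<rho> - 1)"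
    using small_displacement[OF A(1) tr] by blast
  then have "cosh (hyp_dist z (psl_act \<gamma> z)) < cosh \<rho>" using A by (simp add: cosh_hyp_dist hmat_gact)
  then show False using \<rho>(2)[OF assms z(1)] \<rho>(1) by (smt (verit) cosh_real_nonneg_le_iff)
qed

text \<open>The projection of the axis is locally distance-preserving at scale
  \<open>\<rho> / 2\<close>: a nontrivial translate that is equally near would move
  \<open>g s\<close> by less than the injectivity radius \<open>\<rho>\<close>.\<close>

lemma closed_geodesic_of_element:
  assumes "\<gamma> \<in> \<Gamma>" "\<gamma> \<noteq> \<one>\<^bsub>PSL2R\<^esub>" "l > 0" "psl_trace \<gamma> = 2 * cosh (l / 2)"
  shows "l \<in> closed_geodesic_lengths (quotient_surface \<Gamma>) qd"
proof -
  obtain A where A: "det A = 1" "psl_act \<gamma> = gact A" "psl_trace \<gamma> = \<bar>trace A\<bar>"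
    using assms(1) by (meson PSL2R_cases in_carrier)
  obtain g where g: "range g \<subseteq> HH" "\<And>r s. hyp_dist (g r) (g s) = \<bar>r - s\<bar>" "\<And>s. psl_act \<gamma> (g s) = g (s + l)"
    using hyperbolic_axis[OF A(1) _ assms(3)] A assms(4) by metis
  have gH: "g s \<in> HH" for s using g(1) by blast
  obtain \<rho> where \<rho>: "\<rho> > 0"
    "\<And>\<gamma> z. \<gamma> \<in> \<Gamma> \<Longrightarrow> \<gamma> \<noteq> \<one>\<^bsub>PSL2R\<^esub> \<Longrightarrow> z \<in> HH \<Longrightarrow> \<rho> \<le> hyp_dist z (psl_act \<gamma> z)"
    using injectivity_radius by blast
  have loc: "qd (orb (g r)) (orb (g s)) = \<bar>r - s\<bar>" if "\<bar>r - s\<bar> < \<rho> / 2" for r s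
  proof -
    obtain \<eta> where e: "\<eta> \<in> \<Gamma>" "qd (orb (g r)) (orb (g s)) = hyp_dist (g r) (psl_act \<eta> (g s))"
      using qd_attained[OF gH gH] by blast
    have le: "qd (orb (g r)) (orb (g s)) \<le> \<bar>r - s\<bar>" using qd_le[OF gH gH] g(2) by metis
    have "\<eta> = \<one>\<^bsub>PSL2R\<^esub>"
    proof (rule ccontr)
      assume "\<eta> \<noteq> \<one>\<^bsub>PSL2R\<^esub>"
      then have "\<rho> \<le> hyp_dist (g s) (psl_act \<eta> (g s))" using \<rho>(2) e gH by blast
      also have "\<dots> \<le> hyp_dist (g s) (g r) + hyp_dist (g r) (psl_act \<eta> (g s))"
        using gH e by (intro hyp_dist_triangle) auto
      also have "\<dots> \<le> \<bar>r - s\<bar> + \<bar>r - s\<bar>" using g(2)[of s r] le e by linarith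
      finally show False using that by simp
    qed
    then show ?thesis using e g(2) gH by simp
  qed
  have "geodesic_line (quotient_surface \<Gamma>) qd (\<lambda>s. orb (g s))"
    unfolding geodesic_line_def
  proof (intro conjI allI)
    show "range (\<lambda>s. orb (g s)) \<subseteq> quotient_surface \<Gamma>" using gH by (auto simp: surface_eq)
    fix t
    show "\<exists>\<epsilon>>0. \<forall>r\<in>{t - \<epsilon><..<t + \<epsilon>}. \<forall>s\<in>{t - \<epsilon><..<t + \<epsilon>}. qd (orb (g r)) (orb (g s)) = \<bar>r - s\<bar>"
      using \<rho>(1) by (intro exI[of _ "\<rho> / 4"] conjI ballI loc) (auto simp: abs_if)
  qed
  moreover have "orb (g (t + l)) = orb (g t)" for t
    using g(3)[of t] orb_act[OF assms(1) gH, of t] by simp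
  ultimately show ?thesis using assms(3) by (auto simp: closed_geodesic_lengths_def)
qed

lemma element_of_closed_geodesic:
  assumes "l \<in> closed_geodesic_lengths (quotient_surface \<Gamma>) qd"
  shows "\<exists>\<gamma>\<in>\<Gamma>. \<gamma> \<noteq> \<one>\<^bsub>PSL2R\<^esub> \<and> psl_trace \<gamma> = 2 * cosh (l / 2)"
proof -
  obtain c where l: "l > 0" and c: "geodesic_line (quotient_surface \<Gamma>) qd c" "\<And>t. c (t + l) = c t"
    using assms by (auto simp: closed_geodesic_lengths_def)
  have per: "c (t + of_nat k * l) = c t" for t k
  proof (induction k)
    case (Suc k)
    then show ?case using c(2)[of "t + of_nat k * l"] by (simp add: algebra_simps)
  qed simp
  have "\<forall>t. \<exists>e>0. \<forall>r\<in>{t-e<..<t+e}. \<forall>s\<in>{t-e<..<t+e}. qd (c r) (c s) = \<bar>r - s\<bar>"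
    using c(1) by (auto simp: geodesic_line_def)
  then obtain e where e: "\<And>t. e t > 0"
    "\<And>t r s. r \<in> ball t (e t) \<Longrightarrow> s \<in> ball t (e t) \<Longrightarrow> qd (c r) (c s) = \<bar>r - s\<bar>"
    unfolding ball_eq_greaterThanLessThan by metis
  have "{0..l} \<subseteq> \<Union>(range (\<lambda>t. ball t (e t)))"
  proof
    fix x
    have "x \<in> ball x (e x)" using e(1) by simp
    then show "x \<in> \<Union>(range (\<lambda>t. ball t (e t)))" by blast
  qed
  \<comment> \<open>\<open>e0\<close> is a Lebesgue number for one period; by periodicity
    \<open>loc\<close> gives the same scale at all nonnegative times.\<close>
  then obtain e0 where e0: "e0 > 0" "\<forall>x\<in>{0..l}. \<exists>G\<in>range (\<lambda>t. ball t (e t)). ball x e0 \<subseteq> G"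
    by (rule Heine_Borel_lemma[OF compact_Icc]) auto
  have loc: "qd (c r) (c s) = \<bar>r - s\<bar>" if "t \<ge> 0" "\<bar>r - t\<bar> < e0" "\<bar>s - t\<bar> < e0" for t r s
  proof -
    define k where "k = nat \<lfloor>t / l\<rfloor>"
    have fl: "of_nat k = of_int \<lfloor>t / l\<rfloor>" using that l by (simp add: k_def)
    have "of_nat k \<le> t / l" "t / l < of_nat k + 1" unfolding fl by linarith+
    then have t0: "t - of_nat k * l \<in> {0..l}" using l by (simp add: field_simps)
    then obtain t' where t': "ball (t - of_nat k * l) e0 \<subseteq> ball t' (e t')" using e0(2) by blast
    have "r - of_nat k * l \<in> ball (t - of_nat k * l) e0" "s - of_nat k * l \<in> ball (t - of_nat k * l) e0"
      using that by (simp_all add: dist_real_def abs_minus_commute)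
    then have "r - of_nat k * l \<in> ball t' (e t')" "s - of_nat k * l \<in> ball t' (e t')"
      using t' by blast+
    from e(2)[OF this] show ?thesis
      using per[of "r - of_nat k * l" k] per[of "s - of_nat k * l" k] by simp
  qed
  obtain \<rho> where \<rho>: "\<rho> > 0"
    "\<And>\<gamma> z. \<gamma> \<in> \<Gamma> \<Longrightarrow> \<gamma> \<noteq> \<one>\<^bsub>PSL2R\<^esub> \<Longrightarrow> z \<in> HH \<Longrightarrow> \<rho> \<le> hyp_dist z (psl_act \<gamma> z)"
    using injectivity_radius by blast
  \<comment> \<open>With steps of length \<open>h = l / n\<close> below \<open>e0\<close>, two
    consecutive steps lie in one isometric interval about their midpoint. With
    \<open>2 * h < \<rho>\<close>, points of one orbit at distance at most \<open>2 * h\<close>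
    coincide.\<close>
  obtain n :: nat where n: "l / e0 + 2 * l / \<rho> < of_nat n" using reals_Archimedean2 by blast
  have lpos: "l / e0 > 0" "2 * l / \<rho> > 0" using l e0 \<rho> by auto
  have n0: "real n > 0" using n lpos by linarith
  define h where "h = l / of_nat n"
  have nh: "real n * h = l" using n0 by (simp add: h_def)
  have h: "h > 0" "h < e0" "2 * h < \<rho>"
  proof -
    show "h > 0" using l n0 by (simp add: h_def)
    have "l / e0 < real n" "2 * l / \<rho> < real n" using n lpos by linarith+
    then show "h < e0" "2 * h < \<rho>" using e0(1) \<rho>(1) n0 by (auto simp: h_def field_simps)
  qed
  have cs: "\<exists>z\<in>HH. c t = orb z" for t
    using c(1) unfolding geodesic_line_def surface_eq by blast
  have qd1: "qd (c (real k * h)) (c (real (Suc k) * h)) = h" for k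
    using loc[of "real k * h"] h by (simp add: algebra_simps)
  have qd2: "qd (c (real k * h)) (c (real (Suc (Suc k)) * h)) = 2 * h" for k
    using loc[of "real (Suc k) * h" "real k * h" "real (Suc (Suc k)) * h"] h by (simp add: algebra_simps)
  \<comment> \<open>The sample points of the curve are lifted one after the other, each at minimal
    distance from its predecessor.\<close>
  have "\<exists>z::nat \<Rightarrow> complex. \<forall>k. (z k \<in> HH \<and> orb (z k) = c (real k * h)) \<and> hyp_dist (z k) (z (Suc k)) = h"
  proof (rule dependent_nat_choice)
    show "\<exists>x. x \<in> HH \<and> orb x = c (real 0 * h)" using cs by metis
    fix x k assume x: "x \<in> HH \<and> orb x = c (real k * h)"
    obtain w where w: "w \<in> HH" "c (real (Suc k) * h) = orb w" using cs by metis
    obtain w' where "w' \<in> HH" "orb w' = orb w" "hyp_dist x w' = qd (orb x) (orb w)"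
      using qd_lift[of x w] x w by blast
    then show "\<exists>y. (y \<in> HH \<and> orb y = c (real (Suc k) * h)) \<and> hyp_dist x y = h"
      using x w qd1[of k] by (intro exI[of _ w']) auto
  qed
  then obtain z where z: "\<And>k. z k \<in> HH" "\<And>k. orb (z k) = c (real k * h)" "\<And>k. hyp_dist (z k) (z (Suc k)) = h"
    by blast
  have d2: "hyp_dist (z k) (z (Suc (Suc k))) = 2 * h" for k
  proof (rule antisym)
    show "hyp_dist (z k) (z (Suc (Suc k))) \<le> 2 * h"
      using hyp_dist_triangle[OF z(1) z(1) z(1), of k "Suc (Suc k)" "Suc k"] z(3)[of k] z(3)[of "Suc k"]
      by linarith
    show "2 * h \<le> hyp_dist (z k) (z (Suc (Suc k)))"
      using qd_le[OF z(1) z(1), of k "Suc (Suc k)"] qd2[of k] by (simp add: z(2))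
  qed
  have "c (real n * h) = c 0" using c(2)[of 0] nh by simp
  then have "orb (z n) = orb (z 0)" by (simp add: z(2))
  then have "z n \<in> orb (z 0)" using orb_self z(1) by blast
  then obtain \<gamma> where g: "\<gamma> \<in> \<Gamma>" "psl_act \<gamma> (z 0) = z n" by (auto simp: orb_def)
  \<comment> \<open>\<open>psl_act \<gamma> (z 1)\<close> and \<open>z (Suc n)\<close> lie in one
    orbit and both have distance \<open>h\<close> from \<open>z n\<close>, hence they agree. So
    \<open>\<gamma>\<close> respects the direction of the curve and not only the point.\<close>
  have g1: "psl_act \<gamma> (z 1) = z (Suc n)"
  proof -
    have "real (Suc n) * h = h + l" using nh by (simp add: algebra_simps)
    then have "orb (z (Suc n)) = orb (psl_act \<gamma> (z 1))" using c(2)[of h] z g by simp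
    then have "z (Suc n) \<in> orb (psl_act \<gamma> (z 1))" using orb_self z(1) by blast
    then obtain \<eta> where e: "\<eta> \<in> \<Gamma>" "z (Suc n) = psl_act \<eta> (psl_act \<gamma> (z 1))" by (auto simp: orb_def)
    have "hyp_dist (psl_act \<gamma> (z 1)) (z (Suc n)) \<le> hyp_dist (psl_act \<gamma> (z 1)) (psl_act \<gamma> (z 0)) + hyp_dist (z n) (z (Suc n))"
      using hyp_dist_triangle[of "psl_act \<gamma> (z 1)" "z n" "z (Suc n)"] g z(1) by simp
    also have "\<dots> = 2 * h" 
      unfolding hyp_dist_psl_act[OF in_carrier[OF g(1)] z(1) z(1)]
      using z(3)[of 0] z(3)[of n] by (simp add: hyp_dist_commute)
    finally have "hyp_dist (psl_act \<gamma> (z 1)) (z (Suc n)) < \<rho>" using h by simp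
    then have "\<eta> = \<one>\<^bsub>PSL2R\<^esub>" using \<rho>(2)[of \<eta> "psl_act \<gamma> (z 1)"] e g z(1) by force
    then show ?thesis using e g z(1) by simp
  qed
  obtain A where A: "det A = 1" "\<gamma> = {A, - A}" "psl_act \<gamma> = gact A" "psl_trace \<gamma> = \<bar>trace A\<bar>"
    using g(1) by (meson PSL2R_cases in_carrier)
  have "(trace A)\<^sup>2 = (2 * cosh (real n * h / 2))\<^sup>2"
    using z d2 h A g g1 by (intro trace_of_translation[of z]) auto
  then have "\<bar>trace A\<bar> = 2 * cosh (l / 2)" unfolding nh
    by (metis abs_of_nonneg cosh_real_nonneg mult_nonneg_nonneg power2_eq_iff_nonneg real_sqrt_abs zero_le_numeral)
  moreover have "\<gamma> \<noteq> \<one>\<^bsub>PSL2R\<^esub>"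
  proof
    assume "\<gamma> = \<one>\<^bsub>PSL2R\<^esub>"
    then have "A = mat 1 \<or> A = - mat 1" using A(2) by (auto simp: one_PSL2R doubleton_eq_iff)
    then have "\<bar>trace A\<bar> = 2" by (auto simp: mat2_one)
    moreover have "cosh (l / 2) > 1" using l cosh_real_strict_mono[of 0 "l/2"] by simp
    ultimately show False using \<open>\<bar>trace A\<bar> = 2 * cosh (l / 2)\<close> by simp
  qed
  ultimately show ?thesis using g(1) A(4) by (intro bexI[of _ \<gamma>] conjI) simp_all
qed

lemma systole_eq:
  assumes "\<gamma> \<in> \<Gamma>" "\<gamma> \<noteq> \<one>\<^bsub>PSL2R\<^esub>"
    and min: "\<And>\<eta>. \<eta> \<in> \<Gamma> \<Longrightarrow> \<eta> \<noteq> \<one>\<^bsub>PSL2R\<^esub> \<Longrightarrow> psl_trace \<gamma> \<le> psl_trace \<eta>"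
  shows "systole (quotient_surface \<Gamma>) qd = 2 * arcosh (psl_trace \<gamma> / 2)"
proof -
  define l where "l = 2 * arcosh (psl_trace \<gamma> / 2)"
  have t: "psl_trace \<gamma> > 2" using trace_gt_2 assms by blast
  have l: "l > 0" "psl_trace \<gamma> = 2 * cosh (l / 2)" using t by (simp_all add: l_def)
  have "systole (quotient_surface \<Gamma>) qd = l"
    unfolding systole_def
  proof (rule Least_equality)
    show "l \<in> closed_geodesic_lengths (quotient_surface \<Gamma>) qd"
      using closed_geodesic_of_element assms l by blast
    fix m assume m: "m \<in> closed_geodesic_lengths (quotient_surface \<Gamma>) qd"
    obtain \<eta> where "\<eta> \<in> \<Gamma>" "\<eta> \<noteq> \<one>\<^bsub>PSL2R\<^esub>" "psl_trace \<eta> = 2 * cosh (m / 2)"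
      using element_of_closed_geodesic[OF m] by blast
    then have "cosh (l / 2) \<le> cosh (m / 2)" using min l by fastforce
    moreover have "m > 0" using m by (simp add: closed_geodesic_lengths_def)
    ultimately show "l \<le> m" using l by (simp add: cosh_real_nonneg_le_iff)
  qed
  then show ?thesis by (simp add: l_def)
qed

text \<open>A point of the axis is moved by exactly the translation length; this converts a bound on
  the trace into a bound on a displacement.\<close>

lemma axis_point:
  assumes "\<gamma> \<in> \<Gamma>" "l > 0" "psl_trace \<gamma> = 2 * cosh (l / 2)"
  shows "\<exists>z\<in>HH. hyp_dist z (psl_act \<gamma> z) = l"
proof -
  obtain A where A: "det A = 1" "psl_act \<gamma> = gact A" "psl_trace \<gamma> = \<bar>trace A\<bar>"
    using assms(1) by (meson PSL2R_cases in_carrier)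
  obtain g where g: "range g \<subseteq> HH" "\<And>r s. hyp_dist (g r) (g s) = \<bar>r - s\<bar>" "\<And>s. psl_act \<gamma> (g s) = g (s + l)"
    using hyperbolic_axis[OF A(1) _ assms(2)] A assms(3) by metis
  show ?thesis
    using g(1) g(2)[of 0 l] g(3)[of 0] assms(2) by (intro bexI[of _ "g 0"]) auto
qed

end

section \<open>Words in the right-angled hexagon group\<close>

datatype side = A1 | A2 | A3 | B1 | B2 | B3

lemma UNIV_side: "UNIV = {A1, A2, A3, B1, B2, B3}"
  using side.exhaust by blast

instance side :: finite
  by standard (simp add: UNIV_side)

fun isA :: "side \<Rightarrow> bool" where
  "isA A1 = True" | "isA A2 = True" | "isA A3 = True"
| "isA B1 = False" | "isA B2 = False" | "isA B3 = False"

fun idx :: "side \<Rightarrow> nat" where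
  "idx A1 = 1" | "idx A2 = 2" | "idx A3 = 3"
| "idx B1 = 1" | "idx B2 = 2" | "idx B3 = 3"

text \<open>In cyclic order the sides of the hexagon are \<open>A1, B2, A3, B1, A2, B3\<close>; two sides commute if
  they are adjacent.\<close>

definition adjacent :: "side \<Rightarrow> side \<Rightarrow> bool" where
  "adjacent i j \<longleftrightarrow> isA i \<noteq> isA j \<and> idx i \<noteq> idx j"

lemma adjacent_sym: "adjacent i j \<Longrightarrow> adjacent j i"
  by (auto simp: adjacent_def)

text \<open>For the hexagon, \<open>b\<close>, \<open>c\<close> and \<open>d\<close> are the cosh of
  the distances between two \<open>A\<close>-sides, two \<open>B\<close>-sides and two opposite
  sides. The entries are polymorphic because the matrix is used over the reals and, at
  \<open>u = 1\<close>, over the integers.\<close>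

definition gram :: "'a::comm_ring_1 \<Rightarrow> 'a \<Rightarrow> 'a \<Rightarrow> side \<Rightarrow> side \<Rightarrow> 'a" where
  "gram b c d i j = (if i = j then 1 else if adjacent i j then 0
     else if isA i \<noteq> isA j then - d else if isA i then - b else - c)"

lemma gram_sym: "gram b c d i j = gram b c d j i"
  by (auto simp: gram_def adjacent_def)

lemma gram_adjacent: "adjacent i j \<Longrightarrow> gram b c d i j = 0"
  by (auto simp: gram_def adjacent_def)

lemma gram_self [simp]: "gram b c d i i = 1"
  by (simp add: gram_def)

text \<open>\<open>front i w\<close>: the letter \<open>i\<close> can be moved to the front of \<open>w\<close> by commutations.\<close>

fun front :: "side \<Rightarrow> side list \<Rightarrow> bool" where
  "front i [] \<longleftrightarrow> False"
| "front i (j # w) \<longleftrightarrow> i = j \<or> adjacent i j \<and> front i w"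

fun reduced :: "side list \<Rightarrow> bool" where
  "reduced [] \<longleftrightarrow> True"
| "reduced (j # w) \<longleftrightarrow> reduced w \<and> \<not> front j w"

lemma front_split:
  "front i w \<Longrightarrow> \<exists>xs ys. w = xs @ i # ys \<and> (\<forall>j\<in>set xs. adjacent i j)"
proof (induction w)
  case (Cons j w)
  show ?case
  proof (cases "i = j")
    case True then show ?thesis by (intro exI[of _ "[]"] exI[of _ w]) simp
  next
    case False
    then obtain xs ys where "w = xs @ i # ys" "\<forall>j\<in>set xs. adjacent i j" "adjacent i j"
      using Cons by auto
    then show ?thesis by (intro exI[of _ "j # xs"] exI[of _ ys]) simp
  qed
qed simp

lemma not_reduced_split:
  "\<not> reduced w \<Longrightarrow> \<exists>p i xs ys. w = p @ i # xs @ i # ys \<and> (\<forall>j\<in>set xs. adjacent i j)"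
proof (induction w)
  case (Cons j w)
  show ?case
  proof (cases "reduced w")
    case True
    then have "front j w" using Cons by simp
    then obtain xs ys where "w = xs @ j # ys" "\<forall>k\<in>set xs. adjacent j k" using front_split by blast
    then show ?thesis by (intro exI[of _ "[]"] exI[of _ j] exI[of _ xs] exI[of _ ys]) simp
  next
    case False
    then obtain p i xs ys where "w = p @ i # xs @ i # ys" "\<forall>j\<in>set xs. adjacent i j"
      using Cons by blast
    then show ?thesis by (intro exI[of _ "j # p"] exI[of _ i] exI[of _ xs] exI[of _ ys]) simp
  qed
qed simp

text \<open>Each cancellation shortens the word by two letters, so cancelling terminates.\<close>

lemma reduced_representative:
  assumes step: "\<And>p i xs ys. \<forall>j\<in>set xs. adjacent i j \<Longrightarrow> R (p @ i # xs @ i # ys) (p @ xs @ ys)"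
    and refl: "\<And>w. R w w" and trans: "\<And>u v w. R u v \<Longrightarrow> R v w \<Longrightarrow> R u w"
  shows "\<exists>w'. reduced w' \<and> R w w'"
proof (induction w rule: measure_induct_rule[of length])
  case (less w)
  show ?case
  proof (cases "reduced w")
    case True then show ?thesis using refl by blast
  next
    case False
    then obtain p i xs ys where w: "w = p @ i # xs @ i # ys" "\<forall>j\<in>set xs. adjacent i j"
      using not_reduced_split by blast
    obtain w' where "reduced w'" "R (p @ xs @ ys) w'" using less[of "p @ xs @ ys"] w by auto
    then show ?thesis using step[OF w(2), of p ys] trans w(1) by blast
  qed
qed

lemma front_if_mem:
  "j \<in> set w \<Longrightarrow> \<forall>k\<in>set w. k = j \<or> adjacent j k \<Longrightarrow> front j w"
  by (induction w) auto

definition nA :: "side list \<Rightarrow> nat" where "nA w = length (filter isA w)"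
definition nB :: "side list \<Rightarrow> nat" where "nB w = length (filter (\<lambda>i. \<not> isA i) w)"

lemma nAB_simps [simp]:
  "nA [] = 0" "nB [] = 0" "nA (v @ w) = nA v + nA w" "nB (v @ w) = nB v + nB w"
  "nA (rev w) = nA w" "nB (rev w) = nB w"
  "nA (i # w) = (if isA i then Suc (nA w) else nA w)" "nB (i # w) = (if isA i then nB w else Suc (nB w))"
  by (simp_all add: nA_def nB_def rev_filter[symmetric])

lemma length_nAB: "length w = nA w + nB w"
  by (simp add: nA_def nB_def sum_length_filter_compl)

text \<open>Adjacent sides have different types, so two letters of one type would be equal and could
  be brought together and cancelled. Such words describe the reflections in sides through a common
  point.\<close>

lemma reduced_pairwise_adjacent:
  assumes "reduced w" "\<forall>i\<in>set w. \<forall>j\<in>set w. i = j \<or> adjacent i j"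
  shows "nA w \<le> 1 \<and> nB w \<le> 1"
  using assms
proof (induction w)
  case (Cons j w)
  have IH: "nA w \<le> 1" "nB w \<le> 1" using Cons by auto
  have "\<forall>k\<in>set w. k = j \<or> adjacent j k" using Cons.prems(2) by (metis list.set_intros)
  then have nj: "j \<notin> set w" using front_if_mem[of j w] Cons.prems(1) by auto
  have "isA i \<noteq> isA j" if "i \<in> set w" for i
    using that nj Cons.prems(2) by (auto simp: adjacent_def)
  then have "nA w = 0 \<or> \<not> isA j" "nB w = 0 \<or> isA j"
    by (auto simp: nA_def nB_def filter_empty_conv)
  then show ?case using IH by auto
qed simp

text \<open>The matrix of a word in the reflection representation at \<open>u = 1\<close>, where the Gram matrix is integral.\<close>

abbreviation G1 :: "side \<Rightarrow> side \<Rightarrow> int" where "G1 \<equiv> gram 2 2 3"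

fun cf :: "side list \<Rightarrow> side \<Rightarrow> side \<Rightarrow> int" where
  "cf [] i k = (if i = k then 1 else 0)"
| "cf (j # w) i k = cf w i k - 2 * G1 i j * cf w j k"

lemma cf_append: "cf (v @ w) i k = (\<Sum>l\<in>UNIV. cf v i l * cf w l k)"
proof (induction v arbitrary: i)
  case Nil
  have "(\<Sum>l\<in>UNIV. cf [] i l * cf w l k) = (\<Sum>l\<in>UNIV. if i = l then cf w l k else 0)"
    by (intro sum.cong) auto
  then show ?case by simp
next
  case (Cons j v)
  show ?case
    by (simp add: Cons left_diff_distrib sum_subtractf sum_distrib_left mult.assoc)
qed

lemma cf_involution: "cf (i # i # w) = cf w"
  by (intro ext) simp

lemma cf_commute: "adjacent i j \<Longrightarrow> cf (i # j # w) = cf (j # i # w)"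
  using gram_adjacent[of i j "2::int" 2 3] gram_adjacent[of j i "2::int" 2 3] adjacent_sym[of i j]
  by (intro ext) simp

lemma cf_cong_append: "cf v = cf v' \<Longrightarrow> cf w = cf w' \<Longrightarrow> cf (v @ w) = cf (v' @ w')"
  by (intro ext) (simp add: cf_append)

lemma cf_cong_Cons: "cf w = cf w' \<Longrightarrow> cf (i # w) = cf (i # w')"
  by (intro ext) simp

lemma cf_move: "\<forall>j\<in>set xs. adjacent i j \<Longrightarrow> cf (i # xs @ zs) = cf (xs @ i # zs)"
proof (induction xs)
  case (Cons j xs)
  then have "cf (i # j # xs @ zs) = cf (j # i # xs @ zs)" by (intro cf_commute) simp
  also have "\<dots> = cf (j # xs @ i # zs)" by (rule cf_cong_Cons, rule Cons.IH) (use Cons.prems in simp)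
  finally show ?case unfolding append_Cons .
qed simp

lemma cf_cancel:
  assumes "\<forall>j\<in>set xs. adjacent i j" shows "cf (p @ i # xs @ i # ys) = cf (p @ xs @ ys)"
proof -
  have "cf (i # xs @ i # ys) = cf (xs @ i # i # ys)" using assms by (rule cf_move)
  also have "\<dots> = cf (xs @ ys)" by (intro cf_cong_append cf_involution refl)
  finally show ?thesis by (intro cf_cong_append refl)
qed

lemma cf_append_rev: "cf (w @ rev w) = cf []"
proof (induction w rule: rev_induct)
  case (snoc j w)
  have "cf (w @ (j # j # rev w)) = cf (w @ rev w)" by (intro cf_cong_append cf_involution refl)
  then show ?case using snoc by simp
qed simp

lemma cf_rev_append: "cf (rev w @ w) = cf []"
  using cf_append_rev[of "rev w"] by simp

section \<open>Congruence subgroups\<close>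

text \<open>The two parities do not change when equal letters are cancelled in pairs. They serve to
  exclude fixed points and to remove the square root \<open>de u\<close> from the traces.\<close>

definition congr :: "int \<Rightarrow> side list \<Rightarrow> side list \<Rightarrow> bool" where
  "congr m v w \<longleftrightarrow> (\<forall>i k. cf v i k mod m = cf w i k mod m) \<and> even (nA v) = even (nA w) \<and> even (nB v) = even (nB w)"

definition in_ker :: "int \<Rightarrow> side list \<Rightarrow> bool" where
  "in_ker m w \<longleftrightarrow> congr m w []"

lemma congr_refl [simp]: "congr m w w"
  and congr_sym: "congr m v w \<Longrightarrow> congr m w v"
  and congr_trans: "congr m u v \<Longrightarrow> congr m v w \<Longrightarrow> congr m u w"
  by (auto simp: congr_def)

lemma congr_append:
  assumes "congr m v v'" "congr m w w'" shows "congr m (v @ w) (v' @ w')"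
proof -
  have "(\<Sum>l\<in>UNIV. cf v i l * cf w l k) mod m = (\<Sum>l\<in>UNIV. cf v' i l * cf w' l k) mod m" for i k
  proof -
    have "(cf v i l * cf w l k) mod m = (cf v' i l * cf w' l k) mod m" for l
      using assms by (intro mod_mult_cong) (auto simp: congr_def)
    then show ?thesis by (subst (1 2) mod_sum_eq[symmetric]) simp
  qed
  then show ?thesis using assms by (auto simp: congr_def cf_append)
qed

lemma congr_cf: "cf v = cf w \<Longrightarrow> even (nA v) = even (nA w) \<Longrightarrow> even (nB v) = even (nB w) \<Longrightarrow> congr m v w"
  by (simp add: congr_def)

lemma congr_append_rev: "congr m (w @ rev w) []" "congr m (rev w @ w) []"
  using cf_append_rev[of w] cf_rev_append[of w] by (auto intro!: congr_cf)

lemma in_ker_Nil: "in_ker m []"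
  by (simp add: in_ker_def)

lemma in_ker_append: "in_ker m v \<Longrightarrow> in_ker m w \<Longrightarrow> in_ker m (v @ w)"
  unfolding in_ker_def using congr_append[of m v "[]" w "[]"] by simp

lemma in_ker_rev: "in_ker m w \<Longrightarrow> in_ker m (rev w)"
  unfolding in_ker_def
  using congr_append[of m "[]" w "rev w" "rev w"] congr_append_rev(1)[of m w] congr_sym congr_trans
  by (metis append_Nil congr_refl)

lemma in_ker_conj: "in_ker m w \<Longrightarrow> in_ker m (v @ w @ rev v)"
  unfolding in_ker_def
  using congr_append[of m v v "w @ rev v" "[] @ rev v"] congr_append[of m w "[]" "rev v" "rev v"]
    congr_append_rev(1)[of m v] congr_trans by (metis append_Nil congr_refl)

lemma in_ker_of_congr: "congr m v w \<Longrightarrow> in_ker m (rev v @ w)"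
  unfolding in_ker_def
  using congr_append[of m "rev v" "rev v" w v] congr_append_rev(2)[of m v] congr_trans congr_sym
  by (metis congr_refl)

lemma in_ker_even: "in_ker m w \<Longrightarrow> even (nA w)" "in_ker m w \<Longrightarrow> even (nB w)"
  "in_ker m w \<Longrightarrow> even (length w)"
  by (auto simp: in_ker_def congr_def length_nAB)

definition residue_class :: "int \<Rightarrow> side list \<Rightarrow> (side \<times> side \<Rightarrow> int) \<times> bool \<times> bool" where
  "residue_class m w = (\<lambda>(i, k). cf w i k mod m, even (nA w), even (nB w))"

lemma congr_iff: "congr m v w \<longleftrightarrow> residue_class m v = residue_class m w"
  by (auto simp: congr_def residue_class_def fun_eq_iff)

lemma finite_residue_classes: assumes "m > 0" shows "finite (range (residue_class m))"
proof -
  have "finite {f :: side \<times> side \<Rightarrow> int. \<forall>x. (x \<in> UNIV \<longrightarrow> f x \<in> {0..<m}) \<and> (x \<notin> UNIV \<longrightarrow> f x = 0)}"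
    by (rule finite_set_of_finite_funs) auto
  then have "finite ({f :: side \<times> side \<Rightarrow> int. \<forall>x. f x \<in> {0..<m}} \<times> (UNIV :: (bool \<times> bool) set))" by simp
  then show ?thesis
    by (rule finite_subset[rotated]) (use assms in \<open>auto simp: residue_class_def\<close>)
qed

text \<open>Finite index of the congruence subgroup, which makes it cocompact along with the
  reflection group.\<close>

lemma finite_transversal:
  assumes "m > 0" shows "\<exists>R. finite R \<and> (\<forall>w. \<exists>v\<in>R. congr m v w)"
proof -
  obtain R where "finite R" "residue_class m ` R = range (residue_class m)"
    using finite_subset_image[OF finite_residue_classes[OF assms] order.refl] by metis
  then show ?thesis unfolding congr_iff by (metis imageE rangeI)
qed

text \<open>Two powers of \<open>[B1, B2]\<close> are congruent by the pigeonhole principle. The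
  exponent depends on \<open>m\<close> only, so this element stays in the group while
  \<open>u\<close> tends to 0.\<close>

lemma power_in_ker:
  assumes "m > 0" shows "\<exists>k>0. in_ker m (concat (replicate k [B1, B2]))"
proof -
  let ?w = "\<lambda>k. concat (replicate k [B1, B2])"
  have "finite (range (\<lambda>k. residue_class m (?w k)))"
    by (rule finite_subset[OF _ finite_residue_classes[OF assms]]) auto
  then have "\<not> inj (\<lambda>k. residue_class m (?w k))" using finite_imageD infinite_UNIV_nat by blast
  then obtain k l where "k < l" "congr m (?w k) (?w l)"
    unfolding inj_def congr_iff by (metis nat_neq_iff)
  moreover have "?w l = ?w k @ ?w (l - k)"
    using \<open>k < l\<close> by (simp flip: replicate_add concat_append)
  ultimately have "in_ker m ((rev (?w k) @ ?w k) @ ?w (l - k))" using in_ker_of_congr by fastforce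
  then have "congr m ([] @ ?w (l - k)) []"
    unfolding in_ker_def using congr_append[OF congr_append_rev(2)[of m "?w k"] congr_refl[of m "?w (l - k)"]]
      congr_sym congr_trans by blast
  then show ?thesis using \<open>k < l\<close> by (intro exI[of _ "l - k"]) (simp add: in_ker_def)
qed

section \<open>The hexagon reflections\<close>

text \<open>The Minkowski form on traceless matrices: unit normals of geodesics have square 1,
  half-turns about points have square -1.\<close>

definition bl :: "real^2^2 \<Rightarrow> real^2^2 \<Rightarrow> real" where "bl P Q = trace (P ** Q) / 2"

lemma bl_linear:
  "bl (P + P') Q = bl P Q + bl P' Q" "bl (P - P') Q = bl P Q - bl P' Q" "bl (s *\<^sub>R P) Q = s * bl P Q"
  by (cases P rule: mat2_cases, cases P' rule: mat2_cases, cases Q rule: mat2_cases,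
      simp add: bl_def field_simps)+

lemma bl_minus: "bl (- P) Q = - bl P Q" "bl Q (- P) = - bl Q P"
  by (simp_all add: bl_def matrix_minus_left matrix_minus_right trace_minus)

lemma two_bl: "2 * bl P Q = trace (P ** Q)"
  by (simp add: bl_def)

lemma bl_sym: "bl P Q = bl Q P"
  by (simp add: bl_def trace_cyclic)

lemma bl_linear_right:
  "bl Q (P + P') = bl Q P + bl Q P'" "bl Q (P - P') = bl Q P - bl Q P'" "bl Q (s *\<^sub>R P) = s * bl Q P"
  using bl_linear bl_sym by metis+

lemma traceless_cases:
  assumes "trace P = 0" obtains a b c where "P = mat2 a b c (- a)"
proof -
  obtain a b c d where P: "P = mat2 a b c d" by (rule mat2_cases)
  then have "d = - a" using assms by simp
  then show ?thesis using that P by blast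
qed

text \<open>The Clifford relation of \<open>bl\<close>. It gives the reflection formula, and it
  drives the reduction of traces to shorter words.\<close>

lemma traceless_anticommute:
  assumes "trace P = 0" "trace Q = 0" shows "P ** Q = (2 * bl P Q) *\<^sub>R mat 1 - Q ** P"
proof -
  obtain a b c where P: "P = mat2 a b c (- a)" using assms(1) by (rule traceless_cases)
  obtain a' b' c' where Q: "Q = mat2 a' b' c' (- a')" using assms(2) by (rule traceless_cases)
  show ?thesis by (simp add: P Q bl_def mat2_one algebra_simps)
qed

lemma traceless_adj2: "trace P = 0 \<Longrightarrow> adj2 P = - P"
  by (erule traceless_cases) simp

lemma traceless_det: "trace P = 0 \<Longrightarrow> det P = - bl P P"
  by (erule traceless_cases) (simp add: bl_def)

text \<open>If \<open>bl P P = 1\<close>, this is the sinh of the signed distance from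
  \<open>z\<close> to the geodesic with normal \<open>P\<close>.\<close>

definition ht :: "real^2^2 \<Rightarrow> complex \<Rightarrow> real" where "ht P z = bl P (hmat z)"

text \<open>\<open>Q\<close> squares to 1 and has determinant -1, so it acts on \<open>X\<close> as
  \<open>- (Q ** X ** Q)\<close>; anticommuting the first two factors gives the reflection along
  \<open>Q\<close>.\<close>

lemma hmat_reflect:
  assumes "trace Q = 0" "bl Q Q = 1" "z \<in> HH"
  shows "hmat (gact Q z) = hmat z - (2 * ht Q z) *\<^sub>R Q"
proof -
  have sq: "Q ** Q = mat 1"
  proof -
    obtain a b c where "Q = mat2 a b c (- a)" using assms(1) by (rule traceless_cases)
    then show ?thesis using assms(2) by (simp add: bl_def mat2_one mult.commute)
  qed
  have "hmat (gact Q z) = Q ** hmat z ** adj2 Q"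
    using assms traceless_det[of Q] by (intro hmat_gact) auto
  also have "\<dots> = - ((Q ** hmat z) ** Q)"
    by (simp add: traceless_adj2 assms matrix_minus_right)
  also have "Q ** hmat z = (2 * ht Q z) *\<^sub>R mat 1 - hmat z ** Q"
    unfolding ht_def using assms by (intro traceless_anticommute) auto
  also have "- (((2 * ht Q z) *\<^sub>R mat 1 - hmat z ** Q) ** Q) = (hmat z ** (Q ** Q)) - (2 * ht Q z) *\<^sub>R Q"
    unfolding matrix_mul_assoc
    by (cases Q rule: mat2_cases, cases "hmat z ** Q" rule: mat2_cases) (simp add: mat2_one algebra_simps)
  finally show ?thesis by (simp add: sq)
qed

lemma ht_reflect:
  assumes "trace Q = 0" "bl Q Q = 1" "z \<in> HH"
  shows "ht P (gact Q z) = ht P z - 2 * bl P Q * ht Q z"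
  by (simp add: ht_def[of P] hmat_reflect[OF assms] bl_linear_right)

lemma cdist_bl: "cdist z w = - bl (hmat z) (hmat w)"
  by (simp add: cdist_def bl_def)

text \<open>The change of the distance is a product of two heights. It is positive when both points
  lie on the positive side, and from this the growth of displacements along reduced words
  follows.\<close>

lemma cdist_reflect:
  assumes "trace Q = 0" "bl Q Q = 1" "z \<in> HH"
  shows "cdist w (gact Q z) = cdist w z + 2 * ht Q w * ht Q z"
  by (simp add: cdist_bl hmat_reflect[OF assms] bl_linear_right ht_def bl_sym[of "hmat w" Q])

text \<open>A nonzero vector that is not spacelike has a constant sign against all points of the
  plane, and the lower left entry tells which.\<close>

lemma ht_pos:
  assumes "p\<^sup>2 + q * r \<le> 0" "r < 0" "z \<in> HH" shows "ht (mat2 p q r (- p)) z > 0"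
proof -
  define x y where "x = Re z" "y = Im z"
  have y: "y > 0" using assms by (simp add: HH_iff x_y_def)
  have e1: "(2 * y) * ht (mat2 p q r (- p)) z = 2 * p * x + q - r * (x\<^sup>2 + y\<^sup>2)"
    using y by (simp add: ht_def bl_def hmat_def cmod_sq x_y_def field_simps)
  have e2: "(- r) * (2 * p * x + q - r * (x\<^sup>2 + y\<^sup>2)) = (r * x - p)\<^sup>2 + (r * y)\<^sup>2 - (p\<^sup>2 + q * r)"
    by (simp add: power2_eq_square algebra_simps)
  have "(r * y)\<^sup>2 > 0" using assms(2) y by simp
  then have "(- r) * ((2 * y) * ht (mat2 p q r (- p)) z) > 0"
    unfolding e1 e2 using assms(1) zero_le_power2[of "r * x - p"] by linarith
  moreover have "- r > 0" "2 * y > 0" using assms(2) y by simp_all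
  ultimately show ?thesis by (metis zero_less_mult_pos)
qed

text \<open>\<open>cc u\<close> and \<open>be u\<close> are the cosh of the lengths of the
  \<open>A\<close>- and \<open>B\<close>-sides, tied by \<open>(cc u - 1) * (be u - 1) = 1\<close>.
  \<open>ka u\<close> is the squared sinh of the length of a \<open>B\<close>-side, and
  \<open>de u\<close> is the cosh of the distance of opposite sides. The side \<open>A1\<close> lies
  on the imaginary axis, and multiplication by \<open>tau u\<close>, the exponential of its length,
  carries the geodesic of \<open>A2\<close> to that of \<open>A3\<close>.\<close>

definition cc :: "real \<Rightarrow> real" where "cc u = 1 + u"
definition be :: "real \<Rightarrow> real" where "be u = 1 + 1 / u"
definition ka :: "real \<Rightarrow> real" where "ka u = (be u)\<^sup>2 - 1"
definition tau :: "real \<Rightarrow> real" where "tau u = cc u + sqrt ((cc u)\<^sup>2 - 1)"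
definition de :: "real \<Rightarrow> real" where "de u = sqrt ((2 * u + 1) * (u + 2) / u)"

text \<open>Unit normals of the sides of a right-angled hexagon in which the sides \<open>A1, A2, A3\<close> have length
  \<open>arcosh (1 + u)\<close> and the sides \<open>B1, B2, B3\<close> have length \<open>arcosh (1 + 1 / u)\<close>. The first three are a basis of
  the traceless matrices; the others are the negatives of the normalised dual basis.\<close>

function Mx :: "real \<Rightarrow> side \<Rightarrow> real^2^2" where
  "Mx u A1 = mat2 1 0 0 (- 1)"
| "Mx u A2 = mat2 (- be u) 1 (- ka u) (be u)"
| "Mx u A3 = mat2 (- be u) (tau u) (- ka u / tau u) (be u)"
| "Mx u B1 = (1 / de u) *\<^sub>R (cc u *\<^sub>R (Mx u A2 + Mx u A3) - Mx u A1)"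
| "Mx u B2 = (1 / de u) *\<^sub>R (cc u *\<^sub>R (Mx u A1 + Mx u A3) - Mx u A2)"
| "Mx u B3 = (1 / de u) *\<^sub>R (cc u *\<^sub>R (Mx u A1 + Mx u A2) - Mx u A3)"

  by pat_completeness auto
termination by (relation "Wellfounded.measure (\<lambda>(u, i). if isA i then 0 else 1)") auto

declare Mx.simps [simp del]

abbreviation gr :: "real \<Rightarrow> side \<Rightarrow> side \<Rightarrow> real" where
  "gr u \<equiv> gram (be u) (cc u) (de u)"

lemma trace_Mx [simp]: "trace (Mx u i) = 0"
  by (cases i) (simp_all add: Mx.simps algebra_simps)

text \<open>\<open>x\<close>, \<open>y\<close>, \<open>z\<close> stand for the heights of a point
  over the \<open>A\<close>-sides, the other nonnegative terms for multiples of its heights over the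
  \<open>B\<close>-sides. If \<open>x\<close> is the largest, the factors belonging to
  \<open>y\<close> and \<open>z\<close> are at least \<open>u * x\<close>, so
  \<open>(y + z) * (u * x)\<close> is at most \<open>2 * D\<close>; finally \<open>x\<close> is at
  most \<open>c * (y + z)\<close>.\<close>

lemma maximal_coordinate_bound:
  fixes u c x y z D :: real
  assumes u: "u > 0" and c: "c = 1 + u"
    and nn: "x \<ge> 0" "y \<ge> 0" "z \<ge> 0" and max: "x \<ge> y" "x \<ge> z"
    and p: "c * (y + z) - x \<ge> 0" "c * (x + z) - y \<ge> 0" "c * (x + y) - z \<ge> 0"
    and D: "x * (c * (y + z) - x) + y * (c * (x + z) - y) + z * (c * (x + y) - z) = D"
  shows "x * x * u \<le> 2 * c * D"
proof -
  have c0: "c > 0" using u c by simp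
  have "c * (x + z) = x + u * x + c * z" "c * (x + y) = x + u * x + c * y"
    unfolding c by (simp_all add: algebra_simps)
  moreover have "c * z \<ge> 0" "c * y \<ge> 0" using c0 nn by simp_all
  ultimately have "u * x \<le> c * (x + z) - y" "u * x \<le> c * (x + y) - z" using max by linarith+
  then have "y * (u * x) \<le> y * (c * (x + z) - y)" "z * (u * x) \<le> z * (c * (x + y) - z)"
    using nn mult_left_mono by blast+
  moreover have "x * (c * (y + z) - x) \<ge> 0" "y * (c * (x + z) - y) \<ge> 0" "z * (c * (x + y) - z) \<ge> 0"
    using nn p mult_nonneg_nonneg by blast+
  ultimately have "y * (u * x) \<le> D" "z * (u * x) \<le> D" using D by linarith+
  then have "(y + z) * (u * x) \<le> 2 * D" unfolding distrib_right by linarith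
  then have "c * ((y + z) * (u * x)) \<le> c * (2 * D)" using c0 by (intro mult_left_mono) auto
  moreover have "x * (u * x) \<le> (c * (y + z)) * (u * x)"
    using p(1) nn(1) u by (intro mult_right_mono) auto
  ultimately have "x * (u * x) \<le> c * (2 * D)" by (simp only: mult.assoc)
  then show ?thesis by (simp only: mult_ac)
qed

locale hexagon =
  fixes u :: real assumes u: "u > 0"
begin

lemma be_u: "be u * u = u + 1" "be u > 1" "(be u - 1) * u = 1"
  using u by (simp_all add: be_def field_simps)

lemma ka_pos: "ka u > 0"
  using be_u(2) power_strict_mono[of 1 "be u" 2] by (simp add: ka_def)

lemma tau: "tau u > 1" "tau u + 1 / tau u = 2 * cc u"
proof -
  have c: "cc u > 1" using u by (simp add: cc_def)
  define s where "s = sqrt ((cc u)\<^sup>2 - 1)"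
  have "(cc u)\<^sup>2 > 1" using power_strict_mono[of 1 "cc u" 2] c by simp
  then have s: "s > 0" "s\<^sup>2 = (cc u)\<^sup>2 - 1" by (simp_all add: s_def)
  show t: "tau u > 1" unfolding tau_def s_def[symmetric] using c s by linarith
  have ts: "tau u = cc u + s" by (simp add: tau_def s_def)
  have "tau u * (cc u - s) = 1" using s(2) by (simp add: ts algebra_simps power2_eq_square)
  then have "cc u - s = 1 / tau u" using t by (simp add: nonzero_eq_divide_eq mult.commute)
  then show "tau u + 1 / tau u = 2 * cc u" using ts by linarith
qed

lemma cc_be: "cc u = u * be u"
  using be_u(1) by (simp add: cc_def mult.commute)

lemma de: "de u > 0" "(de u)\<^sup>2 = 2 * cc u * be u + 1" "(de u)\<^sup>2 * u = (2 * u + 1) * (u + 2)"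
proof -
  have "(2 * u + 1) * (u + 2) / u > 0" using u by simp
  then show p: "de u > 0" "(de u)\<^sup>2 * u = (2 * u + 1) * (u + 2)" using u by (simp_all add: de_def)
  have "(2 * cc u * be u + 1) * u = 2 * cc u * (be u * u) + u" by (simp add: algebra_simps)
  also have "\<dots> = (2 * u + 1) * (u + 2)" unfolding be_u(1) cc_def by (simp add: algebra_simps)
  finally have "(2 * cc u * be u + 1) * u = (2 * u + 1) * (u + 2)" .
  then have "(de u)\<^sup>2 * u = (2 * cc u * be u + 1) * u" unfolding p(2) by (rule sym)
  then show "(de u)\<^sup>2 = 2 * cc u * be u + 1" using u by (metis less_irrefl mult_right_cancel)
qed

lemma de_gt_1: "de u > 1"
proof (rule power2_less_imp_less)
  show "1\<^sup>2 < (de u)\<^sup>2" using de(2) be_u(2) u by (simp add: cc_def)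
qed (use de in simp)

text \<open>The hexagon relation enters in the pair \<open>A2\<close>, \<open>A3\<close>, through
  \<open>tau u + 1 / tau u = 2 * cc u\<close> and \<open>(be u - 1) * u = 1\<close>.\<close>

lemma bl_A: "bl (Mx u A1) (Mx u A1) = 1" "bl (Mx u A2) (Mx u A2) = 1" "bl (Mx u A3) (Mx u A3) = 1"
  "bl (Mx u A1) (Mx u A2) = - be u" "bl (Mx u A1) (Mx u A3) = - be u" "bl (Mx u A2) (Mx u A3) = - be u"
proof -
  show "bl (Mx u A1) (Mx u A1) = 1" "bl (Mx u A2) (Mx u A2) = 1"
     "bl (Mx u A1) (Mx u A2) = - be u" "bl (Mx u A1) (Mx u A3) = - be u"
    by (simp_all add: Mx.simps bl_def ka_def power2_eq_square algebra_simps)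
  show "bl (Mx u A3) (Mx u A3) = 1" using tau(1) by (simp add: Mx.simps bl_def ka_def power2_eq_square algebra_simps)
  have "2 * bl (Mx u A2) (Mx u A3) = 2 * (be u)\<^sup>2 - ka u * (tau u + 1 / tau u)"
    unfolding two_bl by (simp add: Mx.simps power2_eq_square algebra_simps)
  then have "bl (Mx u A2) (Mx u A3) = (be u)\<^sup>2 - ka u * cc u" unfolding tau(2) by simp
  also have "ka u * cc u = (be u + 1) * be u * ((be u - 1) * u)"
    unfolding cc_be ka_def by (simp add: power2_eq_square algebra_simps)
  finally show "bl (Mx u A2) (Mx u A3) = - be u"
    unfolding be_u(3) by (simp add: power2_eq_square algebra_simps)
qed

lemma bl_A':
  "bl (Mx u A2) (Mx u A1) = - be u" "bl (Mx u A3) (Mx u A1) = - be u" "bl (Mx u A3) (Mx u A2) = - be u"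
  by (subst bl_sym, rule bl_A)+

lemma bl_AB:
  assumes "isA i" "\<not> isA k" shows "bl (Mx u i) (Mx u k) = (if idx i = idx k then - de u else 0)"
proof -
  have 0: "cc u * (1 + - be u) - - be u = 0" "cc u * (- be u + 1) - - be u = 0"
    unfolding cc_be using be_u(1) by Groebner_Basis.algebra+
  have "cc u * (- be u + - be u) - 1 = - (de u * de u)"
    using de(2) by (simp add: power2_eq_square)
  then have 1: "1 / de u * (cc u * (- be u + - be u) - 1) = - de u" using de(1) by simp
  show ?thesis using assms
    by (cases i; cases k; simp only: isA.simps idx.simps Mx.simps(4-6) bl_linear_right bl_A bl_A' 0 1; simp)
qed

lemma bl_Mx: "bl (Mx u i) (Mx u j) = gr u i j"
proof -
  \<comment> \<open>One of the two \<open>B\<close>-normals is expanded in \<open>A\<close>-normals,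
    which leaves only the mixed products of \<open>bl_AB\<close>.\<close>
  have B: "bl (Mx u i) (Mx u j) = gr u i j" if "\<not> isA i" "\<not> isA j" for i j
  proof -
    have "Mx u i = (1 / de u) *\<^sub>R (cc u *\<^sub>R (Mx u a + Mx u b) - Mx u c)"
      if "(i, a, b, c) \<in> {(B1, A2, A3, A1), (B2, A1, A3, A2), (B3, A1, A2, A3)}" for a b c
      using that by (auto simp: Mx.simps)
    then obtain a b c where i: "Mx u i = (1 / de u) *\<^sub>R (cc u *\<^sub>R (Mx u a + Mx u b) - Mx u c)"
      "(i, a, b, c) \<in> {(B1, A2, A3, A1), (B2, A1, A3, A2), (B3, A1, A2, A3)}"
      using \<open>\<not> isA i\<close> by (cases i) auto
    have "bl (Mx u i) (Mx u j) = (cc u * (bl (Mx u a) (Mx u j) + bl (Mx u b) (Mx u j)) - bl (Mx u c) (Mx u j)) / de u"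
      unfolding i(1) by (simp add: bl_linear)
    also have "\<dots> = gr u i j"
      using i(2) de(1) \<open>\<not> isA j\<close>
      by (cases j) (auto simp: bl_AB gram_def adjacent_def)
    finally show ?thesis .
  qed
  show ?thesis
  proof (cases "isA i = isA j")
    case False
    then show ?thesis
      using bl_AB[of i j] bl_AB[of j i] bl_sym[of "Mx u i" "Mx u j"]
      by (cases "isA i") (auto simp: gram_def adjacent_def)
  next
    case True
    then show ?thesis
    proof (cases "isA i")
      case True
      with \<open>isA i = isA j\<close> show ?thesis
        by (cases i; cases j; simp add: bl_A bl_A' gram_def adjacent_def)
    qed (use B in simp)
  qed
qed

lemma bl_Mx_self [simp]: "bl (Mx u i) (Mx u i) = 1"
  by (simp add: bl_Mx)

lemma det_Mx [simp]: "det (Mx u i) = - 1"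
  by (simp add: traceless_det)

lemma Mx_square: "Mx u i ** Mx u i = mat 1"
  using adj2_cancel(1)[of "Mx u i"] by (simp add: traceless_adj2 matrix_minus_right)

lemma Mx_anticommute: "adjacent i j \<Longrightarrow> Mx u i ** Mx u j = - (Mx u j ** Mx u i)"
  using traceless_anticommute[of "Mx u i" "Mx u j"] by (simp add: bl_Mx gram_adjacent)

section \<open>Heights over the sides of the hexagon\<close>

definition h :: "side \<Rightarrow> complex \<Rightarrow> real" where "h i z = ht (Mx u i) z"

definition refl :: "side \<Rightarrow> complex \<Rightarrow> complex" where "refl i = gact (Mx u i)"

lemma refl_HH [simp]: "z \<in> HH \<Longrightarrow> refl i z \<in> HH"
  by (simp add: refl_def hmat_gact)

lemma h_refl: "z \<in> HH \<Longrightarrow> h i (refl j z) = h i z - 2 * gr u i j * h j z"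
  by (simp add: h_def refl_def ht_reflect bl_Mx)

lemma cdist_refl: "z \<in> HH \<Longrightarrow> cdist w (refl j z) = cdist w z + 2 * h j w * h j z"
  by (simp add: h_def refl_def cdist_reflect)

text \<open>This supplies the sign that \<open>ht_pos\<close> asks for. The entry of
  \<open>A1\<close> is 0, and the only one that may be positive is that of \<open>B2\<close>; each
  of the sides \<open>A2\<close>, \<open>B1\<close>, \<open>B3\<close> not adjacent to
  \<open>B2\<close> outweighs it.\<close>

lemma Mx_lower_left:
  "i \<noteq> j \<Longrightarrow> \<not> adjacent i j \<Longrightarrow> (Mx u i + Mx u j) $ 2 $ 1 < 0"
proof -
  define k t where "k = ka u" "t = 1 / tau u"
  have k: "k > 0" using ka_pos by (simp add: k_t_def)
  have t: "t > 0" "t < 1" using tau(1) by (simp_all add: k_t_def)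
  have c: "cc u > 1" using u by (simp add: cc_def)
  note d = de_gt_1
  have A: "Mx u A1 $ 2 $ 1 = 0" "Mx u A2 $ 2 $ 1 = - k" "Mx u A3 $ 2 $ 1 = - (k * t)"
    by (simp_all add: Mx.simps k_t_def)
  have B: "Mx u B1 $ 2 $ 1 = - (k / de u * (cc u * (1 + t)))"
     "Mx u B2 $ 2 $ 1 = k / de u * (1 - cc u * t)"
     "Mx u B3 $ 2 $ 1 = - (k / de u * (cc u - t))"
    by (simp_all add: Mx.simps k_t_def algebra_simps add_divide_distrib diff_divide_distrib)
  define K where "K = k / de u"
  have K: "K > 0" "K < k" using k d by (simp_all add: K_def field_simps)
  have B': "Mx u B1 $ 2 $ 1 = - (K * (cc u * (1 + t)))"
     "Mx u B2 $ 2 $ 1 = K * (1 - cc u * t)" "Mx u B3 $ 2 $ 1 = - (K * (cc u - t))"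
    unfolding B K_def by simp_all
  have pos: "cc u * (1 + t) > 0" "cc u - t > 0" "cc u * t > 0" using c t by auto
  have 1: "K * (1 - cc u * t) < k"
  proof -
    have "K * (1 - cc u * t) < K * 1" using K pos by (intro mult_strict_left_mono) auto
    then show ?thesis using K(2) by linarith
  qed
  have 2: "K * (1 - cc u * t) < K * (cc u * (1 + t))"
  proof (intro mult_strict_left_mono K)
    have "cc u * (1 + t) = cc u + cc u * t" by (simp add: algebra_simps)
    then show "1 - cc u * t < cc u * (1 + t)" using c pos(3) by linarith
  qed
  have 3: "K * (1 - cc u * t) < K * (cc u - t)"
  proof (intro mult_strict_left_mono K)
    have "1 + t < cc u * (1 + t)" using c t by simp
    then show "1 - cc u * t < cc u - t" by (simp add: algebra_simps)
  qed
  have 4: "K * (cc u * (1 + t)) > 0" "K * (cc u - t) > 0" "k * t > 0" using K k pos t by simp_all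
  show "i \<noteq> j \<Longrightarrow> \<not> adjacent i j \<Longrightarrow> (Mx u i + Mx u j) $ 2 $ 1 < 0"
    unfolding vector_add_component
    by (cases i; cases j; simp add: adjacent_def A B'; (use k 1 2 3 4 in linarith)?)
qed

text \<open>The product of the two unit normals is at most -1, so their sum is not spacelike.
  Geometrically, no point lies on or beyond both of two disjoint sides.\<close>

lemma h_nonadjacent:
  assumes "i \<noteq> j" "\<not> adjacent i j" "z \<in> HH" shows "h i z + h j z > 0"
proof -
  obtain p q r s where e: "Mx u i + Mx u j = mat2 p q r s" by (rule mat2_cases)
  have "trace (Mx u i + Mx u j) = 0" by (simp add: trace_plus)
  then have s: "s = - p" unfolding e by simp
  have "gr u i j \<le> - 1"
    using assms(1,2) be_u(2) de_gt_1 u by (auto simp: gram_def cc_def)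
  moreover have "bl (Mx u i + Mx u j) (Mx u i + Mx u j) = 2 + 2 * gr u i j"
    by (simp add: bl_linear bl_linear_right bl_Mx gram_sym[of _ _ _ j i])
  ultimately have "bl (mat2 p q r (- p)) (mat2 p q r (- p)) \<le> 0" unfolding e s by simp
  then have "p\<^sup>2 + q * r \<le> 0" by (simp add: bl_def power2_eq_square algebra_simps)
  moreover have "r < 0" using Mx_lower_left[OF assms(1,2)] unfolding e by simp
  ultimately have "ht (Mx u i + Mx u j) z > 0" unfolding e s using assms(3) by (rule ht_pos)
  then show ?thesis by (simp add: h_def ht_def bl_linear)
qed

section \<open>The word problem\<close>

definition wm :: "side list \<Rightarrow> real^2^2" where
  "wm w = foldr (\<lambda>i A. Mx u i ** A) w (mat 1)"

lemma wm_simps [simp]: "wm [] = mat 1" "wm (i # w) = Mx u i ** wm w"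
  by (simp_all add: wm_def)

lemma wm_append: "wm (v @ w) = wm v ** wm w"
  by (induction v) (simp_all add: matrix_mul_assoc)

lemma det_wm: "det (wm w) = (- 1) ^ length w"
  by (induction w) (simp_all add: det_mul)

lemma det_wm_cases: "det (wm w) = 1 \<or> det (wm w) = -1"
  unfolding det_wm by (cases "even (length w)") auto

lemma wm_append_rev: "wm (w @ rev w) = mat 1"
proof (induction w rule: rev_induct)
  case (snoc j w)
  have "wm ((w @ [j]) @ rev (w @ [j])) = wm w ** (Mx u j ** Mx u j) ** wm (rev w)"
    by (simp add: wm_append matrix_mul_assoc)
  then show ?case using snoc by (simp add: Mx_square wm_append)
qed simp

definition wact :: "side list \<Rightarrow> complex \<Rightarrow> complex" where "wact w = gact (wm w)"

lemma wact_Nil [simp]: "z \<in> HH \<Longrightarrow> wact [] z = z"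
  by (simp add: wact_def gact_one)

lemma wact_append: "z \<in> HH \<Longrightarrow> wact (v @ w) z = wact v (wact w z)"
  unfolding wact_def wm_append by (intro gact_mult det_wm_cases)

lemma wact_Cons: "z \<in> HH \<Longrightarrow> wact (i # w) z = refl i (wact w z)"
  unfolding wact_def refl_def wm_simps by (intro gact_mult det_wm_cases) simp_all

lemma wact_HH [simp]: "z \<in> HH \<Longrightarrow> wact w z \<in> HH"
  unfolding wact_def by (rule hmat_gact(1)[OF det_wm_cases])

lemma hyp_dist_wact [simp]: "z \<in> HH \<Longrightarrow> y \<in> HH \<Longrightarrow> hyp_dist (wact w z) (wact w y) = hyp_dist z y"
  unfolding wact_def by (rule hyp_dist_gact[OF det_wm_cases])

lemma wact_rev: "z \<in> HH \<Longrightarrow> wact w (wact (rev w) z) = z" "z \<in> HH \<Longrightarrow> wact (rev w) (wact w z) = z"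
proof -
  show *: "wact w (wact (rev w) z) = z" if "z \<in> HH" for w z
    using that wm_append_rev[of w] wact_append[of z w "rev w"] by (simp add: wact_def gact_one)
  show "z \<in> HH \<Longrightarrow> wact (rev w) (wact w z) = z" using *[of z "rev w"] by simp
qed

text \<open>Reflections in adjacent sides commute, but their matrices anticommute; so cancelling
  letters preserves the matrix only up to sign, and it preserves the class modulo every
  \<open>m\<close>.\<close>

definition same :: "side list \<Rightarrow> side list \<Rightarrow> bool" where
  "same v w \<longleftrightarrow> (wm v = wm w \<or> wm v = - wm w) \<and> (\<forall>m. congr m v w)"

lemma same_refl: "same w w" by (simp add: same_def)

lemma same_trans: "same a b \<Longrightarrow> same b c \<Longrightarrow> same a c"
  unfolding same_def using congr_trans by (elim conjE disjE) (auto intro: congr_trans)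

lemma wm_move:
  "\<forall>j\<in>set xs. adjacent i j \<Longrightarrow> wm (xs @ [i]) = Mx u i ** wm xs \<or> wm (xs @ [i]) = - (Mx u i ** wm xs)"
proof (induction xs)
  case (Cons j xs)
  have j: "Mx u j ** Mx u i = - (Mx u i ** Mx u j)" 
    using Mx_anticommute[OF adjacent_sym[of i j]] Cons.prems by simp
  have "Mx u j ** (Mx u i ** wm xs) = - (Mx u i ** (Mx u j ** wm xs))"
    unfolding matrix_mul_assoc j by (simp add: matrix_minus_left)
  then show ?case using Cons by (auto simp: matrix_minus_right)
qed simp

lemma same_cancel:
  assumes "\<forall>j\<in>set xs. adjacent i j" shows "same (p @ i # xs @ i # ys) (p @ xs @ ys)"
proof -
  have "wm (i # xs @ i # ys) = Mx u i ** wm (xs @ [i]) ** wm ys"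
    by (simp add: wm_append matrix_mul_assoc)
  also have "\<dots> = wm xs ** wm ys \<or> \<dots> = - (wm xs ** wm ys)"
    using wm_move[OF assms] Mx_square[of i]
    by (auto simp: matrix_minus_right matrix_minus_left matrix_mul_assoc)
  finally have "wm (i # xs @ i # ys) = wm (xs @ ys) \<or> wm (i # xs @ i # ys) = - wm (xs @ ys)"
    by (simp add: wm_append del: wm_simps)
  then have "wm (p @ i # xs @ i # ys) = wm (p @ xs @ ys) \<or> wm (p @ i # xs @ i # ys) = - wm (p @ xs @ ys)"
    unfolding wm_append[of p] by (auto simp: matrix_minus_right simp del: wm_simps)
  then show ?thesis using cf_cancel[OF assms] by (auto simp: same_def intro!: congr_cf)
qed

lemma reduced_same: "\<exists>w'. reduced w' \<and> same w w'"
  by (rule reduced_representative[where R = same, OF same_cancel same_refl same_trans])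

lemma wact_same: "same v w \<Longrightarrow> z \<in> HH \<Longrightarrow> wact v z = wact w z"
  unfolding same_def wact_def using gact_minus[OF det_wm_cases] by auto

text \<open>For right-angled Coxeter groups Tits' lemma is a one-line induction.\<close>

lemma tits:
  assumes "reduced w" "z \<in> HH" "\<And>i. h i z \<ge> \<theta>" "\<theta> \<ge> 0"
  shows "if front i w then h i (wact w z) \<le> - \<theta> else h i (wact w z) \<ge> \<theta>"
  using assms(1)
proof (induction w arbitrary: i)
  case Nil
  then show ?case using assms by simp
next
  case (Cons j v)
  have IH: "if front i v then h i (wact v z) \<le> - \<theta> else h i (wact v z) \<ge> \<theta>" for i
    using Cons by simp
  have hj: "h j (wact v z) \<ge> \<theta>" using IH[of j] Cons.prems by simp
  have eq: "h i (wact (j # v) z) = h i (wact v z) - 2 * gr u i j * h j (wact v z)" for i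
    using assms(2) by (simp add: wact_Cons h_refl)
  have j': "h j (wact (j # v) z) \<le> - \<theta>" using hj by (simp add: eq)
  show ?case
  proof (cases "i = j")
    case True
    then show ?thesis using j' by simp
  next
    case ne: False
    show ?thesis
    proof (cases "adjacent i j")
      case True
      then show ?thesis using IH[of i] ne by (simp add: eq gram_adjacent)
    next
      case False
      have "wact (j # v) z \<in> HH" using assms(2) by simp
      from h_nonadjacent[OF ne False this] show ?thesis using j' ne False by simp
    qed
  qed
qed

lemma fixed_in_polygon:
  assumes "reduced w" "z \<in> HH" "\<And>i. h i z \<ge> 0" "\<And>i. h i (wact w z) \<ge> 0"
  shows "wact w z = z \<and> (\<forall>i\<in>set w. h i z = 0)"
  using assms(1,4)
proof (induction w)
  case Nil then show ?case using assms by simp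
next
  case (Cons j v)
  have "h j (wact (j # v) z) \<le> 0" using tits[of "j # v" z 0 j] Cons assms by simp
  then have "h j (wact (j # v) z) = 0" using Cons.prems(2)[of j] by simp
  then have hj: "h j (wact v z) = 0" using assms(2) by (simp add: wact_Cons h_refl)
  have H: "wact v z \<in> HH" using assms(2) by simp
  have "hmat (refl j (wact v z)) = hmat (wact v z)"
    unfolding refl_def using hmat_reflect[of "Mx u j" "wact v z"] H hj
    by (simp add: h_def)
  then have "refl j (wact v z) = wact v z" by (rule hmat_inj[OF refl_HH[OF H] H])
  then have e: "wact (j # v) z = wact v z" using assms(2) by (simp add: wact_Cons)
  have "wact v z = z \<and> (\<forall>i\<in>set v. h i z = 0)" using Cons e by simp
  then show ?case using e hj by simp
qed

section \<open>The centre of the hexagon\<close>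

definition c0 :: real where "c0 = 1 / sqrt (3 * (2 * be u - 1))"

lemma c0: "c0 > 0" "c0\<^sup>2 * (3 * (2 * be u - 1)) = 1"
  using be_u(2) by (simp_all add: c0_def power_divide)

text \<open>A vector symmetric in the three \<open>A\<close>-sides. Its square is
  \<open>- (3 * (2 * be u - 1))\<close>, which \<open>c0\<close> normalises to -1.\<close>

definition S0 :: "real^2^2" where "S0 = Mx u A1 + Mx u A2 + Mx u A3"

lemma bl_S0: "bl S0 (Mx u i) = (if isA i then 1 - 2 * be u else - de u)"
  by (cases i) (simp_all add: S0_def bl_linear bl_Mx gram_def adjacent_def)

lemma bl_traceless_self: "bl (mat2 p q r (- p)) (mat2 p q r (- p)) = p\<^sup>2 + q * r"
  by (simp add: bl_def power2_eq_square)

lemma ex_center: "\<exists>z\<in>HH. hmat z = - (c0 *\<^sub>R S0)"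
proof -
  have m1: "- (c0 *\<^sub>R S0) = mat2 (c0 * (2 * be u - 1)) (- (c0 * (1 + tau u))) (c0 * (ka u * (1 + 1 / tau u))) (- (c0 * (2 * be u - 1)))"
    by (simp add: Mx.simps S0_def algebra_simps)
  have m2: "bl (- (c0 *\<^sub>R S0)) (- (c0 *\<^sub>R S0)) = - 1"
  proof -
    have e1: "bl S0 S0 = - (3 * (2 * be u - 1))" using bl_S0 by (subst (2) S0_def) (simp add: bl_linear_right)
    have e2: "bl (- (c0 *\<^sub>R S0)) (- (c0 *\<^sub>R S0)) = c0\<^sup>2 * bl S0 S0"
      using bl_linear(3)[of "- c0" S0] bl_linear_right(3)[of _ "- c0" S0] by (simp add: power2_eq_square)
    show ?thesis unfolding e2 e1 mult_minus_right c0(2) ..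
  qed
  have m3: "- (c0 * (2 * be u - 1))\<^sup>2 - (- (c0 * (1 + tau u))) * (c0 * (ka u * (1 + 1 / tau u))) = 1"
    using m2 unfolding m1 bl_traceless_self by linarith
  have m4: "c0 * (ka u * (1 + 1 / tau u)) > 0" using c0 ka_pos tau(1) by (simp add: add_pos_pos)
  show ?thesis using hmat_of_traceless[OF m3 m4] unfolding m1 by blast
qed

definition z0 :: complex where "z0 = (SOME z. z \<in> HH \<and> hmat z = - (c0 *\<^sub>R S0))"

lemma z0: "z0 \<in> HH" "hmat z0 = - (c0 *\<^sub>R S0)"
proof -
  have "\<exists>z. z \<in> HH \<and> hmat z = - (c0 *\<^sub>R S0)" using ex_center by blast
  from someI_ex[OF this] show "z0 \<in> HH" "hmat z0 = - (c0 *\<^sub>R S0)" unfolding z0_def by blast+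
qed

lemma h_z0: "h i z0 = c0 * (if isA i then 2 * be u - 1 else de u)"
proof -
  have "h i z0 = - c0 * bl S0 (Mx u i)"
    by (simp add: h_def ht_def z0 bl_minus bl_linear_right bl_sym[of _ S0])
  then show ?thesis by (simp add: bl_S0 algebra_simps)
qed

text \<open>Because the centre is a combination of \<open>A\<close>-normals, the distance from it
  depends linearly on three heights; bounds on heights become bounds on distance.\<close>

lemma cdist_z0: "cdist z0 z = c0 * (h A1 z + h A2 z + h A3 z)"
  by (simp add: cdist_bl z0 S0_def bl_minus bl_linear h_def ht_def)

text \<open>In fact \<open>c0\<^sup>2 * (de u)\<^sup>2 = (2 * u + 1) / 3\<close>, so there is a
  positive lower bound independent of \<open>u\<close>. The condition \<open>u \<le> 1\<close> makes
  the heights of the centre over the \<open>B\<close>-sides the smaller ones.\<close>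

lemma c0_de: "c0\<^sup>2 * (de u)\<^sup>2 \<ge> 1 / 3" "u \<le> 1 \<Longrightarrow> de u \<le> 2 * be u - 1"
proof -
  have b: "(2 * be u - 1) * u = u + 2" using be_u(1) by (simp add: algebra_simps)
  have "((2 * u + 1) * (2 * be u - 1) - (de u)\<^sup>2) * u = (2 * u + 1) * ((2 * be u - 1) * u) - (de u)\<^sup>2 * u"
    by (simp add: algebra_simps)
  also have "\<dots> = 0" unfolding b de(3) by simp
  finally have "((2 * u + 1) * (2 * be u - 1) - (de u)\<^sup>2) * u = 0" .
  then have d: "(de u)\<^sup>2 = (2 * u + 1) * (2 * be u - 1)" using u by simp
  have "3 * (c0\<^sup>2 * (de u)\<^sup>2) = (2 * u + 1) * (c0\<^sup>2 * (3 * (2 * be u - 1)))" unfolding d by simp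
  then show "c0\<^sup>2 * (de u)\<^sup>2 \<ge> 1 / 3" unfolding c0(2) using u by simp
  assume u1: "u \<le> 1"
  have "2 * u + 1 \<le> 2 * be u - 1"
  proof -
    have "u * u \<le> 1" using u u1 mult_mono[of u 1 u 1] by simp
    then have "(2 * u + 1) * u \<le> (2 * be u - 1) * u" unfolding b by (simp add: algebra_simps)
    then show ?thesis using u by simp
  qed
  then have "(2 * u + 1) * (2 * be u - 1) \<le> (2 * be u - 1) * (2 * be u - 1)"
    using be_u(2) by (intro mult_right_mono) auto
  then have "(de u)\<^sup>2 \<le> (2 * be u - 1)\<^sup>2" unfolding d power2_eq_square[of "2 * be u - 1"] .
  then show "de u \<le> 2 * be u - 1" by (rule power2_le_imp_le) (use be_u(2) in simp)
qed

lemma h_z0_ge: "u \<le> 1 \<Longrightarrow> h i z0 \<ge> c0 * de u"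
  using c0(1) c0_de(2) by (simp add: h_z0)

text \<open>For a reduced word \<open>j # v\<close> the point \<open>wact v z0\<close> is still on
  the positive side of \<open>j\<close>, at height at least \<open>c0 * de u\<close> by
  \<open>tits\<close>. So the reflection in \<open>j\<close> adds at least twice the square of this
  number, which is at least 2/3.\<close>

lemma displacement_ge:
  assumes "u \<le> 1" "reduced w" shows "cdist z0 (wact w z0) \<ge> 1 + 2 / 3 * length w"
  using assms(2)
proof (induction w)
  case Nil
  then show ?case using z0 by (simp add: cdist_ge_1)
next
  case (Cons j v)
  have "h j (wact v z0) \<ge> c0 * de u"
    using tits[of v z0 "c0 * de u" j] Cons.prems z0 h_z0_ge[OF assms(1)] c0 de(1) by (simp split: if_splits)
  moreover have p: "c0 * de u > 0" using c0(1) de(1) by simp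
  moreover have "h j z0 \<ge> 0" using h_z0_ge[OF assms(1), of j] p by linarith
  ultimately have "h j z0 * h j (wact v z0) \<ge> (c0 * de u) * (c0 * de u)"
    using h_z0_ge[OF assms(1), of j] by (intro mult_mono) auto
  then have g: "2 * h j z0 * h j (wact v z0) \<ge> 2 / 3" using c0_de(1) by (simp add: power2_eq_square mult_ac)
  have e: "cdist z0 (wact (j # v) z0) = cdist z0 (wact v z0) + 2 * h j z0 * h j (wact v z0)"
    using z0 by (simp add: wact_Cons cdist_refl)
  have "1 + 2 / 3 * real (length v) \<le> cdist z0 (wact v z0)" using Cons by simp
  moreover have "real (length (j # v)) = real (length v) + 1" by simp
  ultimately show ?case using g unfolding e by linarith
qed

lemma finite_words: "finite {w :: side list. length w \<le> n}"
  using finite_lists_length_le[of "UNIV :: side set" n] by simp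

lemma length_le_of_displacement:
  assumes "u \<le> 1" "reduced w" "hyp_dist z0 (wact w z0) \<le> r" shows "length w \<le> 2 * cosh r"
proof -
  have "r \<ge> 0" using assms(3) hyp_dist_nonneg[of z0 "wact w z0"] z0 by simp
  then have "cosh (hyp_dist z0 (wact w z0)) \<le> cosh r"
    using assms(3) z0 by (simp add: cosh_real_nonneg_le_iff hyp_dist_nonneg)
  then have "1 + 2 / 3 * length w \<le> cosh r"
    using displacement_ge[OF assms(1,2)] z0 by (simp add: cosh_hyp_dist)
  then show ?thesis using cosh_real_pos[of r] by simp
qed

text \<open>In the orbit of \<open>z\<close> a point nearest to \<open>z0\<close> is taken. It
  exists because only finitely many reduced words bring \<open>z\<close> as near as it was, and a
  negative height over a side would let the reflection in that side bring it nearer.\<close>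

lemma move_to_polygon:
  assumes "u \<le> 1" "z \<in> HH" shows "\<exists>w. \<forall>i. h i (wact w z) \<ge> 0"
proof -
  define d where "d = hyp_dist z0 z"
  define F where "F = {w. reduced w \<and> cdist z0 (wact w z) \<le> cdist z0 z}"
  have len: "length w \<le> 2 * cosh (2 * d)" if "w \<in> F" for w
  proof -
    have w: "reduced w" "cdist z0 (wact w z) \<le> cdist z0 z" using that by (auto simp: F_def)
    then have "hyp_dist z0 (wact w z) \<le> d"
    proof -
      have "cosh (hyp_dist z0 (wact w z)) \<le> cosh (hyp_dist z0 z)"
        using w(2) z0(1) assms(2) by (simp add: cosh_hyp_dist)
      then show ?thesis unfolding d_def
        using z0(1) assms(2) by (simp add: cosh_real_nonneg_le_iff hyp_dist_nonneg)
    qed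
    moreover have "hyp_dist z0 (wact w z0) \<le> hyp_dist z0 (wact w z) + hyp_dist (wact w z) (wact w z0)"
      using z0 assms(2) by (intro hyp_dist_triangle) auto
    ultimately have "hyp_dist z0 (wact w z0) \<le> 2 * d" using z0 assms(2) by (simp add: d_def hyp_dist_commute)
    then show ?thesis using length_le_of_displacement assms(1) w by blast
  qed
  have "F \<subseteq> {w. length w \<le> nat \<lceil>2 * cosh (2 * d)\<rceil>}"
  proof
    fix w assume "w \<in> F"
    then have "real (length w) \<le> real (nat \<lceil>2 * cosh (2 * d)\<rceil>)"
      using len real_nat_ceiling_ge order_trans by blast
    then show "w \<in> {w. length w \<le> nat \<lceil>2 * cosh (2 * d)\<rceil>}" by simp
  qed
  then have F: "finite F" using finite_words finite_subset by blast
  have "[] \<in> F" using assms(2) by (simp add: F_def)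
  define f where "f = (\<lambda>w. cdist z0 (wact w z))"
  have "Min (f ` F) \<in> f ` F" using F \<open>[] \<in> F\<close> by (intro Min_in) auto
  then obtain w where wF: "w \<in> F" "Min (f ` F) = f w" by blast
  have "f w \<le> f v" if "v \<in> F" for v using F that by (simp flip: wF(2))
  then have w: "w \<in> F" "\<And>v. v \<in> F \<Longrightarrow> cdist z0 (wact w z) \<le> cdist z0 (wact v z)"
    using wF(1) by (simp_all add: f_def)
  have "h i (wact w z) \<ge> 0" for i
  proof (rule ccontr)
    assume neg: "\<not> h i (wact w z) \<ge> 0"
    obtain v where v: "reduced v" "same (i # w) v" using reduced_same by blast
    have e: "wact v z = refl i (wact w z)" using wact_same[OF v(2) assms(2)] assms(2) by (simp add: wact_Cons)
    have "h i z0 > 0" using h_z0 c0 de(1) be_u(2) by simp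
    then have lt: "cdist z0 (wact v z) < cdist z0 (wact w z)"
      using neg assms(2) by (simp add: e cdist_refl mult_pos_neg)
    then have "v \<in> F" using v w(1) by (simp add: F_def)
    then show False using w(2) lt by fastforce
  qed
  then show ?thesis by blast
qed

lemma polygon_bounded:
  assumes "u \<le> 1" "z \<in> HH" "\<And>i. h i z \<ge> 0" shows "(cdist z0 z)\<^sup>2 \<le> 36 / u"
proof -
  define a b c where "a = h A1 z" "b = h A2 z" "c = h A3 z"
  \<comment> \<open>The \<open>B\<close>-normals divided by \<open>- de u\<close> are the basis dual
    to the \<open>A\<close>-normals, so \<open>V\<close> is the difference of \<open>hmat z\<close>
    and its expansion and must vanish. Pairing it with \<open>hmat z\<close> gives the quadratic
    relation between the heights.\<close>
  define V where "V = hmat z + (1 / de u) *\<^sub>R (a *\<^sub>R Mx u B1 + b *\<^sub>R Mx u B2 + c *\<^sub>R Mx u B3)"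
  have orth: "bl (Mx u A1) V = 0" "bl (Mx u A2) V = 0" "bl (Mx u A3) V = 0"
    using de(1) unfolding V_def bl_linear_right bl_Mx
    by (simp_all add: gram_def adjacent_def a_b_c_def h_def ht_def)
  have "V = 0"
  proof -
    obtain p q r s where e: "V = mat2 p q r s" by (rule mat2_cases)
    have "trace V = 0" unfolding V_def by (simp add: trace_plus trace_scaleR)
    then have s: "s = - p" by (simp add: e)
    have p: "p = 0" using orth(1) by (simp add: e s Mx.simps bl_def)
    have r: "r = ka u * q" using orth(2) by (simp add: e s p Mx.simps bl_def algebra_simps)
    have "tau u * r = ka u / tau u * q" using orth(3) by (simp add: e s p Mx.simps bl_def algebra_simps)
    then have "ka u * q * (tau u * tau u - 1) = 0" using tau(1) unfolding r by (simp add: field_simps)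
    moreover have "tau u * tau u \<noteq> 1" using tau(1) less_1_mult[of "tau u" "tau u"] by simp
    ultimately have "q = 0" using ka_pos by simp
    then show ?thesis using p r s e by (simp add: vec_eq_iff forall_2)
  qed
  then have "bl (hmat z) V = 0" by (simp add: bl_def trace_def)
  moreover have "bl (hmat z) (hmat z) = - 1" using assms(2) by (simp add: bl_def hmat_square mat2_one)
  ultimately have "(a * h B1 z + b * h B2 z + c * h B3 z) / de u = 1"
    unfolding V_def bl_linear_right h_def ht_def 
    by (simp add: bl_sym[of "hmat z" "Mx u B1"] bl_sym[of "hmat z" "Mx u B2"] bl_sym[of "hmat z" "Mx u B3"]
        add_divide_distrib)
  then have sum: "a * (de u * h B1 z) + b * (de u * h B2 z) + c * (de u * h B3 z) = (de u)\<^sup>2"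
    using de(1) by (simp add: field_simps power2_eq_square)
  have hB: "de u * h B1 z = cc u * (b + c) - a" "de u * h B2 z = cc u * (a + c) - b" "de u * h B3 z = cc u * (a + b) - c"
    using de(1) by (simp_all add: h_def ht_def a_b_c_def Mx.simps(4-6) bl_linear)
  have nn: "a \<ge> 0" "b \<ge> 0" "c \<ge> 0" "cc u * (b + c) - a \<ge> 0" "cc u * (a + c) - b \<ge> 0" "cc u * (a + b) - c \<ge> 0"
  proof -
    show "a \<ge> 0" "b \<ge> 0" "c \<ge> 0" using assms(3) by (simp_all add: a_b_c_def)
    have "de u * h i z \<ge> 0" for i using assms(3)[of i] de(1) by simp
    from this[of B1] this[of B2] this[of B3]
    show "cc u * (b + c) - a \<ge> 0" "cc u * (a + c) - b \<ge> 0" "cc u * (a + b) - c \<ge> 0" unfolding hB .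
  qed
  note key = maximal_coordinate_bound[OF u cc_def[of u]]
  define x where "x = max a (max b c)"
  have x: "x * x * u \<le> 2 * cc u * (de u)\<^sup>2"
  proof -
    have le: "a \<le> x" "b \<le> x" "c \<le> x" unfolding x_def by linarith+
    note facts = nn le sum[unfolded hB]
    consider "x = a" | "x = b" | "x = c" unfolding x_def by linarith
    then show ?thesis
    proof cases
      case 1
      show ?thesis unfolding 1 by (rule key[of a b c]; use facts[unfolded 1] in linarith)
    next
      case 2
      show ?thesis unfolding 2 
        by (rule key[of b a c]) (use facts[unfolded 2] in \<open>simp_all only: add_ac\<close>)
    next
      case 3
      show ?thesis unfolding 3 
        by (rule key[of c a b]) (use facts[unfolded 3] in \<open>simp_all only: add_ac\<close>)
    qed
  qed
  have x0: "x \<ge> 0" "a + b + c \<le> 3 * x" unfolding x_def using nn by linarith+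
  have "cdist z0 z = c0 * (a + b + c)" by (simp add: cdist_z0 a_b_c_def)
  then have "cdist z0 z \<le> c0 * (3 * x)" "cdist z0 z \<ge> 0" using c0(1) x0 nn by simp_all
  then have "(cdist z0 z)\<^sup>2 \<le> (c0 * (3 * x))\<^sup>2" by (intro power_mono)
  also have "\<dots> = 9 * c0\<^sup>2 * (x * x)" by (simp add: power2_eq_square)
  \<comment> \<open>The factor equals \<open>u * (u + 2)\<close>; it removes \<open>c0\<close> and
    the denominators hidden in \<open>be u\<close> and \<open>de u\<close>.\<close>
  finally have "(cdist z0 z)\<^sup>2 * (u * u * (2 * be u - 1)) \<le> (9 * c0\<^sup>2 * (x * x)) * (u * u * (2 * be u - 1))"
    using u be_u(2) by (intro mult_right_mono) auto
  also have "\<dots> = 3 * (c0\<^sup>2 * (3 * (2 * be u - 1))) * (x * x * u) * u" by simp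
  also have "\<dots> = 3 * (x * x * u) * u" unfolding c0(2) by simp
  also have "\<dots> \<le> 3 * (2 * cc u * (de u)\<^sup>2) * u"
    using x u by (intro mult_right_mono mult_left_mono) auto
  also have "\<dots> = 6 * cc u * ((de u)\<^sup>2 * u)" by simp
  also have "\<dots> = 6 * cc u * ((2 * u + 1) * (u + 2))" unfolding de(3) ..
  also have "\<dots> \<le> 36 * (u + 2)"
  proof -
    have "cc u * (2 * u + 1) \<le> 2 * 3" using assms(1) u by (intro mult_mono) (auto simp: cc_def)
    then have "(cc u * (2 * u + 1)) * (u + 2) \<le> 6 * (u + 2)" using u by (intro mult_right_mono) auto
    moreover have "6 * cc u * ((2 * u + 1) * (u + 2)) = 6 * ((cc u * (2 * u + 1)) * (u + 2))"
      by (simp only: mult.assoc)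
    ultimately show ?thesis by linarith
  qed
  also have "u * u * (2 * be u - 1) = u * (2 * (be u * u) - u)" by (simp add: algebra_simps)
  also have "\<dots> = u * (u + 2)" unfolding be_u(1) by simp
  finally have "((cdist z0 z)\<^sup>2 * u) * (u + 2) \<le> 36 * (u + 2)" by (simp only: mult.assoc)
  then have "(cdist z0 z)\<^sup>2 * u \<le> 36" by (rule mult_right_le_imp_le) (use u in simp)
  then show ?thesis using u by (simp add: pos_le_divide_eq)
qed

lemma polygon_bounded':
  assumes "u \<le> 1" "z \<in> HH" "\<And>i. h i z \<ge> 0" shows "hyp_dist z0 z \<le> arcosh (6 / sqrt u)"
proof -
  have "cdist z0 z \<le> sqrt (36 / u)" using polygon_bounded[OF assms] by (rule real_le_rsqrt)
  then have "cdist z0 z \<le> 6 / sqrt u" by (simp add: real_sqrt_divide)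
  moreover have "cdist z0 z \<ge> 1" using assms z0 by (intro cdist_ge_1)
  ultimately show ?thesis using assms z0
    by (cases "cdist z0 z = 6 / sqrt u") (auto simp: hyp_dist_eq intro!: less_imp_le)
qed

end

section \<open>The surface groups\<close>

context hexagon
begin

definition coset :: "side list \<Rightarrow> (real^2^2) set" where "coset w = {wm w, - wm w}"

definition Gam :: "int \<Rightarrow> (real^2^2) set set" where "Gam m = coset ` {w. in_ker m w}"

lemma det_wm_even: "even (length w) \<Longrightarrow> det (wm w) = 1"
  by (simp add: det_wm)

lemma det_wm_ker: "in_ker m w \<Longrightarrow> det (wm w) = 1"
  by (intro det_wm_even in_ker_even(3))

lemma coset_act: "det (wm w) = 1 \<Longrightarrow> psl_act (coset w) = wact w"
  by (simp add: coset_def psl_act_coset wact_def gact_det_1)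

lemma coset_trace: "psl_trace (coset w) = \<bar>trace (wm w)\<bar>"
  by (simp add: coset_def psl_trace_coset)

lemma coset_carrier: "det (wm w) = 1 \<Longrightarrow> coset w \<in> carrier PSL2R"
  by (auto simp: coset_def carrier_PSL2R)

lemma coset_mult:
  "det (wm v) = 1 \<Longrightarrow> det (wm w) = 1 \<Longrightarrow> coset v \<otimes>\<^bsub>PSL2R\<^esub> coset w = coset (v @ w)"
  by (simp add: coset_def mult_PSL2R wm_append)

lemma coset_Nil: "coset [] = \<one>\<^bsub>PSL2R\<^esub>"
  by (simp add: coset_def one_PSL2R)

lemma coset_same: "same v w \<Longrightarrow> coset v = coset w"
  by (auto simp: same_def coset_def)

lemma same_in_ker: "same v w \<Longrightarrow> in_ker m v \<Longrightarrow> in_ker m w"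
  unfolding same_def in_ker_def using congr_sym congr_trans by blast

lemma subgroup_Gam: "subgroup (Gam m) PSL2R"
proof (rule group.subgroupI[OF group_PSL2R])
  show "Gam m \<subseteq> carrier PSL2R" using coset_carrier det_wm_ker by (auto simp: Gam_def)
  show "Gam m \<noteq> {}" using in_ker_Nil by (auto simp: Gam_def)
  fix a assume "a \<in> Gam m"
  then obtain v where v: "in_ker m v" "a = coset v" by (auto simp: Gam_def)
  have d: "det (wm v) = 1" "det (wm (rev v)) = 1" using v det_wm_ker in_ker_rev by blast+
  have "coset (rev v @ v) = coset []"
    using wm_append_rev[of "rev v"] by (simp add: coset_def)
  then have "coset (rev v) \<otimes>\<^bsub>PSL2R\<^esub> coset v = \<one>\<^bsub>PSL2R\<^esub>" using d by (simp add: coset_mult coset_Nil)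
  then have "inv\<^bsub>PSL2R\<^esub> a = coset (rev v)"
    using d coset_carrier v(2) group.inv_equality[OF group_PSL2R] by blast
  then show "inv\<^bsub>PSL2R\<^esub> a \<in> Gam m" using in_ker_rev[OF v(1)] by (auto simp: Gam_def)
  fix b assume "b \<in> Gam m"
  then obtain w where w: "in_ker m w" "b = coset w" by (auto simp: Gam_def)
  have "a \<otimes>\<^bsub>PSL2R\<^esub> b = coset (v @ w)" using v w det_wm_ker by (simp add: coset_mult)
  then show "a \<otimes>\<^bsub>PSL2R\<^esub> b \<in> Gam m" using in_ker_append[OF v(1) w(1)] by (auto simp: Gam_def)
qed

lemma matrix_sub_rdistrib: "(A - B) ** C = A ** C - B ** C"
  and matrix_sub_ldistrib: "C ** (A - B) = C ** A - C ** B" for A B C :: "real^2^2"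
  by (cases A rule: mat2_cases, cases B rule: mat2_cases, cases C rule: mat2_cases, simp add: algebra_simps)+

lemma wm_conj: "wm (v @ w @ rev v) = wm v ** wm w ** wm (rev v)"
  by (simp add: wm_append matrix_mul_assoc)

lemma wm_rev_mult: "wm (rev v) ** wm v = mat 1"
  using wm_append_rev[of "rev v"] by (simp add: wm_append)

lemma wm_unconj: "wm w = wm (rev v) ** wm (v @ w @ rev v) ** wm v"
proof -
  have "wm (rev v) ** (wm v ** wm w ** wm (rev v)) ** wm v = (wm (rev v) ** wm v) ** wm w ** (wm (rev v) ** wm v)"
    by (simp add: matrix_mul_assoc)
  then show ?thesis by (simp add: wm_conj wm_rev_mult)
qed

lemma trace_wm_conj: "trace (wm (v @ w @ rev v)) = trace (wm w)"
proof -
  have "trace (wm v ** wm w ** wm (rev v)) = trace (wm (rev v) ** (wm v ** wm w))" by (rule trace_cyclic)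
  also have "\<dots> = trace (wm w)" by (simp add: matrix_mul_assoc wm_rev_mult)
  finally show ?thesis by (simp add: wm_conj)
qed

lemma wact_conj: "z \<in> HH \<Longrightarrow> wact (v @ w @ rev v) (wact v z) = wact v (wact w z)"
  by (simp add: wact_append wact_rev)

text \<open>All heights of the centre are positive, and the first letter puts its image on or beyond
  a side.\<close>

lemma reduced_nontrivial:
  assumes "reduced w" "w \<noteq> []" shows "coset w \<noteq> \<one>\<^bsub>PSL2R\<^esub>" "wact w z0 \<noteq> z0"
proof -
  obtain j v where w: "w = j # v" using assms(2) by (cases w) auto
  have pos: "h i z0 > 0" for i using h_z0[of i] c0 de(1) be_u(2) by simp
  have "h j (wact v z0) \<ge> 0"
    using tits[of v z0 0 j] assms(1) w z0 pos by (simp add: less_imp_le split: if_splits)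
  then have "h j (wact w z0) \<le> 0" using z0 by (simp add: w wact_Cons h_refl)
  then show ne: "wact w z0 \<noteq> z0" using pos[of j] by auto
  show "coset w \<noteq> \<one>\<^bsub>PSL2R\<^esub>"
  proof
    assume "coset w = \<one>\<^bsub>PSL2R\<^esub>"
    then have "wm w = mat 1 \<or> wm w = - mat 1" by (auto simp: coset_def one_PSL2R doubleton_eq_iff)
    then have "wact w z0 = z0"
      using z0(1) gact_minus[of "mat 1" z0] by (auto simp: wact_def gact_one)
    then show False using ne by simp
  qed
qed

text \<open>Conjugation moves the fixed point into the hexagon. The letters of the reduced conjugate
  are then sides through this point, hence pairwise adjacent, so there is at most one of each type.
  Even numbers of both types leave the empty word.\<close>

lemma Gam_free:
  assumes "u \<le> 1" "in_ker m w" "z \<in> HH" "wact w z = z" shows "coset w = \<one>\<^bsub>PSL2R\<^esub>"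
proof -
  obtain v where v: "\<And>i. h i (wact v z) \<ge> 0" using move_to_polygon[OF assms(1,3)] by blast
  define p where "p = wact v z"
  have p: "p \<in> HH" "\<And>i. h i p \<ge> 0" using v assms(3) by (simp_all add: p_def)
  obtain w' where w': "reduced w'" "same (v @ w @ rev v) w'" using reduced_same by blast
  have k: "in_ker m w'" using same_in_ker[OF w'(2)] in_ker_conj[OF assms(2)] by blast
  have "wact w' p = p"
    using wact_same[OF w'(2) p(1)] wact_conj[OF assms(3)] assms(4) by (simp add: p_def)
  then have z: "\<forall>i\<in>set w'. h i p = 0" using fixed_in_polygon[OF w'(1) p] p(2) by simp
  have "\<forall>i\<in>set w'. \<forall>j\<in>set w'. i = j \<or> adjacent i j"
  proof (intro ballI)
    fix i j assume "i \<in> set w'" "j \<in> set w'"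
    then have "h i p + h j p = 0" using z by simp
    then show "i = j \<or> adjacent i j" using h_nonadjacent[of i j p] p(1) by fastforce
  qed
  then have "nA w' \<le> 1" "nB w' \<le> 1" using reduced_pairwise_adjacent[OF w'(1)] by auto
  then have "nA w' = 0" "nB w' = 0" using in_ker_even[OF k] by (auto simp: le_Suc_eq)
  then have "w' = []" using length_nAB[of w'] by simp
  then have "wm (v @ w @ rev v) = mat 1 \<or> wm (v @ w @ rev v) = - mat 1"
    using w'(2) by (auto simp: same_def)
  then have "wm w = mat 1 \<or> wm w = - mat 1"
    using wm_unconj[of w v] by (auto simp: wm_rev_mult matrix_minus_left matrix_minus_right)
  then show ?thesis by (auto simp: coset_def one_PSL2R)
qed

lemma surface_group_Gam:
  assumes "u \<le> 1" "m > 0" shows "surface_group (Gam m) z0"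
proof (rule surface_group.intro)
  show "subgroup (Gam m) PSL2R" by (rule subgroup_Gam)
  show "z0 \<in> HH" by (rule z0)
  show "\<gamma> = \<one>\<^bsub>PSL2R\<^esub>" if "\<gamma> \<in> Gam m" "z \<in> HH" "psl_act \<gamma> z = z" for \<gamma> z
    using that Gam_free[OF assms(1)] by (auto simp: Gam_def coset_act det_wm_ker)
  show "finite {\<gamma> \<in> Gam m. hyp_dist z0 (psl_act \<gamma> z0) \<le> r}" for r
  proof (rule finite_subset)
    show "{\<gamma> \<in> Gam m. hyp_dist z0 (psl_act \<gamma> z0) \<le> r} \<subseteq> coset ` {w. length w \<le> nat \<lceil>2 * cosh r\<rceil>}"
    proof (intro subsetI, elim CollectE conjE)
      fix \<gamma> assume "\<gamma> \<in> Gam m" and d: "hyp_dist z0 (psl_act \<gamma> z0) \<le> r"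
      then obtain w where w: "in_ker m w" "\<gamma> = coset w" by (auto simp: Gam_def)
      obtain w' where w': "reduced w'" "same w w'" using reduced_same by blast
      have "hyp_dist z0 (wact w' z0) \<le> r"
        using d wact_same[OF w'(2) z0(1)] by (simp add: w coset_act det_wm_ker[OF w(1)])
      then have "real (length w') \<le> 2 * cosh r" using length_le_of_displacement[OF assms(1) w'(1)] by blast
      then have "real (length w') \<le> real (nat \<lceil>2 * cosh r\<rceil>)" using real_nat_ceiling_ge order_trans by blast
      then show "\<gamma> \<in> coset ` {w. length w \<le> nat \<lceil>2 * cosh r\<rceil>}"
        using coset_same[OF w'(2)] w(2) by auto
    qed
  qed (intro finite_imageI finite_words)
  show "\<exists>R. \<forall>z\<in>HH. \<exists>\<gamma>\<in>Gam m. hyp_dist z0 (psl_act \<gamma> z) \<le> R"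
  proof -
    obtain T where T: "finite T" "\<And>w. \<exists>v\<in>T. congr m v w" using finite_transversal[OF assms(2)] by blast
    \<comment> \<open>Images of the hexagon under the finitely many inverse representatives meet
      every orbit of \<open>Gam m\<close>. The first summand bounds the distance to their centres,
      the second the radius of the hexagon.\<close>
    define R where "R = Max ((\<lambda>v. hyp_dist z0 (wact (rev v) z0)) ` T) + arcosh (6 / sqrt u)"
    show ?thesis
    proof (intro exI[of _ R] ballI)
      fix z assume z: "z \<in> HH"
      obtain w where w: "\<And>i. h i (wact w z) \<ge> 0" using move_to_polygon[OF assms(1) z] by blast
      obtain v where v: "v \<in> T" "congr m v w" using T(2) by blast
      have k: "in_ker m (rev v @ w)" using in_ker_of_congr[OF v(2)] .
      have "hyp_dist z0 (wact (rev v @ w) z) \<le> hyp_dist z0 (wact (rev v) z0) + hyp_dist (wact (rev v) z0) (wact (rev v) (wact w z))"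
        using z z0(1) by (subst wact_append[OF z]) (intro hyp_dist_triangle wact_HH)
      also have "hyp_dist (wact (rev v) z0) (wact (rev v) (wact w z)) \<le> arcosh (6 / sqrt u)"
        using z z0(1) polygon_bounded'[OF assms(1) wact_HH[OF z] w] by simp
      also have "hyp_dist z0 (wact (rev v) z0) \<le> Max ((\<lambda>v. hyp_dist z0 (wact (rev v) z0)) ` T)"
        using T(1) v(1) by (intro Max_ge) auto
      finally have "hyp_dist z0 (wact (rev v @ w) z) \<le> R" by (simp add: R_def)
      then show "\<exists>\<gamma>\<in>Gam m. hyp_dist z0 (psl_act \<gamma> z) \<le> R"
        using k by (intro bexI[of _ "coset (rev v @ w)"]) (auto simp: Gam_def coset_act det_wm_ker)
    qed
  qed
qed

text \<open>Up to conjugation, an element of translation length \<open>l\<close> moves a point of the hexagon by \<open>l\<close>.\<close>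

lemma short_word:
  assumes "u \<le> 1" "m > 0" "\<gamma> \<in> Gam m" "l > 0" "psl_trace \<gamma> = 2 * cosh (l / 2)"
  shows "\<exists>w. reduced w \<and> in_ker m w \<and> w \<noteq> [] \<and> length w \<le> 2 * cosh (l + 2 * arcosh (6 / sqrt u)) \<and>
    \<bar>trace (wm w)\<bar> = psl_trace \<gamma>"
proof -
  interpret surface_group "Gam m" z0 by (rule surface_group_Gam[OF assms(1,2)])
  define D where "D = arcosh (6 / sqrt u)"
  obtain z where z: "z \<in> HH" "hyp_dist z (psl_act \<gamma> z) = l" using axis_point[OF assms(3-5)] by blast
  obtain w where w: "in_ker m w" "\<gamma> = coset w" using assms(3) by (auto simp: Gam_def)
  obtain v where v: "\<And>i. h i (wact v z) \<ge> 0" using move_to_polygon[OF assms(1) z(1)] by blast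
  define p where "p = wact v z"
  have p: "p \<in> HH" "hyp_dist z0 p \<le> D"
    using v z(1) polygon_bounded'[OF assms(1)] by (simp_all add: p_def D_def)
  obtain w' where w': "reduced w'" "same (v @ w @ rev v) w'" using reduced_same by blast
  have "wact w' p = wact v (wact w z)"
    using wact_same[OF w'(2) p(1)] wact_conj[OF z(1)] by (simp add: p_def)
  then have "hyp_dist p (wact w' p) = l"
    using z w by (simp add: p_def coset_act det_wm_ker)
  moreover have "hyp_dist z0 (wact w' z0) \<le> hyp_dist z0 p + hyp_dist p (wact w' z0)"
    "hyp_dist p (wact w' z0) \<le> hyp_dist p (wact w' p) + hyp_dist (wact w' p) (wact w' z0)"
    using p z0 by (intro hyp_dist_triangle; simp)+
  moreover have "hyp_dist (wact w' p) (wact w' z0) = hyp_dist z0 p" using p z0 by (simp add: hyp_dist_commute)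
  ultimately have "hyp_dist z0 (wact w' z0) \<le> l + 2 * D" using p by linarith
  then have len: "length w' \<le> 2 * cosh (l + 2 * D)" by (rule length_le_of_displacement[OF assms(1) w'(1)])
  have tr: "\<bar>trace (wm w')\<bar> = psl_trace \<gamma>"
    using w'(2) trace_wm_conj[of v w] by (auto simp: w(2) coset_trace same_def trace_minus)
  have "w' \<noteq> []"
  proof
    assume "w' = []"
    then have "psl_trace \<gamma> = 2" using tr by (simp add: mat2_one)
    moreover have "cosh (l / 2) > 1" using assms(4) cosh_real_strict_mono[of 0 "l / 2"] by simp
    ultimately show False using assms(5) by simp
  qed
  moreover have "in_ker m w'" using same_in_ker[OF w'(2)] in_ker_conj[OF w(1)] by blast
  ultimately show ?thesis using w'(1) len tr unfolding D_def by blast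
qed

section \<open>Traces\<close>

text \<open>Moving the first letter cyclically through the word expresses the trace by shorter traces (Wick's formula).
  The entry \<open>de u\<close> of the Gram matrix pairs letters of different type, hence occurs with even total degree in the
  trace of a word with an even number of letters of each type.\<close>

lemma trace_in_ring:
  fixes Rg :: "real set"
  assumes add: "\<And>x y. x \<in> Rg \<Longrightarrow> y \<in> Rg \<Longrightarrow> x + y \<in> Rg"
    and mult: "\<And>x y. x \<in> Rg \<Longrightarrow> y \<in> Rg \<Longrightarrow> x * y \<in> Rg"
    and neg: "\<And>x. x \<in> Rg \<Longrightarrow> - x \<in> Rg" and one: "1 \<in> Rg"
    and param: "be u \<in> Rg" "cc u \<in> Rg" "(de u)\<^sup>2 \<in> Rg"
    and even: "even (nA w)" "even (nB w)"
  shows "trace (wm w) \<in> Rg"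
proof -
  \<comment> \<open>A grading by parity: \<open>True\<close> stands for the ring itself,
    \<open>False\<close> for its multiples by \<open>de u\<close>, which is not assumed to lie in
    the ring.\<close>
  define Rp where "Rp = (\<lambda>p::bool. if p then Rg else (\<lambda>x. de u * x) ` Rg)"
  have zero: "0 \<in> Rg" using add[OF one neg[OF one]] by simp
  have Rp_iff: "x \<in> Rp p \<longleftrightarrow> (if p then x \<in> Rg else \<exists>a\<in>Rg. x = de u * a)" for x p
    by (auto simp: Rp_def)
  have Radd: "x + y \<in> Rp p" if xy: "x \<in> Rp p" "y \<in> Rp p" for x y p
  proof (cases p)
    case False
    then obtain a b where "a \<in> Rg" "x = de u * a" "b \<in> Rg" "y = de u * b" using xy unfolding Rp_iff by auto
    then have "a + b \<in> Rg" "x + y = de u * (a + b)" using add by (simp_all add: distrib_left)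
    then show ?thesis using False unfolding Rp_iff by auto
  qed (use xy add in \<open>simp add: Rp_iff\<close>)
  have Rneg: "- x \<in> Rp p" if x: "x \<in> Rp p" for x p
  proof (cases p)
    case False
    then obtain a where "a \<in> Rg" "x = de u * a" using x unfolding Rp_iff by auto
    then have "- a \<in> Rg" "- x = de u * (- a)" using neg by simp_all
    then show ?thesis using False unfolding Rp_iff by metis
  qed (use x neg in \<open>simp add: Rp_iff\<close>)
  have Rzero: "0 \<in> Rp p" for p using zero unfolding Rp_iff by (metis mult_zero_right)
  have Rmult: "x * y \<in> Rp (p = q)" if xy: "x \<in> Rp p" "y \<in> Rp q" for x y p q
  proof -
    have r: "de u * a * (de u * b) \<in> Rg" if "a \<in> Rg" "b \<in> Rg" for a b
    proof -
      have "(de u)\<^sup>2 * (a * b) \<in> Rg" using that param mult by blast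
      then show ?thesis by (simp add: power2_eq_square mult_ac)
    qed
    have l: "\<exists>c\<in>Rg. de u * a * b = de u * c" "\<exists>c\<in>Rg. a * (de u * b) = de u * c" if "a \<in> Rg" "b \<in> Rg" for a b
      using mult[OF that] by (auto intro!: bexI[of _ "a * b"])
    show ?thesis
    proof (cases p; cases q)
      assume "\<not> p" "\<not> q" then show ?thesis using xy r by (auto simp: Rp_iff)
    next
      assume "\<not> p" "q" then show ?thesis using xy l(1) by (auto simp: Rp_iff)
    next
      assume "p" "\<not> q" then show ?thesis using xy l(2) by (auto simp: Rp_iff)
    next
      assume "p" "q" then show ?thesis using xy mult by (auto simp: Rp_iff)
    qed
  qed
  have gR: "gr u i j \<in> Rp (isA i = isA j)" for i j
  proof -
    have "de u \<in> Rp False" unfolding Rp_iff using one by force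
    moreover have "1 \<in> Rp True" "be u \<in> Rp True" "cc u \<in> Rp True" using param one by (simp_all add: Rp_iff)
    ultimately show ?thesis using Rzero Rneg by (simp add: gram_def)
  qed
  have two: "2 \<in> Rg" using add[OF one one] by simp
  have main: "even (length w) \<Longrightarrow> trace (wm w) \<in> Rp (even (nA w))" for w
  proof (induction w rule: measure_induct_rule[of length])
    case (less w)
    show ?case
    proof (cases w)
      case Nil
      then show ?thesis using two by (simp add: Rp_def mat2_one)
    next
      case (Cons v zs)
      define P where "P = even (nA w)"
      \<comment> \<open>The letter \<open>v\<close> passes through \<open>ys\<close> by one
        anticommutation per letter, each contributing a Gram entry times the trace of a word that is
        two letters shorter.\<close>
      have inner: "\<exists>r\<in>Rp P. trace (wm (xs @ v # ys)) = 2 * r + (- 1) ^ length ys * trace (wm (xs @ ys @ [v]))"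
        if "length (xs @ ys) = length zs" "nA (xs @ ys) = nA zs" for xs ys
        using that
      proof (induction ys arbitrary: xs)
        case Nil
        then show ?case using Rzero[of P] by (intro bexI[of _ 0]) auto
      next
        case (Cons y ys)
        define g T where "g = gr u v y" "T = trace (wm (xs @ ys))"
        obtain r where r: "r \<in> Rp P" "trace (wm ((xs @ [y]) @ v # ys)) = 2 * r + (- 1) ^ length ys * trace (wm ((xs @ [y]) @ ys @ [v]))"
          using Cons.IH[of "xs @ [y]"] Cons.prems by auto
        have "Mx u v ** Mx u y = (2 * g) *\<^sub>R mat 1 - Mx u y ** Mx u v"
          unfolding g_T_def bl_Mx[symmetric] by (rule traceless_anticommute) simp_all
        then have "Mx u v ** (Mx u y ** wm ys) = (2 * g) *\<^sub>R wm ys - Mx u y ** (Mx u v ** wm ys)"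
          by (simp add: matrix_mul_assoc matrix_sub_rdistrib matrix_scaleR_left)
        then have "wm (xs @ v # y # ys) = (2 * g) *\<^sub>R wm (xs @ ys) - wm ((xs @ [y]) @ v # ys)"
          by (simp add: wm_append matrix_sub_ldistrib matrix_scaleR_right matrix_mul_assoc)
        then have e: "trace (wm (xs @ v # y # ys)) = 2 * g * T - trace (wm ((xs @ [y]) @ v # ys))"
          by (simp add: g_T_def trace_sub trace_scaleR)
        have len: "length w = Suc (Suc (length (xs @ ys)))" using Cons.prems(1) \<open>w = v # zs\<close> by simp
        then have "even (length (xs @ ys))" using less.prems by (simp del: length_append)
        then have "T \<in> Rp (even (nA (xs @ ys)))" unfolding g_T_def using less.IH[of "xs @ ys"] len by simp
        then have "g * T \<in> Rp ((isA v = isA y) = even (nA (xs @ ys)))" unfolding g_T_def by (intro Rmult gR)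
        moreover have "((isA v = isA y) = even (nA (xs @ ys))) = P"
        proof -
          have "nA zs = nA xs + nA (y # ys)" using Cons.prems(2) by simp
          then show ?thesis using \<open>w = v # zs\<close> by (cases "isA v"; cases "isA y") (auto simp: P_def)
        qed
        ultimately have "g * T \<in> Rp P" by (simp only:)
        then have "g * T + - r \<in> Rp P" by (rule Radd[OF _ Rneg[OF r(1)]])
        moreover have "trace (wm (xs @ v # y # ys)) = 2 * (g * T + - r) + (- 1) ^ length (y # ys) * trace (wm (xs @ (y # ys) @ [v]))"
          unfolding e r(2) by (simp add: algebra_simps)
        ultimately show ?case by blast
      qed
      obtain r where r: "r \<in> Rp P" "trace (wm ([] @ v # zs)) = 2 * r + (- 1) ^ length zs * trace (wm ([] @ zs @ [v]))"
        using inner[of "[]" zs] by auto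
      \<comment> \<open>An odd number of sign changes gives the trace as \<open>2 * r\<close> minus
        itself, so it equals \<open>r\<close> and no division by 2 leaves the ring.\<close>
      have "odd (length zs)" using less.prems Cons by simp
      moreover have "trace (wm (zs @ [v])) = trace (wm (v # zs))"
        by (simp add: wm_append trace_cyclic)
      ultimately have "trace (wm w) = r" using r(2) Cons by simp
      then show ?thesis using r(1) by (simp add: P_def)
    qed
  qed
  have "trace (wm w) \<in> Rp True" using main[of w] even by (simp add: length_nAB)
  then show ?thesis by (simp add: Rp_def)
qed

lemma square_subgroup_subset: "square_subgroup (Gam m) \<subseteq> Gam m"
proof -
  have "{\<gamma> \<otimes>\<^bsub>PSL2R\<^esub> \<gamma> | \<gamma>. \<gamma> \<in> Gam m} \<subseteq> Gam m"
    using subgroup.m_closed[OF subgroup_Gam] by blast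
  then show ?thesis unfolding square_subgroup_def
    by (intro group.generate_subgroup_incl[OF group_PSL2R _ subgroup_Gam])
qed

lemma trace_pair: "trace (Mx u B1 ** Mx u B2) = - 2 * cc u"
  using two_bl[of "Mx u B1" "Mx u B2"] by (simp add: bl_Mx gram_def adjacent_def)

lemma trace_power:
  assumes "cosh a = cc u"
  shows "trace (wm (concat (replicate k [B1, B2]))) = (- 1) ^ k * (2 * cosh (real k * a))"
proof (induction k rule: induct_nat_012)
  case 0 show ?case by (simp add: mat2_one)
next
  case 1 show ?case using assms by (simp add: trace_pair)
next
  case (ge2 k)
  define T where "T = Mx u B1 ** Mx u B2"
  define Y where "Y = wm (concat (replicate k [B1, B2]))"
  have "det T = 1" "trace T = - 2 * cc u" by (simp_all add: T_def det_mul trace_pair)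
  then have CH: "T ** T = (- 2 * cc u) *\<^sub>R T - mat 1"
  proof -
    obtain a b c d where T': "T = mat2 a b c d" by (rule mat2_cases)
    have "a * d - b * c = 1" "a + d = - 2 * cc u" using \<open>det T = 1\<close> \<open>trace T = - 2 * cc u\<close> by (simp_all add: T')
    then show ?thesis unfolding T' mat2_one by (simp, intro conjI) Groebner_Basis.algebra+
  qed
  have e: "wm (concat (replicate (Suc j) [B1, B2])) = T ** wm (concat (replicate j [B1, B2]))" for j
    by (simp add: T_def matrix_mul_assoc)
  have "wm (concat (replicate (Suc (Suc k)) [B1, B2])) = (T ** T) ** Y" by (simp only: e Y_def matrix_mul_assoc)
  also have "\<dots> = (- 2 * cc u) *\<^sub>R (T ** Y) - Y"
    unfolding CH by (simp only: matrix_sub_rdistrib matrix_scaleR_left matrix_mul_lid)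
  finally have "trace (wm (concat (replicate (Suc (Suc k)) [B1, B2]))) =
      - 2 * cc u * trace (wm (concat (replicate (Suc k) [B1, B2]))) - trace Y"
    by (simp only: e Y_def trace_sub trace_scaleR)
  also have "\<dots> = (- 1) ^ k * (2 * (2 * cosh a * cosh (real (Suc k) * a) - cosh (real k * a)))"
    unfolding Y_def ge2 assms by (simp add: algebra_simps)
  also have "2 * cosh a * cosh (real (Suc k) * a) - cosh (real k * a) = cosh (real (Suc (Suc k)) * a)"
    using cosh_add[of "real (Suc k) * a" a] cosh_diff[of "real (Suc k) * a" a] by (simp add: algebra_simps)
  finally show ?case by simp
qed

end

section \<open>Faithfulness of the integral representation\<close>

interpretation H1: hexagon 1 by standard simp

text \<open>\<open>cf w\<close> expresses the heights of the moved point through those of the point;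
  at \<open>u = 1\<close> the coefficients are integers since \<open>de 1 = 3\<close>.\<close>

lemma h_wact_at_1:
  assumes "z \<in> HH" shows "H1.h i (H1.wact w z) = (\<Sum>k\<in>UNIV. of_int (cf w i k) * H1.h k z)"
proof (induction w arbitrary: i)
  case Nil
  have "(\<Sum>k\<in>UNIV. of_int (cf [] i k) * H1.h k z) = (\<Sum>k\<in>UNIV. if i = k then H1.h k z else 0)"
    by (intro sum.cong) auto
  then show ?case using assms by simp
next
  case (Cons j w)
  have "de 1 = 3" by (simp add: de_def real_sqrt_unique)
  then have g: "gr 1 i j = of_int (G1 i j)" by (simp add: gram_def be_def cc_def)
  have "H1.h i (H1.wact (j # w) z) = H1.h i (H1.wact w z) - 2 * gr 1 i j * H1.h j (H1.wact w z)"
    using assms by (simp add: H1.wact_Cons H1.h_refl)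
  also have "\<dots> = (\<Sum>k\<in>UNIV. of_int (cf (j # w) i k) * H1.h k z)"
    unfolding Cons g by (simp add: left_diff_distrib sum_subtractf sum_distrib_left mult.assoc)
  finally show ?case .
qed

text \<open>A trivial matrix would leave all heights of the centre unchanged, hence its displacement
  would be 0, against the growth of displacement with word length.\<close>

lemma reduced_cf_nontrivial: "reduced w \<Longrightarrow> w \<noteq> [] \<Longrightarrow> cf w \<noteq> cf []"
proof
  assume w: "reduced w" "w \<noteq> []" and e: "cf w = cf []"
  have "H1.h i (H1.wact w H1.z0) = H1.h i H1.z0" for i
    using h_wact_at_1[OF H1.z0(1), of i w] h_wact_at_1[OF H1.z0(1), of i "[]"] H1.z0(1) by (simp only: e H1.wact_Nil)
  then have "cdist H1.z0 (H1.wact w H1.z0) = cdist H1.z0 H1.z0" by (simp add: H1.cdist_z0)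
  also have "\<dots> = 1" using H1.z0(1) by (simp add: cdist_eq)
  finally have "length w = 0" using H1.displacement_ge[of w] w(1) by simp
  then show False using w(2) by simp
qed

text \<open>For words of bounded length the entries of the integral matrices are smaller than a suitable \<open>m\<close>, so that
  congruence to the identity modulo \<open>m\<close> means equality.\<close>

lemma deep_congruence: "\<exists>m>0. \<forall>w. reduced w \<and> w \<noteq> [] \<and> length w \<le> N \<longrightarrow> \<not> in_ker m w"
proof -
  define d where "d = (\<lambda>(w, i, k). \<bar>cf w i k - cf [] i k\<bar>)"
  define D where "D = d ` ({w. length w \<le> N} \<times> UNIV \<times> UNIV)"
  have D: "finite D" using H1.finite_words[of N] by (simp add: D_def)
  define m where "m = Max (insert 0 D) + 1"
  have "m > 0" unfolding m_def using D Max_ge[of "insert 0 D" 0] by simp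
  moreover have "\<not> in_ker m w" if w: "reduced w" "w \<noteq> []" "length w \<le> N" for w
  proof
    assume k: "in_ker m w"
    have "cf w i k = cf [] i k" for i k
    proof -
      have "m dvd cf w i k - cf [] i k"
        using k unfolding in_ker_def congr_def by (metis mod_eq_dvd_iff)
      moreover have "\<bar>cf w i k - cf [] i k\<bar> < m"
      proof -
        have "d (w, i, k) \<in> D" unfolding D_def using w(3) by (intro imageI) simp
        then have "\<bar>cf w i k - cf [] i k\<bar> \<in> insert 0 D" by (simp add: d_def)
        then show ?thesis unfolding m_def using D Max_ge[of "insert 0 D"] by (simp add: zle_add1_eq_le del: Max_insert)
      qed
      ultimately show ?thesis using zdvd_imp_le[of m "\<bar>cf w i k - cf [] i k\<bar>"] by fastforce
    qed
    then show False using reduced_cf_nontrivial[OF w(1,2)] by (simp add: fun_eq_iff)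
  qed
  ultimately show ?thesis by blast
qed

section \<open>Dependence on the parameter\<close>

lemma continuous_on_matrix_mult:
  fixes f g :: "real \<Rightarrow> real^2^2"
  assumes "continuous_on S f" "continuous_on S g" shows "continuous_on S (\<lambda>x. f x ** g x)"
proof -
  have "f x ** g x = (\<chi> i j. \<Sum>k\<in>UNIV. f x $ i $ k * g x $ k $ j)" for x
    by (simp add: matrix_matrix_mult_def)
  then show ?thesis using assms
    by (auto intro!: continuous_intros)
qed

lemma continuous_on_mat2:
  assumes "continuous_on S a" "continuous_on S b" "continuous_on S c" "continuous_on S d"
  shows "continuous_on S (\<lambda>x. mat2 (a x) (b x) (c x) (d x))"
proof -
  have "mat2 (a x) (b x) (c x) (d x) = (\<chi> i j. if i = 1 then if j = 1 then a x else b x else if j = 1 then c x else d x)" for x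
    by (simp add: vec_eq_iff forall_2)
  moreover have "continuous_on S (\<lambda>x. if i = (1::2) then if j = (1::2) then a x else b x else if j = 1 then c x else d x)" for i j
    using assms by (cases "i = 1"; cases "j = 1") auto
  ultimately show ?thesis by (auto intro!: continuous_on_vec_lambda)
qed

lemma continuous_on_parameters:
  "continuous_on {0<..} be" "continuous_on {0<..} cc" "continuous_on {0<..} ka" "continuous_on {0<..} tau" "continuous_on {0<..} de"
  unfolding be_def[abs_def] cc_def[abs_def] ka_def[abs_def] tau_def[abs_def] de_def[abs_def]
  by (auto intro!: continuous_intros)

lemma continuous_on_Mx: "continuous_on {0<..} (\<lambda>u. Mx u i)"
proof -
  have t: "tau u \<noteq> 0" "de u \<noteq> 0" if "u \<in> {0<..}" for u
    using that hexagon.tau(1)[of u] hexagon.de(1)[of u] by (auto simp: hexagon_def)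
  have A: "continuous_on {0<..} (\<lambda>u. Mx u i)" if "isA i" for i
    using that t by (cases i) (auto simp: Mx.simps intro!: continuous_on_mat2 continuous_intros continuous_on_parameters)
  show ?thesis
    using A t by (cases i) (auto simp: Mx.simps(4-6) simp del: Mx.simps(1-3) intro!: continuous_intros continuous_on_parameters)
qed

lemma continuous_on_trace_wm: "continuous_on {0<..} (\<lambda>u. \<bar>trace (hexagon.wm u w)\<bar>)"
proof -
  have "continuous_on {0<..} (\<lambda>u. foldr (\<lambda>i A. Mx u i ** A) w (mat 1))"
    by (induction w) (auto intro!: continuous_on_matrix_mult continuous_on_Mx)
  then have "continuous_on {0<..} (\<lambda>u. \<bar>trace (foldr (\<lambda>i A. Mx u i ** A) w (mat 1 :: real^2^2))\<bar>)"
    unfolding trace_def by (intro continuous_intros)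
  then show ?thesis
    by (rule continuous_on_eq) (simp add: hexagon.wm_def hexagon_def)
qed

no_notation Finite_Cartesian_Product.vec.vec_nth (infixl "$" 90)
notation Matrix.vec_index (infixl "$" 100)

section \<open>Real cyclotomic numbers\<close>

interpretation RR: ring real_ring by (rule ring_from_type_algebra)

lemma field_RR: "field real_ring" by (rule field_from_type_algebra)

lemma domain_RR: "domain real_ring" by (rule field.axioms(1)[OF field_RR])

lemmas field_facts =
  field.generate_field_is_subfield[OF field_RR] field.generate_field_min_subfield1[OF field_RR]
  domain.simple_extension_is_subring[OF domain_RR] domain.simple_extension_is_subfield[OF domain_RR]
  domain.finite_dimension_simple_extension[OF domain_RR]

lemma RR_simps [simp]:
  "carrier real_ring = UNIV" "mult real_ring = (*)" "add real_ring = (+)"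
  "one real_ring = 1" "zero real_ring = 0"
  by (simp_all add: ring_of_type_algebra_def)

lemma RR_a_inv [simp]: "a_inv real_ring x = - x"
  by (rule RR.minus_equality) auto

lemma RR_inv: "x \<noteq> 0 \<Longrightarrow> m_inv real_ring x = inverse x"
  by (rule RR.inv_unique'[symmetric]) auto

lemma subring_Ints: "subring \<int> real_ring"
  by (rule RR.subringI) auto

lemma subfield_Rats: "subfield \<rat> real_ring"
proof (rule field.subfieldI'[OF field_RR])
  show "subring \<rat> real_ring" by (rule RR.subringI) auto
qed (auto simp: RR_inv)

abbreviation "ZZ_ext \<equiv> ring.simple_extension real_ring \<int>"
abbreviation "QQ_ext \<equiv> ring.simple_extension real_ring \<rat>"

lemma ZZ_ext_closed:
  "x \<in> ZZ_ext a \<Longrightarrow> y \<in> ZZ_ext a \<Longrightarrow> x + y \<in> ZZ_ext a"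
  "x \<in> ZZ_ext a \<Longrightarrow> y \<in> ZZ_ext a \<Longrightarrow> x * y \<in> ZZ_ext a"
  "x \<in> ZZ_ext a \<Longrightarrow> - x \<in> ZZ_ext a"
  "1 \<in> ZZ_ext a" "0 \<in> ZZ_ext a" "a \<in> ZZ_ext a" "of_int k \<in> ZZ_ext a"
proof -
  have s: "subring (ZZ_ext a) real_ring" by (rule field_facts(3)[OF subring_Ints]) simp
  show "x \<in> ZZ_ext a \<Longrightarrow> y \<in> ZZ_ext a \<Longrightarrow> x + y \<in> ZZ_ext a"
    "x \<in> ZZ_ext a \<Longrightarrow> y \<in> ZZ_ext a \<Longrightarrow> x * y \<in> ZZ_ext a"
    "x \<in> ZZ_ext a \<Longrightarrow> - x \<in> ZZ_ext a" "1 \<in> ZZ_ext a" "0 \<in> ZZ_ext a"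
    using subringE(2,3,5,6,7)[OF s] by auto
  show "a \<in> ZZ_ext a" by (rule RR.simple_extension_mem[OF subring_Ints]) simp
  show "of_int k \<in> ZZ_ext a" using RR.simple_extension_incl[of \<int> a] by auto
qed

lemma ZZ_ext_subset_QQ_ext: "ZZ_ext a \<subseteq> QQ_ext a"
  by (rule RR.mono_simple_extension) (auto simp: Ints_def)

text \<open>Multiplication by \<open>x \<in> \<int>[2 cos \<theta>]\<close>, where \<open>n\<theta>\<close> is a multiple of \<open>2\<pi>\<close>, is represented by a circulant
  symmetric matrix with entries \<open>g (i - k)\<close> and eigenvector \<open>cos (i\<theta>)\<close>.\<close>

definition represents :: "nat \<Rightarrow> real \<Rightarrow> ('a \<Rightarrow> real) \<Rightarrow> (int \<Rightarrow> 'a) \<Rightarrow> real \<Rightarrow> bool" where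
  "represents n t hm g x \<longleftrightarrow> (\<forall>k. g (k + int n) = g k) \<and> (\<forall>k. g (- k) = g k) \<and>
     (\<forall>i. (\<Sum>k<n. hm (g (i - int k)) * cos (of_nat k * t)) = x * cos (of_int i * t))"

lemma cos_mod:
  fixes t :: real
  assumes "cos (of_nat n * t) = 1"
  shows "cos (of_int (i mod int n) * t) = cos (of_int i * t)"
proof -
  have s: "sin (of_nat n * t) = 0" using sin_cos_squared_add[of "of_nat n * t"] assms by simp
  have per: "cos (x + of_int k * (of_nat n * t)) = cos x \<and> sin (x + of_int k * (of_nat n * t)) = sin x" for x k
  proof (induction k rule: int_induct[where k = 0])
    case (step1 k)
    have "x + of_int (k + 1) * (of_nat n * t) = (x + of_int k * (of_nat n * t)) + of_nat n * t" by (simp add: distrib_right)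
    then show ?case using step1 assms s by (simp only: cos_add sin_add) simp
  next
    case (step2 k)
    have "x + of_int (k - 1) * (of_nat n * t) = (x + of_int k * (of_nat n * t)) - of_nat n * t" by (simp add: left_diff_distrib)
    then show ?case using step2 assms s by (simp only: cos_diff sin_diff) simp
  qed simp
  have "of_int i * t = of_int (i mod int n) * t + of_int (i div int n) * (of_nat n * t)"
  proof -
    have "(of_int i :: real) = of_int (i mod int n + i div int n * int n)" by (simp only: mod_div_mult_eq)
    also have "\<dots> = of_int (i mod int n) + of_int (i div int n) * of_nat n"
      by (simp only: of_int_add of_int_mult of_int_of_nat_eq)
    finally have "of_int i * t = (of_int (i mod int n) + of_int (i div int n) * of_nat n) * t" by (rule arg_cong)
    then show ?thesis by (simp only: distrib_right mult.assoc)
  qed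
  then show ?thesis using per by simp
qed

text \<open>Elements of the extension are built by Horner steps
  \<open>k1 * (2 * cos t) + k2\<close>. The map \<open>hm\<close> covers integer coefficients for
  integrality and rational ones for total reality.\<close>

lemma simple_extension_represented:
  fixes hm :: "'a::comm_ring_1 \<Rightarrow> real"
  assumes hm: "comm_ring_hom hm" and n: "n > 0" "cos (of_nat n * t) = 1"
    and x: "x \<in> ring.simple_extension real_ring (range hm) (2 * cos t)"
  shows "\<exists>g. represents n t hm g x"
  using x
proof (induction rule: RR.simple_extension.induct)
  interpret comm_ring_hom hm by fact
  case zero
  have "represents n t hm (\<lambda>_. 0) 0" by (simp add: represents_def)
  then show ?case by auto
next
  interpret comm_ring_hom hm by fact
  case (lin k1 k2)
  then obtain g q where g: "represents n t hm g k1" and q: "k2 = hm q" by auto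
  \<comment> \<open>Multiplication by \<open>2 * cos t\<close> adds the two neighbouring shifts, by
    the product formula for cosines; the constant \<open>q\<close> sits on the diagonal modulo
    \<open>n\<close>.\<close>
  define g' where "g' = (\<lambda>k. g (k + 1) + g (k - 1) + (if int n dvd k then q else 0))"
  have gp: "g (k + int n) = g k" "g (- k) = g k" for k using g by (auto simp: represents_def)
  have "g' (k + int n) = g' k" for k
    using gp(1)[of "k + 1"] gp(1)[of "k - 1"] by (simp add: g'_def algebra_simps)
  moreover have "g' (- k) = g' k" for k
  proof -
    have e: "- k + 1 = - (k - 1)" "- k - 1 = - (k + 1)" by simp_all
    show ?thesis unfolding g'_def e gp(2) by (simp add: add.commute)
  qed
  moreover have "(\<Sum>k<n. hm (g' (i - int k)) * cos (of_nat k * t)) = (2 * cos t * k1 + k2) * cos (of_int i * t)" for i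
  proof -
    have sh: "(\<Sum>k<n. hm (g (j - int k)) * cos (of_nat k * t)) = k1 * cos (of_int j * t)" for j
      using g by (auto simp: represents_def)
    have "(\<Sum>k<n. hm (if int n dvd (i - int k) then q else 0) * cos (of_nat k * t)) = k2 * cos (of_int i * t)"
    proof -
      define k0 where "k0 = nat (i mod int n)"
      have k0: "k0 < n" "int k0 = i mod int n" using n(1) by (simp_all add: k0_def nat_less_iff)
      have "int n dvd (i - int k) \<longleftrightarrow> k = k0" if "k < n" for k
        using that k0 by (metis mod_eq_dvd_iff mod_pos_pos_trivial of_nat_0_le_iff of_nat_eq_iff of_nat_less_iff)
      then have "(\<Sum>k<n. hm (if int n dvd (i - int k) then q else 0) * cos (of_nat k * t)) =
          (\<Sum>k<n. if k = k0 then k2 * cos (of_nat k * t) else 0)"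
        by (intro sum.cong) (auto simp: q)
      also have "\<dots> = k2 * cos (of_nat k0 * t)" using k0(1) by simp
      also have "cos (of_nat k0 * t) = cos (of_int i * t)"
        using cos_mod[OF n(2), of i] by (simp flip: k0(2))
      finally show ?thesis .
    qed
    note e3 = this
    have e: "(\<Sum>k<n. hm (g' (i - int k)) * cos (of_nat k * t)) =
        (\<Sum>k<n. hm (g (i + 1 - int k)) * cos (of_nat k * t)) +
        (\<Sum>k<n. hm (g (i - 1 - int k)) * cos (of_nat k * t)) +
        (\<Sum>k<n. hm (if int n dvd (i - int k) then q else 0) * cos (of_nat k * t))"
      by (simp add: g'_def hom_add distrib_right sum.distrib algebra_simps)
    have c2: "cos (of_int (i + 1) * t) + cos (of_int (i - 1) * t) = 2 * cos t * cos (of_int i * t)"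
      by (simp add: distrib_right left_diff_distrib cos_add cos_diff)
    have e4: "k1 * cos (of_int (i + 1) * t) + k1 * cos (of_int (i - 1) * t) = k1 * (2 * cos t * cos (of_int i * t))"
      unfolding distrib_left[symmetric] c2 ..
    have "k1 * (2 * cos t * cos (of_int i * t)) + k2 * cos (of_int i * t) = (2 * cos t * k1 + k2) * cos (of_int i * t)"
      by (simp add: distrib_right)
    then show ?thesis unfolding e sh e3 e4 .
  qed
  ultimately have "represents n t hm g' (2 * cos t * k1 + k2)" by (simp add: represents_def)
  then show ?case by (auto simp: mult.commute)
qed

text \<open>The vector with entries \<open>cos (of_nat k * t)\<close> is an eigenvector for
  \<open>x\<close>, nonzero because its first entry is 1.\<close>

lemma represented_char_poly:
  fixes hm :: "'a::comm_ring_1 \<Rightarrow> real"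
  assumes hm: "comm_ring_hom hm" and n: "n > 0" and g: "represents n t hm g x"
  shows "poly (map_poly hm (char_poly (Matrix.mat n n (\<lambda>(i, k). g (int i - int k))))) x = 0"
proof -
  interpret comm_ring_hom hm by fact
  define N where "N = Matrix.mat n n (\<lambda>(i, k). g (int i - int k))"
  have N: "N \<in> carrier_mat n n" by (simp add: N_def)
  define v where "v = Matrix.vec n (\<lambda>k. cos (of_nat k * t))"
  have "map_mat hm N *\<^sub>v v = x \<cdot>\<^sub>v v"
  proof (rule eq_vecI)
    fix i assume "i < dim_vec (x \<cdot>\<^sub>v v)"
    then have i: "i < n" by (simp add: v_def)
    have "(map_mat hm N *\<^sub>v v) $ i = (\<Sum>k<n. hm (g (int i - int k)) * cos (of_nat k * t))"
      using i by (simp add: N_def v_def scalar_prod_def lessThan_atLeast0)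
    also have "\<dots> = x * cos (of_nat i * t)" using g by (simp add: represents_def)
    finally show "(map_mat hm N *\<^sub>v v) $ i = (x \<cdot>\<^sub>v v) $ i" using i by (simp add: v_def)
  qed (simp add: N_def v_def)
  moreover have "v \<noteq> 0\<^sub>v n"
  proof
    assume "v = 0\<^sub>v n"
    then have "v $ 0 = 0" using n by simp
    then show False using n by (simp add: v_def)
  qed
  ultimately have "eigenvalue (map_mat hm N) x"
    using N by (auto simp: eigenvalue_def eigenvector_def v_def intro!: exI[of _ v])
  then have "poly (char_poly (map_mat hm N)) x = 0"
    using eigenvalue_root_char_poly[of "map_mat hm N" n x] N by simp
  then show ?thesis by (simp add: char_poly_hom[OF N] flip: N_def)
qed

lemma range_of_int: "range (of_int :: int \<Rightarrow> real) = \<int>" and range_of_rat: "range (of_rat :: rat \<Rightarrow> real) = \<rat>"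
  by (simp_all add: Ints_def Rats_def)

lemma comm_ring_hom_of_int: "comm_ring_hom (of_int :: int \<Rightarrow> real)"
  by standard auto

lemma comm_ring_hom_of_rat: "comm_ring_hom (of_rat :: rat \<Rightarrow> 'a :: field_char_0)"
  by standard (auto simp: of_rat_add of_rat_mult)

lemma algebraic_int_of_cyclotomic:
  assumes n: "n > 0" "cos (of_nat n * t) = 1" and x: "x \<in> ZZ_ext (2 * cos t)"
  shows "algebraic_int x"
proof -
  obtain g :: "int \<Rightarrow> int" where g: "represents n t of_int g x"
    using simple_extension_represented[OF comm_ring_hom_of_int n, of x] x by (auto simp: range_of_int)
  define N where "N = Matrix.mat n n (\<lambda>(i, k). g (int i - int k))"
  have "Polynomial.degree (char_poly N) = n \<and> Polynomial.coeff (char_poly N) n = 1"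
    by (rule degree_monic_char_poly) (simp add: N_def)
  then have "Polynomial.lead_coeff (char_poly N) = 1" by simp
  moreover have "poly (map_poly of_int (char_poly N)) x = 0"
    unfolding N_def by (rule represented_char_poly[OF comm_ring_hom_of_int n(1) g])
  ultimately show ?thesis unfolding algebraic_int_altdef_ipoly by blast
qed

text \<open>Applied to the image of an element under a field embedding, which is a root of the same
  rational characteristic polynomial as the element.\<close>

lemma symmetric_eigenvalue_real:
  fixes g :: "int \<Rightarrow> rat"
  assumes sym: "\<And>k. g (- k) = g k"
    and z: "poly (map_poly of_rat (char_poly (Matrix.mat n n (\<lambda>(i, k). g (int i - int k))))) (z::complex) = 0"
  shows "z \<in> \<real>"
proof -
  interpret comm_ring_hom "of_rat :: rat \<Rightarrow> complex" by (rule comm_ring_hom_of_rat)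
  define N where "N = Matrix.mat n n (\<lambda>(i, k). g (int i - int k))"
  have N: "N \<in> carrier_mat n n" by (simp add: N_def)
  have "poly (char_poly (map_mat of_rat N)) z = 0" using z by (simp add: comm_ring_hom.char_poly_hom[OF comm_ring_hom_of_rat N] flip: N_def)
  then have "eigenvalue (map_mat of_rat N) z"
    using eigenvalue_root_char_poly[of "map_mat of_rat N" n z] N by simp
  then obtain w where w: "w \<in> carrier_vec n" "w \<noteq> 0\<^sub>v n" "map_mat of_rat N *\<^sub>v w = z \<cdot>\<^sub>v w"
    using N by (auto simp: eigenvalue_def eigenvector_def)
  define a where "a = (\<lambda>i k. of_rat (g (int i - int k)) :: complex)"
  have row: "(\<Sum>k<n. a i k * w $ k) = z * w $ i" if i: "i < n" for i
  proof -
    have "(map_mat of_rat N *\<^sub>v w) $ i = (z \<cdot>\<^sub>v w) $ i" using w(3) by simp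
    then show ?thesis using i w(1) by (simp add: N_def a_def scalar_prod_def lessThan_atLeast0)
  qed
  have a: "a i k = a k i" "cnj (a i k) = a i k" for i k
  proof -
    show "a i k = a k i" using sym[of "int i - int k"] by (simp add: a_def)
    show "cnj (a i k) = a i k" unfolding a_def
      by (cases "g (int i - int k)") (simp add: of_rat_rat)
  qed
  \<comment> \<open>The Hermitian form at the eigenvector: real because the matrix is real and
    symmetric, and equal to \<open>z\<close> times the squared norm.\<close>
  define H where "H = (\<Sum>i<n. \<Sum>k<n. cnj (w $ i) * a i k * w $ k)"
  have "cnj H = (\<Sum>i<n. \<Sum>k<n. cnj (w $ k) * a k i * w $ i)"
    by (simp add: H_def a mult_ac)
  also have "\<dots> = H" unfolding H_def by (rule sum.swap)
  finally have "H \<in> \<real>" by (simp add: Reals_cnj_iff)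
  moreover have "H = z * of_real (\<Sum>i<n. (cmod (w $ i))\<^sup>2)"
  proof -
    have "H = (\<Sum>i<n. cnj (w $ i) * (\<Sum>k<n. a i k * w $ k))"
      by (simp add: H_def sum_distrib_left mult.assoc)
    also have "\<dots> = (\<Sum>i<n. z * (w $ i * cnj (w $ i)))" 
    proof (intro sum.cong refl)
      fix i assume "i \<in> {..<n}"
      then have "(\<Sum>k<n. a i k * w $ k) = z * w $ i" by (intro row) simp
      then show "cnj (w $ i) * (\<Sum>k<n. a i k * w $ k) = z * (w $ i * cnj (w $ i))" by (simp only: mult_ac)
    qed
    also have "\<dots> = z * of_real (\<Sum>i<n. (cmod (w $ i))\<^sup>2)"
      by (simp add: sum_distrib_left complex_norm_square del: of_real_power)
    finally show ?thesis .
  qed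
  moreover have "(\<Sum>i<n. (cmod (w $ i))\<^sup>2) \<noteq> 0"
  proof
    assume "(\<Sum>i<n. (cmod (w $ i))\<^sup>2) = 0"
    then have "\<forall>i<n. w $ i = 0" by (subst (asm) sum_nonneg_eq_0_iff) auto
    then have "w = 0\<^sub>v n" using w(1) by (intro eq_vecI) auto
    then show False using w(2) by simp
  qed
  ultimately obtain S where "H = z * of_real S" "S \<noteq> 0" by blast
  then have "z = H / of_real S" by simp
  then show ?thesis using \<open>H \<in> \<real>\<close> by (metis Reals_divide Reals_of_real)
qed

text \<open>Polynomials of HOL-Algebra are lists beginning with the leading coefficient, whereas
  \<open>coeffs\<close> ends with it.\<close>

lemma eval_rev_coeffs: "RR.eval (rev (coeffs p)) x = poly p x"
proof (induction p)
  case (pCons a p)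
  have ev: "RR.eval (xs @ [a]) x = RR.eval xs x * x + a" for xs
    by (induction xs) (simp_all add: algebra_simps)
  show ?case
  proof (cases "pCons a p = 0")
    case False
    then have "coeffs (pCons a p) = a # coeffs p" by (metis cCons_def coeffs_pCons_eq_cCons pCons_eq_0_iff coeffs_eq_Nil not_0_cCons_eq cCons_not_0_eq)
    then show ?thesis using pCons ev by simp
  qed simp
qed simp

lemma algebraic_over_Rats:
  fixes p :: "rat poly"
  assumes "p \<noteq> 0" "poly (map_poly of_rat p) x = 0"
  shows "RR.algebraic \<rat> x"
proof -
  define q where "q = map_poly (of_rat :: rat \<Rightarrow> real) p"
  have q: "q \<noteq> 0" using assms(1) by (simp add: q_def map_poly_eq_0_iff)
  have "rev (coeffs q) \<noteq> []" using q by simp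
  moreover have "set (rev (coeffs q)) \<subseteq> \<rat>"
    by (auto simp: q_def coeffs_map_poly)
  moreover have "hd (rev (coeffs q)) \<noteq> 0" using q by (simp add: hd_rev last_coeffs_eq_coeff_degree)
  ultimately have "rev (coeffs q) \<in> carrier (univ_poly real_ring \<rat>)"
    by (simp add: univ_poly_def polynomial_def)
  then show ?thesis
    using \<open>rev (coeffs q) \<noteq> []\<close> unfolding over_def
    by (rule RR.algebraicI[unfolded over_def]) (unfold eval_rev_coeffs, use assms(2) in \<open>simp add: q_def\<close>)
qed

text \<open>An embedding \<open>\<sigma>\<close> is given on the subfield \<open>K\<close> only. It
  need not be extended to the cyclotomic field: each \<open>x\<close> in \<open>K\<close> has a
  symmetric matrix of its own, and \<open>\<sigma> x\<close> is a root of its characteristic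
  polynomial.\<close>

lemma totally_real_of_cyclotomic:
  assumes n: "n > 0" "cos (of_nat n * t) = 1" and T: "T \<subseteq> ZZ_ext (2 * cos t)"
  shows "totally_real_number_field (generate_field real_ring T)"
proof -
  define K where "K = generate_field real_ring T"
  have K: "subfield K real_ring" unfolding K_def by (rule field_facts(1)) simp
  let ?u = "2 * cos t"
  have rep: "\<exists>g :: int \<Rightarrow> rat. represents n t of_rat g x" if "x \<in> QQ_ext ?u" for x
    using simple_extension_represented[OF comm_ring_hom_of_rat n, of x] that by (simp add: range_of_rat)
  have alg: "RR.algebraic \<rat> ?u"
  proof -
    have "?u \<in> QQ_ext ?u" using ZZ_ext_closed(6) ZZ_ext_subset_QQ_ext by blast
    then obtain g :: "int \<Rightarrow> rat" where g: "represents n t of_rat g ?u" using rep by blast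
    define N where "N = Matrix.mat n n (\<lambda>(i, k). g (int i - int k))"
    have "Polynomial.coeff (char_poly N) n = 1" using degree_monic_char_poly[of N n] by (simp add: N_def)
    then have "char_poly N \<noteq> 0" by auto
    moreover have "poly (map_poly of_rat (char_poly N)) ?u = 0"
      unfolding N_def by (rule represented_char_poly[OF comm_ring_hom_of_rat n(1) g])
    ultimately show ?thesis by (rule algebraic_over_Rats)
  qed
  have F: "subfield (QQ_ext ?u) real_ring"
    using field_facts(4)[OF subfield_Rats, of ?u] alg by (simp add: over_def)
  have KF: "K \<subseteq> QQ_ext ?u" unfolding K_def
    using T ZZ_ext_subset_QQ_ext by (intro field_facts(2)[OF _ F]) auto
  have fin: "RR.finite_dimension \<rat> (QQ_ext ?u)"
    using field_facts(5)[OF subfield_Rats, of ?u] alg by (simp add: over_def)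
  have Ksr: "subring K real_ring" using K by (rule subfieldE(1))
  have Kc: "1 \<in> K" "0 \<in> K" "\<And>x y. x \<in> K \<Longrightarrow> y \<in> K \<Longrightarrow> x + y \<in> K" "\<And>x y. x \<in> K \<Longrightarrow> y \<in> K \<Longrightarrow> x * y \<in> K"
    "\<And>x. x \<in> K \<Longrightarrow> - x \<in> K"
    using subringE[OF Ksr] by auto
  have Kinv: "inverse x \<in> K" if "x \<in> K" for x
  proof (cases "x = 0")
    case False
    then have "m_inv real_ring x \<in> K" using RR.subfield_m_inv(1)[OF K, of x] that by simp
    then show ?thesis using False by (simp add: RR_inv)
  qed (use that in simp)
  have Kint: "of_int k \<in> K" for k
  proof (induction k rule: int_induct[where k = 0])
    case (step2 i)
    have "of_int i + (- 1) \<in> K" using step2 Kc by blast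
    then show ?case by simp
  qed (use Kc in auto)
  have Krat: "of_rat q \<in> K" for q
  proof -
    obtain a b where "q = of_int a / of_int b" by (metis Fract_of_int_quotient Rat_cases)
    then have "(of_rat q :: real) = of_int a * inverse (of_int b)" by (simp add: of_rat_divide divide_inverse[of "of_int a :: real"])
    then show ?thesis using Kc(4) Kinv Kint by simp
  qed
  have "subalgebra \<rat> K real_ring"
  proof (rule subalgebra.intro)
    show "subgroup K (add_monoid real_ring)" using subring.axioms(1)[OF Ksr] .
    show "subalgebra_axioms \<rat> K real_ring"
      by standard (auto elim!: Rats_cases intro!: Kc Krat)
  qed
  then have "RR.finite_dimension \<rat> K"
    using RR.subalbegra_incl_imp_finite_dimension[OF subfield_Rats fin] KF by blast
  moreover have "\<sigma> ` K \<subseteq> \<real>" if \<sigma>: "\<sigma> \<in> Ring.ring_hom (real_ring\<lparr>carrier := K\<rparr>) complex_ring" for \<sigma>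
  proof
    have h: "\<sigma> 1 = 1" "\<And>x y. x \<in> K \<Longrightarrow> y \<in> K \<Longrightarrow> \<sigma> (x + y) = \<sigma> x + \<sigma> y"
      "\<And>x y. x \<in> K \<Longrightarrow> y \<in> K \<Longrightarrow> \<sigma> (x * y) = \<sigma> x * \<sigma> y"
      using \<sigma> unfolding Ring.ring_hom_def by (auto simp: ring_of_type_algebra_def)
    have h0: "\<sigma> 0 = 0" using h(2)[of 0 0] Kc by simp
    have hneg: "\<sigma> (- x) = - \<sigma> x" if "x \<in> K" for x
      using h(2)[of x "- x"] h0 Kc(5) that by (simp add: eq_neg_iff_add_eq_0 add.commute)
    have hint: "\<sigma> (of_int k) = of_int k" for k
    proof (induction k rule: int_induct[where k = 0])
      case (step1 i) then show ?case using h(1) h(2)[of "of_int i" 1] Kint Kc by simp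
    next
      case (step2 i) then show ?case using h(1) h(2)[of "of_int i" "- 1"] hneg[of 1] Kint Kc by simp
    qed (simp add: h0)
    have hrat: "\<sigma> (of_rat q) = of_rat q" for q
    proof -
      obtain a b where q: "q = of_int a / of_int b" "b \<noteq> 0"
        by (metis Fract_of_int_quotient Rat_cases less_irrefl)
      have "of_rat q * of_int b = (of_int a :: real)" using q by (simp add: of_rat_divide)
      then have "\<sigma> (of_rat q) * of_int b = of_int a" using h(3)[of "of_rat q" "of_int b"] Krat Kint hint by simp
      then have "\<sigma> (of_rat q) = of_int a / of_int b" using q(2) by (simp add: field_simps)
      then show ?thesis using q by (simp add: of_rat_divide)
    qed
    have hpoly: "poly (map_poly of_rat p) x \<in> K \<and> \<sigma> (poly (map_poly of_rat p) x) = poly (map_poly of_rat p) (\<sigma> x)"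
      if x: "x \<in> K" for x p
    proof (induction p)
      case 0 then show ?case using h0 Kc by simp
    next
      case (pCons a p)
      then show ?case using x Krat Kc h hrat by (simp add: map_poly_pCons)
    qed
    fix y assume "y \<in> \<sigma> ` K"
    then obtain x where x: "x \<in> K" "y = \<sigma> x" by auto
    obtain g :: "int \<Rightarrow> rat" where g: "represents n t of_rat g x" using rep KF x by blast
    have "poly (map_poly of_rat (char_poly (Matrix.mat n n (\<lambda>(i, k). g (int i - int k))))) x = 0"
      by (rule represented_char_poly[OF comm_ring_hom_of_rat n(1) g])
    then have "poly (map_poly of_rat (char_poly (Matrix.mat n n (\<lambda>(i, k). g (int i - int k))))) (\<sigma> x) = 0"
      using hpoly[OF x(1)] h0 by metis
    then show "y \<in> \<real>" unfolding x(2)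
      by (rule symmetric_eigenvalue_real[rotated]) (use g in \<open>simp add: represents_def\<close>)
  qed
  ultimately show ?thesis using K unfolding totally_real_number_field_def K_def by blast
qed

text \<open>For odd \<open>n\<close> the number \<open>2 cos \<theta>\<close> is a unit, as \<open>sin (m\<cdot>2\<theta>) = sin \<theta>\<close> for \<open>m = (n + 1) / 2\<close>.\<close>

lemma cyclotomic_unit:
  fixes t :: real
  assumes n: "odd n" "cos (of_nat n * t) = 1" and nz: "sin t \<noteq> 0" "cos t \<noteq> 0"
  shows "1 / (2 * cos t) \<in> ZZ_ext (2 * cos t)"
proof -
  let ?u = "2 * cos t"
  have s2: "sin (2 * t) = ?u * sin t" by (simp add: sin_double)
  \<comment> \<open>These quotients are Chebyshev polynomials of the second kind, whose recurrence
    has the coefficient \<open>2 * cos (2 * t) = ?u * ?u - 2\<close>.\<close>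
  have "sin (of_nat k * (2 * t)) / sin (2 * t) \<in> ZZ_ext ?u" for k
  proof (induction k rule: induct_nat_012)
    case 0 show ?case by (simp add: ZZ_ext_closed)
  next
    case 1 show ?case using nz s2 by (simp add: ZZ_ext_closed)
  next
    case (ge2 k)
    have c: "2 * cos (2 * t) = ?u * ?u + of_int (- 2)"
      by (simp add: cos_double_cos power2_eq_square)
    have "sin (of_nat (Suc (Suc k)) * (2 * t)) = 2 * cos (2 * t) * sin (of_nat (Suc k) * (2 * t)) + - sin (of_nat k * (2 * t))"
      using sin_add[of "of_nat (Suc k) * (2 * t)" "2 * t"] sin_diff[of "of_nat (Suc k) * (2 * t)" "2 * t"]
      by (simp add: algebra_simps)
    then have "sin (of_nat (Suc (Suc k)) * (2 * t)) / sin (2 * t) =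
        (?u * ?u + of_int (- 2)) * (sin (of_nat (Suc k) * (2 * t)) / sin (2 * t)) + - (sin (of_nat k * (2 * t)) / sin (2 * t))"
      unfolding c by (simp add: add_divide_distrib diff_divide_distrib)
    moreover have "\<dots> \<in> ZZ_ext ?u" using ge2 by (intro ZZ_ext_closed)
    ultimately show ?case by simp
  qed
  from this[of "(n + 1) div 2"]
  have "sin (of_nat ((n + 1) div 2) * (2 * t)) / sin (2 * t) \<in> ZZ_ext ?u" .
  moreover have "of_nat ((n + 1) div 2) * (2 * t) = of_nat n * t + t"
  proof -
    obtain k where "n = 2 * k + 1" using n(1) by (rule oddE)
    then show ?thesis by (simp add: algebra_simps)
  qed
  moreover have "sin (of_nat n * t) = 0"
    using sin_cos_squared_add[of "of_nat n * t"] n(2) by simp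
  ultimately have "sin t / sin (2 * t) \<in> ZZ_ext ?u" using n(2) by (simp add: sin_add)
  then show ?thesis using nz s2 by simp
qed

section \<open>Density\<close>

context hexagon
begin

lemma semi_arithmetic_Gam:
  assumes "u \<le> 1" "m > 0" and n: "odd n" "cos (of_nat n * t) = 1" and ut: "u = 2 * cos t"
  shows "semi_arithmetic (Gam m)"
proof -
  interpret S: surface_group "Gam m" z0 by (rule surface_group_Gam[OF assms(1,2)])
  have n0: "n > 0" using n(1) by (rule odd_pos)
  have "sin t \<noteq> 0"
  proof
    assume "sin t = 0"
    then have "(cos t)\<^sup>2 = 1" using sin_cos_squared_add[of t] by simp
    moreover have "\<bar>cos t\<bar> < 1" using u assms(1) ut by linarith
    ultimately show False using abs_square_less_1[of "cos t"] by simp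
  qed
  then have inv: "1 / u \<in> ZZ_ext u" using cyclotomic_unit[OF n] u ut by simp
  have tr: "\<bar>trace (wm w)\<bar> \<in> ZZ_ext u" if "in_ker m w" for w
  proof -
    have par: "be u \<in> ZZ_ext u" "cc u \<in> ZZ_ext u"
      using inv ZZ_ext_closed(1)[OF ZZ_ext_closed(4) inv] ZZ_ext_closed(1)[OF ZZ_ext_closed(4) ZZ_ext_closed(6)]
      by (simp_all add: be_def cc_def)
    then have "cc u * be u \<in> ZZ_ext u" by (rule ZZ_ext_closed(2)[rotated])
    then have "(cc u * be u + cc u * be u) + 1 \<in> ZZ_ext u" using ZZ_ext_closed(1,4) by blast
    then have "(de u)\<^sup>2 \<in> ZZ_ext u" by (simp add: de(2) mult_ac)
    then have "trace (wm w) \<in> ZZ_ext u"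
      using par in_ker_even[OF that] by (intro trace_in_ring ZZ_ext_closed)
    then show ?thesis using ZZ_ext_closed(3) by (cases "trace (wm w) \<ge> 0") simp_all
  qed
  have sub: "psl_trace ` square_subgroup (Gam m) \<subseteq> ZZ_ext (2 * cos t)"
  proof (intro image_subsetI)
    fix \<gamma> assume "\<gamma> \<in> square_subgroup (Gam m)"
    then have "\<gamma> \<in> Gam m" using square_subgroup_subset by blast
    then obtain w where "in_ker m w" "\<gamma> = coset w" by (auto simp: Gam_def)
    then show "psl_trace \<gamma> \<in> ZZ_ext (2 * cos t)" using tr by (simp add: coset_trace flip: ut)
  qed
  have "psl_trace \<gamma> \<in> ring_of_integers (invariant_trace_field (Gam m))" if "\<gamma> \<in> square_subgroup (Gam m)" for \<gamma>
  proof -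
    have "psl_trace \<gamma> \<in> invariant_trace_field (Gam m)"
      unfolding invariant_trace_field_def using that by (intro generate_field.incl imageI)
    moreover have "algebraic_int (psl_trace \<gamma>)"
      using that sub by (intro algebraic_int_of_cyclotomic[OF n0 n(2)]) auto
    ultimately show ?thesis by (simp add: ring_of_integers_def)
  qed
  then show ?thesis
    using S.cofinite totally_real_of_cyclotomic[OF n0 n(2) sub]
    by (simp add: semi_arithmetic_def invariant_trace_field_def)
qed

end

text \<open>The candidates for the systole. The set does not depend on \<open>u\<close>; only their
  matrices do, continuously.\<close>

definition words :: "int \<Rightarrow> nat \<Rightarrow> side list set" where
  "words m N = {w. reduced w \<and> in_ker m w \<and> w \<noteq> [] \<and> length w \<le> N}"

lemma finite_words': "finite (words m N)"
  by (rule finite_subset[OF _ H1.finite_words[of N]]) (auto simp: words_def)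

definition min_trace :: "side list set \<Rightarrow> real \<Rightarrow> real" where
  "min_trace W u = Min ((\<lambda>w. \<bar>trace (hexagon.wm u w)\<bar>) ` W)"

lemma min_trace_le: "finite W \<Longrightarrow> w \<in> W \<Longrightarrow> min_trace W u \<le> \<bar>trace (hexagon.wm u w)\<bar>"
  by (simp add: min_trace_def)

lemma min_trace_attained:
  assumes "finite W" "W \<noteq> {}" obtains w where "w \<in> W" "\<bar>trace (hexagon.wm u w)\<bar> = min_trace W u"
proof -
  have "min_trace W u \<in> (\<lambda>w. \<bar>trace (hexagon.wm u w)\<bar>) ` W"
    unfolding min_trace_def using assms by (intro Min_in) auto
  then show ?thesis using that by force
qed

lemma continuous_on_min_trace:
  assumes "finite W" "W \<noteq> {}" shows "continuous_on {0<..} (min_trace W)"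
  using assms
proof (induction W rule: finite_ne_induct)
  case (singleton w)
  show ?case unfolding min_trace_def[abs_def] using continuous_on_trace_wm[of w] by simp
next
  case (insert w W)
  have "min_trace (insert w W) = (\<lambda>u. min \<bar>trace (hexagon.wm u w)\<bar> (min_trace W u))"
    using insert.hyps by (simp add: min_trace_def fun_eq_iff)
  then show ?case using continuous_on_min[OF continuous_on_trace_wm[of w] insert.IH] by simp
qed

section \<open>The systole as a minimum over finitely many words\<close>

context hexagon
begin

text \<open>The bound on the length of competing words grows with the translation length and
  decreases in \<open>u\<close>, so one \<open>N\<close> serves a whole interval of parameters and
  lengths.\<close>

lemma reach_mono: "0 \<le> l \<Longrightarrow> l \<le> l' \<Longrightarrow> 0 < v \<Longrightarrow> v \<le> u \<Longrightarrow> u \<le> 1 \<Longrightarrow>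
    2 * cosh (l + 2 * arcosh (6 / sqrt u)) \<le> 2 * cosh (l' + 2 * arcosh (6 / sqrt v))"
proof -
  assume a: "0 \<le> l" "l \<le> l'" "0 < v" "v \<le> u" "u \<le> 1"
  have s: "0 < sqrt v" "sqrt v \<le> sqrt u" "sqrt u \<le> 1" using a by simp_all
  have "1 \<le> 6 / sqrt u" by (subst le_divide_eq_1_pos; use s in linarith)
  moreover have "6 / sqrt u \<le> 6 / sqrt v" by (intro divide_left_mono mult_pos_pos; use s in linarith)
  ultimately have d: "1 \<le> 6 / sqrt u" "6 / sqrt u \<le> 6 / sqrt v" .
  then have "0 \<le> arcosh (6 / sqrt u)" by simp
  moreover have "arcosh (6 / sqrt u) \<le> arcosh (6 / sqrt v)"
  proof (cases "6 / sqrt u = 6 / sqrt v")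
    case False
    then have "6 / sqrt u < 6 / sqrt v" using d(2) by linarith
    then show ?thesis by (rule less_imp_le[OF arcosh_real_strict_mono[OF d(1)]])
  qed (simp only: order_refl)
  ultimately show ?thesis using a by (simp add: cosh_real_nonneg_le_iff)
qed

lemma words_Gam:
  assumes "w \<in> words m N" shows "coset w \<in> Gam m" "coset w \<noteq> \<one>\<^bsub>PSL2R\<^esub>" "psl_trace (coset w) = \<bar>trace (wm w)\<bar>"
  using assms reduced_nontrivial[of w] by (auto simp: words_def Gam_def coset_trace)

lemma short_element_word:
  assumes "u \<le> 1" "m > 0" "\<gamma> \<in> Gam m" "\<gamma> \<noteq> \<one>\<^bsub>PSL2R\<^esub>" "psl_trace \<gamma> \<le> 2 * cosh (l / 2)" "l > 0"
    and N: "2 * cosh (l + 2 * arcosh (6 / sqrt u)) \<le> real N"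
  shows "\<exists>w\<in>words m N. \<bar>trace (wm w)\<bar> = psl_trace \<gamma>"
proof -
  interpret S: surface_group "Gam m" z0 by (rule surface_group_Gam[OF assms(1,2)])
  define l' where "l' = 2 * arcosh (psl_trace \<gamma> / 2)"
  have "psl_trace \<gamma> > 2" using S.trace_gt_2 assms(3,4) by blast
  then have l': "l' > 0" "psl_trace \<gamma> = 2 * cosh (l' / 2)" by (simp_all add: l'_def)
  have "cosh (l' / 2) \<le> cosh (l / 2)" using assms(5) l' by simp
  then have "l' \<le> l" using l'(1) assms(6) by (subst (asm) cosh_real_nonneg_le_iff) auto
  obtain w where w: "reduced w" "in_ker m w" "w \<noteq> []" "\<bar>trace (wm w)\<bar> = psl_trace \<gamma>"
      and len: "length w \<le> 2 * cosh (l' + 2 * arcosh (6 / sqrt u))"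
    using short_word[OF assms(1-3) l'] by blast
  have "length w \<le> real N"
    using len N reach_mono[of l' l u] l'(1) \<open>l' \<le> l\<close> u assms(1) by linarith
  then show ?thesis using w by (auto simp: words_def)
qed

text \<open>Elements of trace at most \<open>2 * cosh (l / 2)\<close> have the trace of a word in
  the list; the others cannot compete, because the minimum over the list does not exceed that
  number.\<close>

lemma systole_Gam:
  assumes "u \<le> 1" "m > 0" "words m N \<noteq> {}" "l > 0" "min_trace (words m N) u \<le> 2 * cosh (l / 2)"
    and N: "2 * cosh (l + 2 * arcosh (6 / sqrt u)) \<le> real N"
  shows "systole (quotient_surface (Gam m)) (quotient_dist (Gam m)) = 2 * arcosh (min_trace (words m N) u / 2)"
proof -
  interpret S: surface_group "Gam m" z0 by (rule surface_group_Gam[OF assms(1,2)])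
  obtain w where w: "w \<in> words m N" "\<bar>trace (wm w)\<bar> = min_trace (words m N) u"
    using min_trace_attained[OF finite_words' assms(3)] by blast
  have "psl_trace (coset w) \<le> psl_trace \<eta>" if \<eta>: "\<eta> \<in> Gam m" "\<eta> \<noteq> \<one>\<^bsub>PSL2R\<^esub>" for \<eta>
  proof (cases "psl_trace \<eta> \<le> 2 * cosh (l / 2)")
    case True
    then obtain v where v: "v \<in> words m N" "\<bar>trace (wm v)\<bar> = psl_trace \<eta>"
      using short_element_word[OF assms(1,2) \<eta> True assms(4) N] by blast
    then show ?thesis using min_trace_le[OF finite_words' v(1), of u] w words_Gam(3)[OF w(1)] by simp
  next
    case False
    then show ?thesis using w assms(5) words_Gam(3)[OF w(1)] by simp
  qed
  then show ?thesis using S.systole_eq[OF words_Gam(1,2)[OF w(1)]] words_Gam(3)[OF w(1)] w(2) by simp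
qed

end

text \<open>The interval corresponds to angles between \<open>s\<close> and \<open>s'\<close>. An
  odd \<open>n\<close> is chosen with \<open>2 * pi / n\<close> below the length of that range, and
  \<open>t\<close> is the first multiple of \<open>2 * pi / n\<close> strictly beyond
  \<open>s\<close>.\<close>

lemma cyclotomic_dense:
  fixes a b :: real
  assumes "0 < a" "a < b" "b \<le> 1"
  shows "\<exists>n t. odd n \<and> cos (of_nat n * t) = 1 \<and> a < 2 * cos t \<and> 2 * cos t < b"
proof -
  define s s' where "s = arccos (b / 2)" "s' = arccos (a / 2)"
  have s: "0 \<le> s" "s' \<le> pi" "cos s = b / 2" "cos s' = a / 2"
    using assms by (simp_all add: s_s'_def arccos_lbound arccos_ubound)
  have ss: "s < s'" unfolding s_s'_def using assms by (intro arccos_less_arccos) auto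
  obtain k where k: "real k > 2 * pi / (s' - s)" using reals_Archimedean2 by blast
  define n where "n = 2 * k + 1"
  define j where "j = \<lfloor>real n * s / (2 * pi)\<rfloor> + 1"
  define t where "t = 2 * pi * of_int j / real n"
  have n: "odd n" "real n > 0" "real n > real k" by (simp_all add: n_def)
  have nt: "real n * t = 2 * pi * of_int j" using n(2) by (simp add: t_def)
  have j: "real n * s / (2 * pi) < of_int j" "of_int j \<le> real n * s / (2 * pi) + 1"
    unfolding j_def by linarith+
  have "real n * s < real n * t" unfolding nt using j(1) by (simp add: pos_divide_less_eq mult.commute)
  then have st: "s < t" using n(2) by simp
  have "2 * pi < real n * (s' - s)"
  proof -
    have "2 * pi < real k * (s' - s)" using k ss by (simp add: pos_divide_less_eq)
    also have "\<dots> \<le> real n * (s' - s)" using n(3) ss by (intro mult_right_mono) auto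
    finally show ?thesis .
  qed
  moreover have "real n * t \<le> real n * s + 2 * pi"
  proof -
    have "2 * pi * of_int j \<le> 2 * pi * (real n * s / (2 * pi) + 1)" using j(2) by (intro mult_left_mono) auto
    also have "\<dots> = real n * s + 2 * pi" by (simp add: distrib_left)
    finally show ?thesis unfolding nt .
  qed
  ultimately have "real n * t < real n * s'" by (simp add: right_diff_distrib)
  then have ts: "t < s'" using n(2) by simp
  have "cos t < cos s" using s st ts by (intro cos_monotone_0_pi) auto
  moreover have "cos s' < cos t" using s st ts by (intro cos_monotone_0_pi) auto
  moreover have "cos (real n * t) = 1" unfolding nt by (rule cos_int_2pin)
  ultimately show ?thesis using n(1) s by (intro exI[of _ n] exI[of _ t]) auto
qed

text \<open>A small trace would be realised by a word of length at most a number \<open>N\<close>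
  determined by \<open>L\<close> alone, and \<open>m\<close> is chosen to exclude such words. The
  conclusion therefore holds for word lists of any length.\<close>

lemma trace_gt_at_1:
  assumes "L > 0"
  shows "\<exists>m>0. \<forall>N. \<forall>w\<in>words m N. \<bar>trace (H1.wm w)\<bar> > 2 * cosh (L / 2)"
proof -
  define N where "N = nat \<lceil>2 * cosh (L + 2 * arcosh (6 / sqrt 1))\<rceil>"
  obtain m where m: "m > 0" "words m N = {}" using deep_congruence[of N] by (auto simp: words_def)
  have "\<bar>trace (H1.wm w)\<bar> > 2 * cosh (L / 2)" if w: "w \<in> words m N'" for w N'
  proof (rule ccontr)
    assume "\<not> \<bar>trace (H1.wm w)\<bar> > 2 * cosh (L / 2)"
    then have "psl_trace (H1.coset w) \<le> 2 * cosh (L / 2)" using H1.words_Gam(3)[OF w] by simp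
    moreover have "2 * cosh (L + 2 * arcosh (6 / sqrt 1)) \<le> real N" unfolding N_def by (rule real_nat_ceiling_ge)
    ultimately have "\<exists>v\<in>words m N. \<bar>trace (H1.wm v)\<bar> = psl_trace (H1.coset w)"
      using H1.short_element_word[OF order_refl m(1) H1.words_Gam(1,2)[OF w]] assms by blast
    then show False using m(2) by blast
  qed
  then show ?thesis using m(1) by blast
qed

lemma short_word_at_small_parameter:
  assumes "m > 0" "L > 0"
  shows "\<exists>u>0. u < 1 \<and> (\<forall>N. 2 * cosh (L + 2 * arcosh (6 / sqrt u)) \<le> real N \<longrightarrow>
    (\<exists>w\<in>words m N. \<bar>trace (hexagon.wm u w)\<bar> < 2 * cosh (L / 2)))"
proof -
  obtain k where k: "k > 0" "in_ker m (concat (replicate k [B1, B2]))" using power_in_ker[OF assms(1)] by blast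
  define v where "v = concat (replicate k [B1, B2])"
  \<comment> \<open>For \<open>u = cosh a - 1\<close> the sides \<open>B1\<close> and
    \<open>B2\<close> have distance \<open>a\<close>, so the power with exponent \<open>k\<close>
    has translation length \<open>2 * k * a\<close>, at most \<open>L / 2\<close>. The bound
    \<open>arcosh (3 / 2)\<close> keeps \<open>u\<close> below 1.\<close>
  define a where "a = min (L / (4 * real k)) (arcosh (3 / 2))"
  have a: "0 < a" "a \<le> L / (4 * real k)" "a \<le> arcosh (3 / 2)" using assms k by (simp_all add: a_def)
  have ka: "0 < real k * a" "real k * a \<le> L / 4"
  proof -
    show "0 < real k * a" using a k by simp
    have "real k * a \<le> real k * (L / (4 * real k))" using a by (intro mult_left_mono) auto
    then show "real k * a \<le> L / 4" using k by simp
  qed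
  have "cosh a \<le> cosh (arcosh (3 / 2 :: real))" using a by (subst cosh_real_nonneg_le_iff) auto
  then have ca: "1 < cosh a" "cosh a \<le> 3 / 2" using cosh_real_nonneg_less_iff[of 0 a] a by simp_all
  define u where "u = cosh a - 1"
  have uu: "0 < u" "u < 1" using ca by (simp_all add: u_def)
  interpret hexagon u using uu by unfold_locales
  interpret S: surface_group "Gam m" z0 using surface_group_Gam uu assms(1) by simp
  have tr: "psl_trace (coset v) = 2 * cosh (real k * a)"
  proof -
    have "cosh a = cc u" by (simp add: u_def cc_def)
    then show ?thesis unfolding coset_trace v_def by (simp add: trace_power abs_mult power_abs)
  qed
  have "psl_trace (coset v) > 2" unfolding tr using ka(1) cosh_real_nonneg_less_iff[of 0 "real k * a"] by simp
  moreover have "psl_trace \<one>\<^bsub>PSL2R\<^esub> = 2" using coset_trace[of "[]"] by (simp add: coset_Nil mat2_one)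
  ultimately have v: "coset v \<in> Gam m" "coset v \<noteq> \<one>\<^bsub>PSL2R\<^esub>" using k(2) by (auto simp: Gam_def v_def)
  have lt: "psl_trace (coset v) < 2 * cosh (L / 2)"
    unfolding tr using ka assms by (simp add: cosh_real_nonneg_less_iff)
  have "\<exists>w\<in>words m N. \<bar>trace (wm w)\<bar> < 2 * cosh (L / 2)"
    if "2 * cosh (L + 2 * arcosh (6 / sqrt u)) \<le> real N" for N
    using short_element_word[OF less_imp_le[OF uu(2)] assms(1) v less_imp_le[OF lt] assms(2) that] lt by metis
  then show ?thesis using uu by blast
qed

lemma systole_approximation:
  assumes "L > 0" "\<epsilon> > 0"
  shows "\<exists>\<Gamma>. closed_surface_group \<Gamma> \<and> semi_arithmetic \<Gamma> \<and>
    \<bar>systole (quotient_surface \<Gamma>) (quotient_dist \<Gamma>) - L\<bar> < \<epsilon>"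
proof -
  \<comment> \<open>\<open>e \<le> L\<close> makes \<open>lo\<close> nonnegative, and
    \<open>e \<le> 1\<close> keeps \<open>hi\<close> within the lengths for which \<open>N\<close>
    is chosen.\<close>
  define e where "e = min \<epsilon> (min L 1)"
  have e: "0 < e" "e \<le> \<epsilon>" "e \<le> L" "e \<le> 1" using assms by (simp_all add: e_def)
  obtain m where m: "m > 0" and big: "\<And>N w. w \<in> words m N \<Longrightarrow> \<bar>trace (H1.wm w)\<bar> > 2 * cosh (L / 2)"
    using trace_gt_at_1[OF assms(1)] by blast
  obtain u0 where u0: "0 < u0" "u0 < 1" and small: "\<And>N. 2 * cosh (L + 2 * arcosh (6 / sqrt u0)) \<le> real N \<Longrightarrow>
      \<exists>w\<in>words m N. \<bar>trace (hexagon.wm u0 w)\<bar> < 2 * cosh (L / 2)"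
    using short_word_at_small_parameter[OF m assms(1)] by blast
  \<comment> \<open>Taken at the smallest parameter \<open>u0\<close> and at length
    \<open>L + 1\<close>, so that by \<open>reach_mono\<close> the list \<open>W\<close> decides the
    systole for every parameter of the interval and every length up to \<open>hi\<close>.\<close>
  define N where "N = nat \<lceil>2 * cosh ((L + 1) + 2 * arcosh (6 / sqrt u0))\<rceil>"
  have N: "2 * cosh ((L + 1) + 2 * arcosh (6 / sqrt u0)) \<le> real N" unfolding N_def by (rule real_nat_ceiling_ge)
  define W where "W = words m N"
  have W: "finite W" unfolding W_def by (rule finite_words')
  interpret U0: hexagon u0 using u0 by unfold_locales
  have "2 * cosh (L + 2 * arcosh (6 / sqrt u0)) \<le> real N"
    using U0.reach_mono[of L "L + 1" u0] assms u0 N by linarith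
  then obtain w0 where w0: "w0 \<in> W" "\<bar>trace (hexagon.wm u0 w0)\<bar> < 2 * cosh (L / 2)" using small W_def by blast
  then have ne: "W \<noteq> {}" by blast
  define F where "F = min_trace W"
  have cont: "continuous_on {u0..1} F"
    unfolding F_def by (rule continuous_on_subset[OF continuous_on_min_trace[OF W ne]]) (use u0 in auto)
  have F0: "F u0 < 2 * cosh (L / 2)" unfolding F_def using min_trace_le[OF W w0(1), of u0] w0(2) by linarith
  have F1: "F 1 > 2 * cosh (L / 2)"
  proof -
    obtain w where "w \<in> W" "\<bar>trace (H1.wm w)\<bar> = F 1" unfolding F_def by (rule min_trace_attained[OF W ne])
    then show ?thesis using big unfolding W_def by metis
  qed
  obtain x where x: "u0 \<le> x" "x \<le> 1" "F x = 2 * cosh (L / 2)"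
    using IVT'[of F u0 "2 * cosh (L / 2)" 1] F0 F1 u0 cont by auto
  then have x': "u0 < x" "x < 1" using F0 F1 by (auto simp: less_le)
  define lo hi where "lo = L - e" "hi = L + e"
  have lohi: "0 \<le> lo" "lo < L" "L < hi" "hi \<le> L + 1" using e by (simp_all add: lo_hi_def)
  \<comment> \<open>A window for the minimal trace that corresponds to lengths strictly between
    \<open>lo\<close> and \<open>hi\<close>.\<close>
  define \<eta> where "\<eta> = min (2 * cosh (L / 2) - 2 * cosh (lo / 2)) (2 * cosh (hi / 2) - 2 * cosh (L / 2))"
  have "\<eta> > 0" unfolding \<eta>_def using lohi assms by (simp add: cosh_real_nonneg_less_iff)
  then obtain \<delta> where \<delta>: "\<delta> > 0" "\<And>y. y \<in> {u0..1} \<Longrightarrow> dist y x < \<delta> \<Longrightarrow> dist (F y) (F x) < \<eta>"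
    using cont x unfolding continuous_on_iff by (metis atLeastAtMost_iff)
  have "\<exists>n t. odd n \<and> cos (of_nat n * t) = 1 \<and> max u0 (x - \<delta>) < 2 * cos t \<and> 2 * cos t < min 1 (x + \<delta>)"
    using x' \<delta>(1) u0 by (intro cyclotomic_dense) auto
  then obtain n t where n: "odd n" "cos (of_nat n * t) = 1"
    and t: "max u0 (x - \<delta>) < 2 * cos t" "2 * cos t < min 1 (x + \<delta>)" by blast
  define u where "u = 2 * cos t"
  have uu: "u0 < u" "u < 1" "\<bar>u - x\<bar> < \<delta>" using t by (auto simp: u_def)
  interpret hexagon u using uu u0 by unfold_locales simp
  interpret S: surface_group "Gam m" z0 using surface_group_Gam uu m by simp
  have "\<bar>F u - 2 * cosh (L / 2)\<bar> < \<eta>" using \<delta>(2)[of u] uu x(3) by (simp add: dist_real_def)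
  then have Fu: "2 * cosh (lo / 2) < F u" "F u < 2 * cosh (hi / 2)" unfolding \<eta>_def by linarith+
  have "2 * cosh (hi + 2 * arcosh (6 / sqrt u)) \<le> real N"
    using reach_mono[of hi "L + 1" u0] lohi assms uu u0 N by linarith
  then have sys: "systole (quotient_surface (Gam m)) (quotient_dist (Gam m)) = 2 * arcosh (F u / 2)"
    using systole_Gam[of m N hi] uu m ne Fu lohi assms unfolding F_def W_def by simp
  have "arcosh (cosh (lo / 2)) < arcosh (F u / 2)" "arcosh (F u / 2) < arcosh (cosh (hi / 2))"
  proof -
    have "1 \<le> cosh (lo / 2)" by (rule cosh_real_ge_1)
    then show "arcosh (cosh (lo / 2)) < arcosh (F u / 2)" "arcosh (F u / 2) < arcosh (cosh (hi / 2))"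
      using Fu by (intro arcosh_real_strict_mono; linarith)+
  qed
  then have "lo < 2 * arcosh (F u / 2)" "2 * arcosh (F u / 2) < hi"
    using lohi assms by (simp_all add: arcosh_cosh_real)
  then have "\<bar>systole (quotient_surface (Gam m)) (quotient_dist (Gam m)) - L\<bar> < \<epsilon>"
    unfolding sys using e by (simp add: lo_hi_def abs_less_iff)
  moreover have "semi_arithmetic (Gam m)"
    using semi_arithmetic_Gam[of m n t] uu m n by (simp add: u_def)
  ultimately show ?thesis using S.closed_surface_group by blast
qed

theorem theorem1p3:
  shows "{0<..} \<subseteq> closure {systole (quotient_surface \<Gamma>) (quotient_dist \<Gamma>) | \<Gamma>.
                          closed_surface_group \<Gamma> \<and> semi_arithmetic \<Gamma>}"
proof
  fix L :: real assume "L \<in> {0<..}"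
  then have "\<exists>\<Gamma>. closed_surface_group \<Gamma> \<and> semi_arithmetic \<Gamma> \<and>
      \<bar>systole (quotient_surface \<Gamma>) (quotient_dist \<Gamma>) - L\<bar> < \<epsilon>" if "\<epsilon> > 0" for \<epsilon>
    using systole_approximation that by simp
  then show "L \<in> closure {systole (quotient_surface \<Gamma>) (quotient_dist \<Gamma>) | \<Gamma>.
      closed_surface_group \<Gamma> \<and> semi_arithmetic \<Gamma>}"
    unfolding closure_approachable dist_real_def by blast
qed

end
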